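(* Let $\mathfrak{g}$ be a finite-dimensional Lie algebra over a field $\mathbb{F}$ of characteristic zero, and let $\Omega_1$, $A$, and $p_\gamma$ be as in the context. Assume that $\Omega_1$ has a greatest element $\mu$. A collection of elements \[ p^{(i)}\in S^{k_i}(\mathfrak{g}),\quad 1\le i\le r,\ k_i\in\mathbb{N}_+, \] is algebraically independent if and only if the collection \[ p^{(i)}_\omega\in S^{k_i}(\mathfrak{g}\otimes A),\quad 1\le i\le r,\ \omega\in k_i\mu-\Omega_1, \] is algebraically independent.
   Context: Tensor products are over $\mathbb{F}$; $\mathbb{N}=\{0,1,2,\dotsc\}$, $\mathbb{N}_+=\{1,2,\dotsc\}$. Fix $\ell\in\mathbb{N}$, $\Gamma=\mathbb{Z}^\ell$, $\Omega=\mathbb{N}^\ell$, with the componentwise partial order. Fix $\Omega_0\subseteq\Omega$ such that $\omega+\gamma\in\Omega_0$ for all $\omega\in\Omega$, $\gamma\in\Omega_0$, and such that $\Omega_1=\Omega\setminus\Omega_0$ is finite. Set $A=\mathbb{F}[t_1,\dotsc,t_\ell]/I$, where $I$ is the ideal spanned by $\{t^\omega\mid\omega\in\Omega_0\}$, $t^\omega=t_1^{\omega_1}\dotsm t_\ell^{\omega_\ell}$. Let $\tau^\omega$ be the image of $t^\omega$ in $A$; $\{\tau^\omega\mid\omega\in\Omega_1\}$ is a basis of $A$. If $\Omega_1$ has a greatest element $\mu$, then $\Omega_1=\{\omega\in\Omega\mid\omega\le\mu\}$. Here $k\mu-\Omega_1=\{k\mu-\omega\mid\omega\in\Omega_1\}$.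 Definition of $p_\gamma$: let $a=\sum_{\omega\in\Omega_1}\tau^\omega\in A$ and let $\tau_a\colon S(\mathfrak{g})\to S(\mathfrak{g}\otimes A)$ be the algebra homomorphism of symmetric algebras extending $x\mapsto x\otimes a$. The algebra $S(\mathfrak{g}\otimes A)$ is $\Gamma$-graded, with $x\otimes\tau^\omega$ of degree $\omega$. For $p\in S(\mathfrak{g})$ and $\gamma\in\Gamma$, $p_\gamma$ is the degree $\gamma$ component of $\tau_a(p)$. $S^k$ denotes the degree $k$ part of the symmetric algebra. *)

theory Defs
  imports
    "HOL-Algebra.Module"
    "HOL-Algebra.QuotRing"
    "HOL-Library.Poly_Mapping"
    "Jordan_Normal_Form.VS_Connect"
begin

text \<open>
  The base field is a type \<open>'f\<close> of class \<^class>\<open>field\<close>, used as the record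
  \<^term>\<open>class_ring :: 'f::field ring\<close>. Vector spaces and commutative algebras over it are
  both records of type \<open>('f, 'v) module\<close>; in a record that is meant only as a vector space, the
  fields \<^const>\<open>mult\<close> and \<^const>\<open>one\<close> are irrelevant.
\<close>

locale lie_algebra = vectorspace K L for K and L (structure) +
  fixes bracket :: "'c \<Rightarrow> 'c \<Rightarrow> 'c"
  assumes bracket_closed: "\<lbrakk>x \<in> carrier L; y \<in> carrier L\<rbrakk> \<Longrightarrow> bracket x y \<in> carrier L"
    and bracket_add_left: "\<lbrakk>x \<in> carrier L; y \<in> carrier L; z \<in> carrier L\<rbrakk> \<Longrightarrow>
      bracket (x \<oplus> y) z = bracket x z \<oplus> bracket y z"
    and bracket_add_right: "\<lbrakk>x \<in> carrier L; y \<in> carrier L; z \<in> carrier L\<rbrakk> \<Longrightarrow>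
      bracket x (y \<oplus> z) = bracket x y \<oplus> bracket x z"
    and bracket_smult_left: "\<lbrakk>c \<in> carrier K; x \<in> carrier L; y \<in> carrier L\<rbrakk> \<Longrightarrow>
      bracket (c \<odot> x) y = c \<odot> bracket x y"
    and bracket_smult_right: "\<lbrakk>c \<in> carrier K; x \<in> carrier L; y \<in> carrier L\<rbrakk> \<Longrightarrow>
      bracket x (c \<odot> y) = c \<odot> bracket x y"
    and bracket_alternating: "x \<in> carrier L \<Longrightarrow> bracket x x = \<zero>"
    and jacobi: "\<lbrakk>x \<in> carrier L; y \<in> carrier L; z \<in> carrier L\<rbrakk> \<Longrightarrow>
      bracket x (bracket y z) \<oplus> bracket y (bracket z x) \<oplus> bracket z (bracket x y) = \<zero>"

definition lin_span :: "('f::field, 'v) module \<Rightarrow> 'v set \<Rightarrow> 'v set" where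
  "lin_span V S = LinearCombinations.module.span class_ring V S"

text \<open>
  Quotient of a vector space by a subspace, or of an algebra by an ideal. The elements are
  cosets, and the scalar action is \<open>c \<cdot> (x + N) = c x + N\<close>.
\<close>

definition quot_module :: "('f, 'v) module \<Rightarrow> 'v set \<Rightarrow> ('f, 'v set) module" where
  "quot_module M N = ring.extend (M Quot N)
     (module.fields (\<lambda>c X. \<Union>x\<in>X. N +>\<^bsub>M\<^esub> (c \<odot>\<^bsub>M\<^esub> x)))"

definition alg_hom :: "('f::field, 'a) module \<Rightarrow> ('f, 'b) module \<Rightarrow> ('a \<Rightarrow> 'b) set" where
  "alg_hom A B = Ring.ring_hom A B \<inter> LinearCombinations.module_hom class_ring A B"


section \<open>Polynomials and algebraic independence\<close>

definition mpoly_algebra :: "'x set \<Rightarrow> ('f::field, ('x \<Rightarrow>\<^sub>0 nat) \<Rightarrow>\<^sub>0 'f) module" where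
  "mpoly_algebra X =
    \<lparr>carrier = {p. \<forall>m\<in>Poly_Mapping.keys p. Poly_Mapping.keys m \<subseteq> X},
     mult = (*), one = 1, zero = 0, add = (+),
     smult = (\<lambda>c p. Poly_Mapping.single 0 c * p)\<rparr>"

definition monomial :: "('x \<Rightarrow>\<^sub>0 nat) \<Rightarrow> ('x \<Rightarrow>\<^sub>0 nat) \<Rightarrow>\<^sub>0 'f::field" where
  "monomial m = Poly_Mapping.single m 1"

definition var :: "'x \<Rightarrow> ('x \<Rightarrow>\<^sub>0 nat) \<Rightarrow>\<^sub>0 'f::field" where
  "var x = monomial (Poly_Mapping.single x 1)"

definition alg_eval ::
  "('f::field, 'b) module \<Rightarrow> ('x \<Rightarrow> 'b) \<Rightarrow> (('x \<Rightarrow>\<^sub>0 nat) \<Rightarrow>\<^sub>0 'f) \<Rightarrow> 'b" where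
  "alg_eval B f P =
    (\<Oplus>\<^bsub>B\<^esub>m\<in>Poly_Mapping.keys P. Poly_Mapping.lookup P m \<odot>\<^bsub>B\<^esub>
      (\<Otimes>\<^bsub>B\<^esub>i\<in>Poly_Mapping.keys m. f i [^]\<^bsub>B\<^esub> Poly_Mapping.lookup m i))"

definition alg_indep :: "('f::field, 'b) module \<Rightarrow> 'x set \<Rightarrow> ('x \<Rightarrow> 'b) \<Rightarrow> bool" where
  "alg_indep B I f \<longleftrightarrow>
    (\<forall>P\<in>carrier (mpoly_algebra I). alg_eval B f P = \<zero>\<^bsub>B\<^esub> \<longrightarrow> P = 0)"


section \<open>Tensor products of vector spaces\<close>

definition free_module :: "'x set \<Rightarrow> ('f::field, 'x \<Rightarrow>\<^sub>0 'f) module" where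
  "free_module X =
    \<lparr>carrier = {u. Poly_Mapping.keys u \<subseteq> X},
     mult = undefined, one = undefined, zero = 0, add = (+),
     smult = (\<lambda>c. Poly_Mapping.map ((*) c))\<rparr>"

definition tensor_relations ::
  "('f::field, 'v) module \<Rightarrow> ('f, 'w) module \<Rightarrow> (('v \<times> 'w) \<Rightarrow>\<^sub>0 'f) set" where
  "tensor_relations V W =
    (let e = (\<lambda>v w. Poly_Mapping.single (v, w) 1) in
      {e (v \<oplus>\<^bsub>V\<^esub> v') w - e v w - e v' w | v v' w.
         v \<in> carrier V \<and> v' \<in> carrier V \<and> w \<in> carrier W} \<union>
      {e v (w \<oplus>\<^bsub>W\<^esub> w') - e v w - e v w' | v w w'.
         v \<in> carrier V \<and> w \<in> carrier W \<and> w' \<in> carrier W} \<union>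
      {e (c \<odot>\<^bsub>V\<^esub> v) w - Poly_Mapping.single (v, w) c | c v w.
         v \<in> carrier V \<and> w \<in> carrier W} \<union>
      {e v (c \<odot>\<^bsub>W\<^esub> w) - Poly_Mapping.single (v, w) c | c v w.
         v \<in> carrier V \<and> w \<in> carrier W})"

definition tensor_subspace ::
  "('f::field, 'v) module \<Rightarrow> ('f, 'w) module \<Rightarrow> (('v \<times> 'w) \<Rightarrow>\<^sub>0 'f) set" where
  "tensor_subspace V W =
    lin_span (free_module (carrier V \<times> carrier W)) (tensor_relations V W)"

definition tensor_module ::
  "('f::field, 'v) module \<Rightarrow> ('f, 'w) module \<Rightarrow> ('f, (('v \<times> 'w) \<Rightarrow>\<^sub>0 'f) set) module" where
  "tensor_module V W =
    quot_module (free_module (carrier V \<times> carrier W)) (tensor_subspace V W)"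

definition pure_tensor ::
  "('f::field, 'v) module \<Rightarrow> ('f, 'w) module \<Rightarrow> 'v \<Rightarrow> 'w \<Rightarrow> (('v \<times> 'w) \<Rightarrow>\<^sub>0 'f) set" where
  "pure_tensor V W v w =
    tensor_subspace V W +>\<^bsub>free_module (carrier V \<times> carrier W)\<^esub> Poly_Mapping.single (v, w) 1"


section \<open>Symmetric algebras\<close>

text \<open>
  \<open>S(V)\<close> is the free commutative algebra on the set \<open>V\<close>, modulo the relations which make the
  canonical map \<open>V \<rightarrow> S(V)\<close> linear.
\<close>

definition sym_relations :: "('f::field, 'v) module \<Rightarrow> (('v \<Rightarrow>\<^sub>0 nat) \<Rightarrow>\<^sub>0 'f) set" where
  "sym_relations V =
    {var (x \<oplus>\<^bsub>V\<^esub> y) - var x - var y | x y. x \<in> carrier V \<and> y \<in> carrier V} \<union>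
    {var (c \<odot>\<^bsub>V\<^esub> x) - Poly_Mapping.single 0 c * var x | c x. x \<in> carrier V}"

definition sym_ideal :: "('f::field, 'v) module \<Rightarrow> (('v \<Rightarrow>\<^sub>0 nat) \<Rightarrow>\<^sub>0 'f) set" where
  "sym_ideal V = Idl\<^bsub>mpoly_algebra (carrier V)\<^esub> (sym_relations V)"

definition sym_algebra ::
  "('f::field, 'v) module \<Rightarrow> ('f, (('v \<Rightarrow>\<^sub>0 nat) \<Rightarrow>\<^sub>0 'f) set) module" where
  "sym_algebra V = quot_module (mpoly_algebra (carrier V)) (sym_ideal V)"

definition sym_incl ::
  "('f::field, 'v) module \<Rightarrow> 'v \<Rightarrow> (('v \<Rightarrow>\<^sub>0 nat) \<Rightarrow>\<^sub>0 'f) set" where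
  "sym_incl V x = sym_ideal V +>\<^bsub>mpoly_algebra (carrier V)\<^esub> var x"

definition sym_power ::
  "('f::field, 'v) module \<Rightarrow> nat \<Rightarrow> (('v \<Rightarrow>\<^sub>0 nat) \<Rightarrow>\<^sub>0 'f) set set" where
  "sym_power V k = lin_span (sym_algebra V)
    {\<Otimes>\<^bsub>sym_algebra V\<^esub>j\<in>{..<k}. sym_incl V (x j) | x. x \<in> {..<k} \<rightarrow> carrier V}"

text \<open>The algebra homomorphism \<open>S(V) \<rightarrow> B\<close> extending a linear map \<open>f : V \<rightarrow> B\<close>.\<close>

definition sym_extend ::
  "('f::field, 'v) module \<Rightarrow> ('f, 'b) module \<Rightarrow> ('v \<Rightarrow> 'b) \<Rightarrow>
    (('v \<Rightarrow>\<^sub>0 nat) \<Rightarrow>\<^sub>0 'f) set \<Rightarrow> 'b" where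
  "sym_extend V B f =
    (THE h. h \<in> alg_hom (sym_algebra V) B \<and> h \<in> extensional (carrier (sym_algebra V)) \<and>
      (\<forall>x\<in>carrier V. h (sym_incl V x) = f x))"


section \<open>The truncated polynomial algebra \<open>A\<close>\<close>

text \<open>
  Elements of \<open>\<nat>\<^sup>\<ell>\<close> are exponents in the variables \<open>0, \<dots>, \<ell> - 1\<close>. The order instance of
  \<open>\<Rightarrow>\<^sub>0\<close> is lexicographic, so the componentwise order is stated on \<^const>\<open>Poly_Mapping.lookup\<close>.
\<close>

definition exps :: "nat \<Rightarrow> (nat \<Rightarrow>\<^sub>0 nat) set" where
  "exps l = {w. Poly_Mapping.keys w \<subseteq> {..<l}}"

definition degs :: "nat \<Rightarrow> (nat \<Rightarrow> int) set" where
  "degs l = {\<gamma>. \<forall>j\<ge>l. \<gamma> j = 0}"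

definition exp_le :: "(nat \<Rightarrow>\<^sub>0 nat) \<Rightarrow> (nat \<Rightarrow>\<^sub>0 nat) \<Rightarrow> bool" where
  "exp_le v w \<longleftrightarrow> (\<forall>j. Poly_Mapping.lookup v j \<le> Poly_Mapping.lookup w j)"

definition trunc_ideal :: "nat \<Rightarrow> (nat \<Rightarrow>\<^sub>0 nat) set \<Rightarrow> ((nat \<Rightarrow>\<^sub>0 nat) \<Rightarrow>\<^sub>0 'f::field) set" where
  "trunc_ideal l \<Omega>0 = lin_span (mpoly_algebra {..<l}) (monomial ` \<Omega>0)"

definition trunc_algebra ::
  "nat \<Rightarrow> (nat \<Rightarrow>\<^sub>0 nat) set \<Rightarrow> ('f::field, ((nat \<Rightarrow>\<^sub>0 nat) \<Rightarrow>\<^sub>0 'f) set) module" where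
  "trunc_algebra l \<Omega>0 = quot_module (mpoly_algebra {..<l}) (trunc_ideal l \<Omega>0)"

definition trunc_mono ::
  "nat \<Rightarrow> (nat \<Rightarrow>\<^sub>0 nat) set \<Rightarrow> (nat \<Rightarrow>\<^sub>0 nat) \<Rightarrow> ((nat \<Rightarrow>\<^sub>0 nat) \<Rightarrow>\<^sub>0 'f::field) set" where
  "trunc_mono l \<Omega>0 w =
    trunc_ideal l \<Omega>0 +>\<^bsub>(mpoly_algebra {..<l} :: ('f, (nat \<Rightarrow>\<^sub>0 nat) \<Rightarrow>\<^sub>0 'f) module)\<^esub> monomial w"


section \<open>The elements \<open>p\<^sub>\<gamma>\<close>\<close>

type_synonym ('f, 'g) tensor_trunc =
  "(('g \<times> ((nat \<Rightarrow>\<^sub>0 nat) \<Rightarrow>\<^sub>0 'f) set) \<Rightarrow>\<^sub>0 'f) set"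

type_synonym ('f, 'v) sym = "(('v \<Rightarrow>\<^sub>0 nat) \<Rightarrow>\<^sub>0 'f) set"

definition current_space ::
  "('f::field, 'g) module \<Rightarrow> nat \<Rightarrow> (nat \<Rightarrow>\<^sub>0 nat) set \<Rightarrow> ('f, ('f, 'g) tensor_trunc) module" where
  "current_space L l \<Omega>0 = tensor_module L (trunc_algebra l \<Omega>0)"

definition tau_hom ::
  "('f::field, 'g) module \<Rightarrow> nat \<Rightarrow> (nat \<Rightarrow>\<^sub>0 nat) set \<Rightarrow>
    ('f, 'g) sym \<Rightarrow> ('f, ('f, 'g) tensor_trunc) sym" where
  "tau_hom L l \<Omega>0 =
    (let A = trunc_algebra l \<Omega>0; V = current_space L l \<Omega>0;
         a = (\<Oplus>\<^bsub>A\<^esub>w\<in>exps l - \<Omega>0. trunc_mono l \<Omega>0 w)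
     in sym_extend L (sym_algebra V) (\<lambda>x. sym_incl V (pure_tensor L A x a)))"

text \<open>
  The degree \<open>\<gamma>\<close> part of \<open>S(\<gg> \<otimes> A)\<close>, spanned by the products
  \<open>(x\<^sub>1 \<otimes> \<tau>\<^sup>\<omega>\<^sup>1) \<cdots> (x\<^sub>n \<otimes> \<tau>\<^sup>\<omega>\<^sup>n)\<close> whose exponents add up to \<open>\<gamma>\<close>.
\<close>

definition sym_degree_part ::
  "('f::field, 'g) module \<Rightarrow> nat \<Rightarrow> (nat \<Rightarrow>\<^sub>0 nat) set \<Rightarrow> (nat \<Rightarrow> int) \<Rightarrow>
    ('f, ('f, 'g) tensor_trunc) sym set" where
  "sym_degree_part L l \<Omega>0 \<gamma> =
    (let A = trunc_algebra l \<Omega>0; V = current_space L l \<Omega>0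
     in lin_span (sym_algebra V)
       {\<Otimes>\<^bsub>sym_algebra V\<^esub>i\<in>{..<n::nat}. sym_incl V (pure_tensor L A (x i) (trunc_mono l \<Omega>0 (w i)))
        | n x w. x \<in> {..<n} \<rightarrow> carrier L \<and> w \<in> {..<n} \<rightarrow> exps l - \<Omega>0 \<and>
            (\<forall>j. (\<Sum>i<n. int (Poly_Mapping.lookup (w i) j)) = \<gamma> j)})"

text \<open>The degree \<open>\<gamma>\<close> component of \<open>s\<close>: decompose \<open>s\<close> as a finite sum of homogeneous elements \<open>q \<delta>\<close>.\<close>

definition sym_component ::
  "('f::field, 'g) module \<Rightarrow> nat \<Rightarrow> (nat \<Rightarrow>\<^sub>0 nat) set \<Rightarrow> (nat \<Rightarrow> int) \<Rightarrow>
    ('f, ('f, 'g) tensor_trunc) sym \<Rightarrow> ('f, ('f, 'g) tensor_trunc) sym" where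
  "sym_component L l \<Omega>0 \<gamma> s =
    (let S = sym_algebra (current_space L l \<Omega>0)
     in THE u. \<exists>q. (\<forall>\<delta>\<in>degs l. q \<delta> \<in> sym_degree_part L l \<Omega>0 \<delta>) \<and>
          finite {\<delta>\<in>degs l. q \<delta> \<noteq> \<zero>\<^bsub>S\<^esub>} \<and>
          s = (\<Oplus>\<^bsub>S\<^esub>\<delta>\<in>{\<delta>\<in>degs l. q \<delta> \<noteq> \<zero>\<^bsub>S\<^esub>}. q \<delta>) \<and> u = q \<gamma>)"

definition p_comp ::
  "('f::field, 'g) module \<Rightarrow> nat \<Rightarrow> (nat \<Rightarrow>\<^sub>0 nat) set \<Rightarrow>
    ('f, 'g) sym \<Rightarrow> (nat \<Rightarrow> int) \<Rightarrow> ('f, ('f, 'g) tensor_trunc) sym" where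
  "p_comp L l \<Omega>0 p \<gamma> = sym_component L l \<Omega>0 \<gamma> (tau_hom L l \<Omega>0 p)"

definition mult_minus :: "nat \<Rightarrow> (nat \<Rightarrow>\<^sub>0 nat) \<Rightarrow> (nat \<Rightarrow>\<^sub>0 nat) set \<Rightarrow> (nat \<Rightarrow> int) set" where
  "mult_minus k \<mu> W =
    {\<lambda>j. int k * int (Poly_Mapping.lookup \<mu> j) - int (Poly_Mapping.lookup w j) | w. w \<in> W}"

end

theory Submission
  imports Defs "HOL-Library.Product_Lexorder" "HOL-Library.Function_Algebras"
begin

text \<open>
  A basis \<open>x\<^sub>1, \<dots>, x\<^sub>n\<close> of \<open>\<gg>\<close> identifies \<open>S(\<gg>)\<close> with the polynomials in \<open>x\<^sub>1, \<dots>, x\<^sub>n\<close>, and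
  \<open>S(\<gg> \<otimes> A)\<close> with the polynomials in variables \<open>(j, \<omega>)\<close> for \<open>\<omega> \<in> \<Omega>1\<close>, where \<open>(j, \<omega>)\<close> stands for
  \<open>x\<^sub>j \<otimes> \<tau>\<^sup>\<omega>\<close>. Then \<open>\<tau>\<^sub>a\<close> is the substitution \<open>x\<^sub>j \<mapsto> \<Sum>\<^sub>\<omega> (j, \<omega>)\<close>, called \<open>hat\<close> below, and
  \<open>p\<^sub>\<gamma>\<close> is the component of \<open>hat p\<close> of weight \<open>\<gamma>\<close>, where \<open>(j, \<omega>)\<close> has weight \<open>\<omega>\<close>. This
  translation is the content of the lemmas \<open>phi_tau\<close> and \<open>phi_component\<close>; it rests on coordinates for
  \<open>\<gg> \<otimes> A\<close> (\<open>tensor_coord_system\<close>) and on the isomorphism \<open>phi\<close> from a symmetric algebra to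
  polynomials.

  It remains to prove \<open>pindep_components_iff\<close>, a statement about polynomials. If \<open>p\<close> has degree
  \<open>k\<close>, no weight in \<open>hat p\<close> exceeds \<open>k \<mu>\<close>, and \<open>p\<^bsub>k\<mu>\<^esub>\<close> is \<open>p\<close> itself in the variables
  \<open>(j, \<mu>)\<close>. As \<open>0 \<in> \<Omega>1\<close>, the second collection thus contains a copy of the first one, which is
  therefore independent if the second one is.

  The converse uses the Jacobian criterion in characteristic zero, in both directions
  (\<open>jacobian_if_pindep\<close> and \<open>pindep_if_rows_independent\<close>). The derivative of \<open>p\<^bsub>k\<mu>-\<omega>\<^esub>\<close> by
  \<open>(j, \<mu> - \<omega>')\<close> is the component of \<open>hat (\<partial>p/\<partial>x\<^sub>j)\<close> of weight \<open>(k - 1) \<mu> - (\<omega> - \<omega>')\<close>. It is zero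
  unless \<open>\<omega>' \<le> \<omega>\<close>, because \<open>\<partial>p/\<partial>x\<^sub>j\<close> has degree \<open>k - 1\<close>, and for \<open>\<omega>' = \<omega>\<close> it is
  \<open>\<partial>p/\<partial>x\<^sub>j\<close> in the variables \<open>(j, \<mu>)\<close>. Hence the Jacobian matrix of the second collection is
  block triangular, and its diagonal blocks are copies of the Jacobian matrix of the first one. If the
  first collection is independent, these blocks have independent rows, hence so has the whole matrix,
  and the second collection is independent.
\<close>

section \<open>Polynomials over an arbitrary set of variables\<close>

abbreviation keys :: "('a \<Rightarrow>\<^sub>0 'b::zero) \<Rightarrow> 'a set" where
  "keys \<equiv> Poly_Mapping.keys"

abbreviation lookup :: "('a \<Rightarrow>\<^sub>0 'b::zero) \<Rightarrow> 'a \<Rightarrow> 'b" where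
  "lookup \<equiv> Poly_Mapping.lookup"

type_synonym ('x, 'f) mpoly = "('x \<Rightarrow>\<^sub>0 nat) \<Rightarrow>\<^sub>0 'f"

abbreviation Const :: "'f::field \<Rightarrow> ('x, 'f) mpoly" where
  "Const c \<equiv> Poly_Mapping.single 0 c"

abbreviation polys :: "'x set \<Rightarrow> ('x, 'f::field) mpoly set" where
  "polys X \<equiv> {p. \<forall>m\<in>keys p. keys m \<subseteq> X}"

lemma poly_mapping_additive_induct:
  assumes single: "\<And>m c. P (Poly_Mapping.single m c)"
    and add: "\<And>a b. P a \<Longrightarrow> P b \<Longrightarrow> P (a + b)"
  shows "P (p :: 'a \<Rightarrow>\<^sub>0 'b::comm_monoid_add)"
proof -
  have eq: "p = (\<Sum>m\<in>keys p. Poly_Mapping.single m (lookup p m))"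
    by (rule poly_mapping_eqI)
      (simp add: lookup_sum lookup_single when_def in_keys_iff sum.If_cases Int_def)
  have "P (\<Sum>m\<in>S. Poly_Mapping.single m (lookup p m))" if "finite S" for S
    using that
  proof induction
    case empty
    show ?case using single[of undefined 0] by simp
  next
    case (insert x F)
    then show ?case by (simp add: add single)
  qed
  then show ?thesis by (subst eq) simp
qed

lemma sum_keys_superset:
  assumes "finite S" "keys P \<subseteq> S" "\<And>m. F m 0 = 0"
  shows "(\<Sum>m\<in>keys P. F m (lookup P m)) = (\<Sum>m\<in>S. F m (lookup P m))"
  using assms by (intro sum.mono_neutral_left) (auto simp: in_keys_iff)

lemma sum_keys_add:
  fixes P Q :: "'m \<Rightarrow>\<^sub>0 'c::comm_monoid_add" and F :: "'m \<Rightarrow> 'c \<Rightarrow> 'b::comm_monoid_add"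
  assumes zero: "\<And>m. F m 0 = 0" and add: "\<And>m a b. F m (a + b) = F m a + F m b"
  shows "(\<Sum>m\<in>keys (P + Q). F m (lookup (P + Q) m)) =
    (\<Sum>m\<in>keys P. F m (lookup P m)) + (\<Sum>m\<in>keys Q. F m (lookup Q m))"
proof -
  let ?S = "keys P \<union> keys Q"
  have "(\<Sum>m\<in>keys (P + Q). F m (lookup (P + Q) m)) = (\<Sum>m\<in>?S. F m (lookup (P + Q) m))"
    using keys_add[of P Q] by (intro sum_keys_superset) (auto simp: zero)
  also have "\<dots> = (\<Sum>m\<in>?S. F m (lookup P m)) + (\<Sum>m\<in>?S. F m (lookup Q m))"
    by (simp add: lookup_add add sum.distrib)
  also have "(\<Sum>m\<in>?S. F m (lookup P m)) = (\<Sum>m\<in>keys P. F m (lookup P m))"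
    by (intro sum_keys_superset[symmetric]) (auto simp: zero)
  also have "(\<Sum>m\<in>?S. F m (lookup Q m)) = (\<Sum>m\<in>keys Q. F m (lookup Q m))"
    by (intro sum_keys_superset[symmetric]) (auto simp: zero)
  finally show ?thesis .
qed

lemma sum_keys_single:
  assumes "F m 0 = 0"
  shows "(\<Sum>n\<in>keys (Poly_Mapping.single m c). F n (lookup (Poly_Mapping.single m c) n)) = F m c"
  using assms by (cases "c = 0") auto

lemma Const_mult_single [simp]:
  "Const c * Poly_Mapping.single m d = Poly_Mapping.single m (c * d :: 'f::field)"
  by (simp add: mult_single)

lemma lookup_Const_mult [simp]: "lookup (Const c * p) m = c * lookup p (m :: 'x \<Rightarrow>\<^sub>0 nat)"
  by (induction p rule: poly_mapping_additive_induct)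
    (simp_all add: lookup_single when_def distrib_left lookup_add)

lemma monomial_split_variable:
  "m \<noteq> 0 \<Longrightarrow> \<exists>x\<in>keys m. \<exists>n. m = Poly_Mapping.single x (1::nat) + n"
proof -
  assume "m \<noteq> 0"
  then obtain x where x: "x \<in> keys m" by (metis all_not_in_conv keys_eq_empty)
  then have "m = Poly_Mapping.single x 1 + (m - Poly_Mapping.single x 1)"
    by (intro poly_mapping_eqI) (auto simp: lookup_add lookup_minus lookup_single when_def in_keys_iff)
  with x show ?thesis by blast
qed

subsection \<open>Weights of monomials\<close>

definition wdeg :: "('x \<Rightarrow> 'w::comm_semiring_1) \<Rightarrow> ('x \<Rightarrow>\<^sub>0 nat) \<Rightarrow> 'w" where
  "wdeg w m = (\<Sum>x\<in>keys m. of_nat (lookup m x) * w x)"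

lemma wdeg_add [simp]: "wdeg w (m + n) = wdeg w m + wdeg w n"
  unfolding wdeg_def by (rule sum_keys_add) (simp_all add: distrib_right)

lemma wdeg_0 [simp]: "wdeg w 0 = 0"
  by (simp add: wdeg_def)

lemma wdeg_single [simp]: "wdeg w (Poly_Mapping.single x k) = of_nat k * w x"
  by (simp add: wdeg_def)

abbreviation mdeg :: "('x \<Rightarrow>\<^sub>0 nat) \<Rightarrow> nat" where
  "mdeg \<equiv> wdeg (\<lambda>_. 1)"

lemma monomial_induct [consumes 1, case_names one var_mult]:
  assumes "keys m \<subseteq> X" "P 0"
    and step: "\<And>x n. x \<in> X \<Longrightarrow> keys n \<subseteq> X \<Longrightarrow> P n \<Longrightarrow> P (Poly_Mapping.single x (1::nat) + n)"
  shows "P m"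
  using assms(1)
proof (induction "mdeg m" arbitrary: m rule: less_induct)
  case less
  show ?case
  proof (cases "m = 0")
    case False
    then obtain x n where x: "x \<in> keys m" and m: "m = Poly_Mapping.single x 1 + n"
      using monomial_split_variable by blast
    have "keys n \<subseteq> keys m" unfolding m by (auto simp: in_keys_iff lookup_add)
    moreover have "mdeg n < mdeg m" unfolding m by simp
    ultimately show ?thesis using less x m step by blast
  qed (use assms in simp)
qed

lemma polys_add: "a \<in> polys X \<Longrightarrow> b \<in> polys X \<Longrightarrow> a + b \<in> polys X"
  using keys_add[of a b] by blast

lemma polys_uminus: "a \<in> polys X \<Longrightarrow> - a \<in> polys X"
  by (simp add: keys_def)

lemma polys_diff: "a \<in> polys X \<Longrightarrow> b \<in> polys X \<Longrightarrow> a - b \<in> polys X"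
  using polys_add[of a X "- b"] polys_uminus[of b X] by simp

lemma polys_mult: "a \<in> polys X \<Longrightarrow> b \<in> polys X \<Longrightarrow> a * b \<in> polys X"
proof -
  assume a: "a \<in> polys X" and b: "b \<in> polys X"
  have "keys m \<subseteq> X" if m: "m \<in> keys (a * b)" for m
  proof -
    obtain k l where "m = k + l" "k \<in> keys a" "l \<in> keys b"
      using subsetD[OF keys_mult m] by blast
    then show ?thesis using a b keys_add[of k l] by blast
  qed
  then show ?thesis by blast
qed

lemma polys_Const: "Const c \<in> polys X"
  by simp

lemma polys_var: "x \<in> X \<Longrightarrow> var x \<in> polys X"
  by (simp add: var_def monomial_def)

lemma polys_0: "0 \<in> polys X" and polys_1: "1 \<in> polys X"
  using polys_Const[of 0 X] polys_Const[of 1 X] by simp_all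

lemma polys_sum: "(\<And>i. i \<in> S \<Longrightarrow> f i \<in> polys X) \<Longrightarrow> sum f S \<in> polys X"
  by (induction S rule: infinite_finite_induct)
    (simp_all add: polys_add polys_0 del: mem_Collect_eq)

text \<open>
  Constants and variables generate the polynomials under sum and product, so an identity between
  maps that respect both operations has to be checked on generators only.
\<close>

lemma mpoly_induct [consumes 1, case_names Const var add mult]:
  fixes q :: "('x, 'f::field) mpoly"
  assumes q: "q \<in> polys X"
    and Const: "\<And>c. P (Const c)"
    and var: "\<And>x. x \<in> X \<Longrightarrow> P (var x)"
    and add: "\<And>a b. a \<in> polys X \<Longrightarrow> b \<in> polys X \<Longrightarrow> P a \<Longrightarrow> P b \<Longrightarrow> P (a + b)"
    and mult: "\<And>a b. a \<in> polys X \<Longrightarrow> b \<in> polys X \<Longrightarrow> P a \<Longrightarrow> P b \<Longrightarrow> P (a * b)"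
  shows "P q"
proof -
  have mono: "P (Poly_Mapping.single m 1)" if "keys m \<subseteq> X" for m
    using that
  proof (induction rule: monomial_induct)
    case one
    show ?case using Const by blast
  next
    case (var_mult x n)
    have "P (var x * Poly_Mapping.single n 1)"
      using var_mult var by (intro mult) (auto simp: var_def monomial_def)
    then show ?case by (simp add: var_def monomial_def mult_single)
  qed
  have single: "P (Poly_Mapping.single m c)" if "keys m \<subseteq> X" for m c
  proof -
    have "P (Const c * Poly_Mapping.single m 1)"
      by (rule mult) (simp_all add: that mono Const)
    then show ?thesis by simp
  qed
  have "P (\<Sum>m\<in>S. Poly_Mapping.single m (lookup q m)) \<and>
      (\<Sum>m\<in>S. Poly_Mapping.single m (lookup q m)) \<in> polys X"
    if "finite S" "S \<subseteq> keys q" for S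
    using that
  proof induction
    case empty
    show ?case using Const[of 0] by simp
  next
    case (insert m S)
    then have m: "keys m \<subseteq> X" using q by auto
    have 1: "Poly_Mapping.single m (lookup q m) \<in> polys X" using m by auto
    have IH: "P (\<Sum>m\<in>S. Poly_Mapping.single m (lookup q m))"
      "(\<Sum>m\<in>S. Poly_Mapping.single m (lookup q m)) \<in> polys X"
      using insert by blast+
    show ?case
      unfolding sum.insert[OF insert(1,2)]
      using add[OF 1 IH(2) single[OF m] IH(1)] polys_add[OF 1 IH(2)] by blast
  qed
  then have "P (\<Sum>m\<in>keys q. Poly_Mapping.single m (lookup q m))" by simp
  also have "(\<Sum>m\<in>keys q. Poly_Mapping.single m (lookup q m)) = q"
    by (rule poly_mapping_eqI)
      (simp add: lookup_sum lookup_single when_def in_keys_iff sum.If_cases Int_def)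
  finally show ?thesis .
qed

subsection \<open>Substitution\<close>

definition mval :: "('x \<Rightarrow> 'b::comm_semiring_1) \<Rightarrow> ('x \<Rightarrow>\<^sub>0 nat) \<Rightarrow> 'b" where
  "mval \<sigma> m = (\<Prod>x\<in>keys m. \<sigma> x ^ lookup m x)"

definition psubst :: "('x \<Rightarrow> ('y, 'f) mpoly) \<Rightarrow> ('x, 'f::field) mpoly \<Rightarrow> ('y, 'f) mpoly" where
  "psubst \<sigma> p = (\<Sum>m\<in>keys p. Const (lookup p m) * mval \<sigma> m)"

lemma mval_superset:
  assumes "finite S" "keys m \<subseteq> S"
  shows "mval \<sigma> m = (\<Prod>x\<in>S. \<sigma> x ^ lookup m x)"
  unfolding mval_def using assms by (intro prod.mono_neutral_left) (auto simp: in_keys_iff)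

lemma mval_add: "mval \<sigma> (m + n) = mval \<sigma> m * mval \<sigma> n"
proof -
  let ?S = "keys m \<union> keys n"
  have "mval \<sigma> (m + n) = (\<Prod>x\<in>?S. \<sigma> x ^ lookup (m + n) x)"
    using keys_add[of m n] by (intro mval_superset) auto
  then show ?thesis
    by (simp add: lookup_add power_add prod.distrib mval_superset[of ?S])
qed

lemma mval_0 [simp]: "mval \<sigma> 0 = 1"
  by (simp add: mval_def)

lemma mval_single [simp]: "mval \<sigma> (Poly_Mapping.single x k) = \<sigma> x ^ k"
  by (simp add: mval_def)

lemma psubst_single [simp]: "psubst \<sigma> (Poly_Mapping.single m c) = Const c * mval \<sigma> m"
  unfolding psubst_def by (rule sum_keys_single) simp

lemma psubst_add: "psubst \<sigma> (p + q) = psubst \<sigma> p + psubst \<sigma> q"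
  unfolding psubst_def by (rule sum_keys_add) (simp_all add: single_add distrib_right)

lemma psubst_mult:
  fixes \<sigma> :: "'x \<Rightarrow> ('y, 'f::field) mpoly"
  shows "psubst \<sigma> (p * q) = psubst \<sigma> p * psubst \<sigma> q"
proof (induction p rule: poly_mapping_additive_induct)
  case (1 m c)
  show ?case
  proof (induction q rule: poly_mapping_additive_induct)
    case (1 n d)
    have c: "Const (c * d) = Const c * (Const d :: ('y, 'f) mpoly)" by simp
    have "psubst \<sigma> (Poly_Mapping.single m c * Poly_Mapping.single n d) =
        Const (c * d) * (mval \<sigma> m * mval \<sigma> n)"
      by (simp only: mult_single psubst_single mval_add)
    then show ?case by (simp only: c psubst_single mult_ac)
  qed (simp add: distrib_left psubst_add)
qed (simp add: distrib_right psubst_add)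

lemma psubst_0 [simp]: "psubst \<sigma> 0 = 0"
  by (simp add: psubst_def)

lemma psubst_1 [simp]: "psubst \<sigma> 1 = 1"
  using psubst_single[of \<sigma> 0 1] by simp

lemma psubst_var [simp]: "psubst \<sigma> (var x) = \<sigma> x"
  by (simp add: var_def monomial_def)

lemma psubst_uminus: "psubst \<sigma> (- p) = - psubst \<sigma> p"
  using psubst_add[of \<sigma> p "- p"] by (simp add: eq_neg_iff_add_eq_0 add.commute)

lemma psubst_diff: "psubst \<sigma> (p - q) = psubst \<sigma> p - psubst \<sigma> q"
  using psubst_add[of \<sigma> p "- q"] by (simp add: psubst_uminus)

lemma psubst_sum: "psubst \<sigma> (sum f S) = (\<Sum>i\<in>S. psubst \<sigma> (f i))"
  by (induction S rule: infinite_finite_induct) (simp_all add: psubst_add)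

text \<open>
  Recognises a map as a substitution without expanding polynomials into monomials; \<open>H\<close> has to
  be a homomorphism on the polynomials in \<open>X\<close> only, as is the case for maps defined on cosets.
\<close>

lemma hom_eq_psubst:
  fixes H :: "('x, 'f::field) mpoly \<Rightarrow> ('y, 'f) mpoly"
  assumes q: "q \<in> polys X"
    and "\<And>c. H (Const c) = Const c"
    and "\<And>x. x \<in> X \<Longrightarrow> H (var x) = \<sigma> x"
    and "\<And>a b. a \<in> polys X \<Longrightarrow> b \<in> polys X \<Longrightarrow> H (a + b) = H a + H b"
    and "\<And>a b. a \<in> polys X \<Longrightarrow> b \<in> polys X \<Longrightarrow> H (a * b) = H a * H b"
  shows "H q = psubst \<sigma> q"
  using q by (induction rule: mpoly_induct) (simp_all add: assms psubst_add psubst_mult)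

lemma psubst_psubst: "psubst \<sigma> (psubst \<rho> q) = psubst (\<lambda>x. psubst \<sigma> (\<rho> x)) q"
  by (rule hom_eq_psubst[where X = UNIV and H = "\<lambda>q. psubst \<sigma> (psubst \<rho> q)"])
    (simp_all add: psubst_add psubst_mult)

lemma psubst_var_id: "psubst var q = q"
  by (rule hom_eq_psubst[where X = UNIV and H = "\<lambda>q. q", symmetric]) simp_all

lemma psubst_cong:
  assumes "q \<in> polys X" "\<And>x. x \<in> X \<Longrightarrow> \<sigma> x = \<rho> x"
  shows "psubst \<sigma> q = psubst \<rho> q"
  using assms(1) by (induction rule: mpoly_induct) (simp_all add: psubst_add psubst_mult assms)

lemma polys_psubst:
  assumes "q \<in> polys X" "\<And>x. x \<in> X \<Longrightarrow> \<sigma> x \<in> polys Y"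
  shows "psubst \<sigma> q \<in> polys Y"
  using assms(1)
proof (induction rule: mpoly_induct)
  case (Const c)
  then show ?case by simp
next
  case (var x)
  then show ?case using assms by simp
next
  case (add a b)
  then show ?case unfolding psubst_add by (intro polys_add)
next
  case (mult a b)
  then show ?case unfolding psubst_mult by (intro polys_mult)
qed

subsection \<open>Partial derivatives and derivations\<close>

definition pdiff :: "'x \<Rightarrow> ('x, 'f::field) mpoly \<Rightarrow> ('x, 'f) mpoly" where
  "pdiff x p = (\<Sum>m\<in>keys p.
     Poly_Mapping.single (m - Poly_Mapping.single x 1) (of_nat (lookup m x) * lookup p m))"

definition derivation :: "(('x, 'f::field) mpoly \<Rightarrow> ('x, 'f) mpoly) \<Rightarrow> bool" where
  "derivation D \<longleftrightarrow> (\<forall>a b. D (a + b) = D a + D b) \<and> (\<forall>a b. D (a * b) = a * D b + D a * b) \<and>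
    (\<forall>c. D (Const c) = 0)"

lemma pdiff_single [simp]:
  "pdiff x (Poly_Mapping.single m c) =
    Poly_Mapping.single (m - Poly_Mapping.single x 1) (of_nat (lookup m x) * c)"
  unfolding pdiff_def by (rule sum_keys_single) simp

lemma pdiff_add: "pdiff x (p + q) = pdiff x p + pdiff x q"
  unfolding pdiff_def by (rule sum_keys_add) (simp_all add: single_add distrib_left)

lemma pdiff_0 [simp]: "pdiff x 0 = 0"
  by (simp add: pdiff_def)

lemma pdiff_mult: "pdiff x (p * q) = p * pdiff x q + pdiff x p * (q :: ('x, 'f::field) mpoly)"
proof (induction p rule: poly_mapping_additive_induct)
  case (1 m c)
  show ?case
  proof (induction q rule: poly_mapping_additive_induct)
    case (1 n d)
    define e where "e = Poly_Mapping.single x (1::nat)"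
    have shift: "(k + k') - e = (k - e) + k'" if "lookup k x \<noteq> 0" for k k' :: "'x \<Rightarrow>\<^sub>0 nat"
      using that unfolding e_def
      by (intro poly_mapping_eqI) (auto simp: lookup_add lookup_minus lookup_single when_def)
    have 1: "Poly_Mapping.single (m + n - e) (of_nat (lookup m x) * (c * d)) =
        Poly_Mapping.single ((m - e) + n) (of_nat (lookup m x) * (c * d))"
      using shift[of m n] by (cases "lookup m x = 0") simp_all
    have 2: "Poly_Mapping.single (m + n - e) (of_nat (lookup n x) * (c * d)) =
        Poly_Mapping.single (m + (n - e)) (of_nat (lookup n x) * (c * d))"
      using shift[of n m] by (cases "lookup n x = 0") (simp_all add: add.commute)
    have "pdiff x (Poly_Mapping.single m c * Poly_Mapping.single n d) =
        Poly_Mapping.single (m + n - e) (of_nat (lookup m x) * (c * d)) +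
        Poly_Mapping.single (m + n - e) (of_nat (lookup n x) * (c * d))"
      by (simp add: mult_single lookup_add distrib_right single_add e_def)
    then show ?case
      unfolding 1 2 by (simp add: mult_single e_def mult_ac add.commute)
  qed (simp add: algebra_simps pdiff_add)
qed (simp add: algebra_simps pdiff_add)

lemma pdiff_var: "pdiff x (var y) = (if x = y then 1 else 0)"
  by (simp add: var_def monomial_def lookup_single when_def)

lemma derivation_pdiff: "derivation (pdiff x)"
  unfolding derivation_def by (simp add: pdiff_add pdiff_mult)

lemma derivationD:
  assumes "derivation D"
  shows "D (a + b) = D a + D b" "D (a * b) = a * D b + D a * b" "D (Const c) = 0"
    "D 0 = 0" "D (sum f S) = (\<Sum>i\<in>S. D (f i))"
proof -
  show 1: "D (a + b) = D a + D b" "D (a * b) = a * D b + D a * b" "D (Const c) = 0" for a b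
    using assms by (simp_all add: derivation_def)
  show 2: "D 0 = 0" using 1(1)[of 0 0] by simp
  show "D (sum f S) = (\<Sum>i\<in>S. D (f i))"
    by (induction S rule: infinite_finite_induct) (simp_all add: 1 2)
qed

text \<open>
  Both sides are additive in \<open>Q\<close> and obey the same Leibniz rule, so they agree once they agree on
  constants and variables.
\<close>

lemma chain_rule:
  assumes D: "derivation D" and I: "finite I" and Q: "Q \<in> polys I"
  shows "D (psubst f Q) = (\<Sum>i\<in>I. psubst f (pdiff i Q) * D (f i))"
  using Q
proof (induction rule: mpoly_induct)
  case (Const c)
  then show ?case using derivationD(3)[OF D] by simp
next
  case (var x)
  have "(\<Sum>i\<in>I. psubst f (pdiff i (var x)) * D (f i)) = (\<Sum>i\<in>I. if i = x then D (f i) else 0)"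
    by (intro sum.cong) (simp_all add: pdiff_var)
  then show ?case using I var by simp
next
  case (add a b)
  then show ?case
    by (simp add: psubst_add pdiff_add derivationD(1)[OF D] distrib_right sum.distrib)
next
  case (mult a b)
  then show ?case
    by (simp add: psubst_add psubst_mult pdiff_mult derivationD(2)[OF D] sum.distrib
      sum_distrib_left algebra_simps)
qed

lemma keys_pdiff:
  "keys (pdiff x p) \<subseteq> {m - Poly_Mapping.single x 1 | m. m \<in> keys p \<and> lookup m x \<noteq> 0}"
proof -
  have "keys (Poly_Mapping.single (m - Poly_Mapping.single x 1) (of_nat (lookup m x) * lookup p m))
      \<subseteq> {m - Poly_Mapping.single x 1 | m. m \<in> keys p \<and> lookup m x \<noteq> 0}" if "m \<in> keys p" for m
    using that by (cases "lookup m x = 0") (auto intro!: exI[of _ m])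
  then show ?thesis unfolding pdiff_def by (intro order.trans[OF keys_sum]) blast
qed

lemma monomial_minus_variable:
  "lookup m x \<noteq> 0 \<Longrightarrow> m = (m - Poly_Mapping.single x 1) + Poly_Mapping.single x (1::nat)"
  by (rule poly_mapping_eqI) (auto simp: lookup_add lookup_minus lookup_single when_def)

lemma polys_pdiff: "p \<in> polys X \<Longrightarrow> pdiff x p \<in> polys X"
proof -
  assume p: "p \<in> polys X"
  have "keys (m - Poly_Mapping.single x 1) \<subseteq> keys m" for m :: "'a \<Rightarrow>\<^sub>0 nat"
    by (auto simp: in_keys_iff lookup_minus)
  then have "keys n \<subseteq> X" if n: "n \<in> keys (pdiff x p)" for n
    using subsetD[OF keys_pdiff n] p by blast
  then show ?thesis by simp
qed

text \<open>
  Differentiation maps the monomials that involve \<open>x\<close> injectively to monomials and multiplies each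
  coefficient by the exponent of \<open>x\<close>, which is a unit in characteristic zero. This is where
  the characteristic enters: in characteristic \<open>q\<close> the power \<open>x\<^sup>q\<close> has derivative zero.
\<close>

lemma pdiff_eq_0_imp:
  fixes p :: "('x, 'f::field_char_0) mpoly"
  assumes "pdiff x p = 0" "m \<in> keys p"
  shows "lookup m x = 0"
proof (rule ccontr)
  assume m: "lookup m x \<noteq> 0"
  let ?e = "Poly_Mapping.single x (1::nat)"
  have "lookup (pdiff x p) (m - ?e) = (\<Sum>n\<in>keys p. if n = m then of_nat (lookup m x) * lookup p m else 0)"
    unfolding pdiff_def lookup_sum
  proof (intro sum.cong refl)
    fix n assume "n \<in> keys p"
    show "lookup (Poly_Mapping.single (n - ?e) (of_nat (lookup n x) * lookup p n)) (m - ?e) =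
        (if n = m then of_nat (lookup m x) * lookup p m else 0)"
    proof (cases "lookup n x = 0")
      case False
      then have "n - ?e = m - ?e \<longleftrightarrow> n = m"
        using m monomial_minus_variable[of n x] monomial_minus_variable[of m x] by auto
      then show ?thesis by (auto simp: lookup_single when_def)
    qed (use m in auto)
  qed
  also have "\<dots> = of_nat (lookup m x) * lookup p m" using assms by simp
  finally show False using m assms by (simp add: in_keys_iff)
qed

subsection \<open>Weighted homogeneous components\<close>

definition whomog :: "('x \<Rightarrow> 'w::comm_semiring_1) \<Rightarrow> 'w \<Rightarrow> ('x, 'f::field) mpoly \<Rightarrow> bool" where
  "whomog w g p \<longleftrightarrow> (\<forall>m\<in>keys p. wdeg w m = g)"

definition wcomp :: "('x \<Rightarrow> 'w::comm_semiring_1) \<Rightarrow> 'w \<Rightarrow> ('x, 'f::field) mpoly \<Rightarrow> ('x, 'f) mpoly" where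
  "wcomp w g p = (\<Sum>m\<in>keys p. if wdeg w m = g then Poly_Mapping.single m (lookup p m) else 0)"

lemma lookup_wcomp: "lookup (wcomp w g p) m = (if wdeg w m = g then lookup p m else 0)"
proof -
  have "lookup (wcomp w g p) m =
      (\<Sum>n\<in>keys p. if n = m then (if wdeg w m = g then lookup p m else 0) else 0)"
    unfolding wcomp_def lookup_sum by (intro sum.cong) (auto simp: lookup_single when_def)
  then show ?thesis by (auto simp: in_keys_iff)
qed

lemma wcomp_add: "wcomp w g (p + q) = wcomp w g p + wcomp w g q"
  and wcomp_0 [simp]: "wcomp w g 0 = 0"
  and wcomp_diff: "wcomp w g (p - q) = wcomp w g p - wcomp w g q"
  by (rule poly_mapping_eqI, simp add: lookup_wcomp lookup_add lookup_minus)+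

lemma wcomp_sum: "wcomp w g (sum f S) = (\<Sum>i\<in>S. wcomp w g (f i))"
  by (induction S rule: infinite_finite_induct) (simp_all add: wcomp_add)

lemma whomog_wcomp: "whomog w g (wcomp w g p)"
  by (auto simp: whomog_def in_keys_iff lookup_wcomp split: if_splits)

lemma wcomp_whomog: "whomog w g p \<Longrightarrow> wcomp w h p = (if h = g then p else 0)"
  by (rule poly_mapping_eqI) (auto simp: whomog_def in_keys_iff lookup_wcomp)

lemma polys_wcomp: "p \<in> polys X \<Longrightarrow> wcomp w g p \<in> polys X"
  by (auto simp: in_keys_iff lookup_wcomp split: if_splits)

lemma sum_wcomp:
  assumes "finite S" "wdeg w ` keys p \<subseteq> S"
  shows "(\<Sum>g\<in>S. wcomp w g p) = p"
proof (rule poly_mapping_eqI)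
  fix m
  have "lookup (\<Sum>g\<in>S. wcomp w g p) m = (\<Sum>g\<in>S. if g = wdeg w m then lookup p m else 0)"
    unfolding lookup_sum by (intro sum.cong) (auto simp: lookup_wcomp)
  also have "\<dots> = lookup p m"
    using assms by (cases "m \<in> keys p") (auto simp: in_keys_iff)
  finally show "lookup (\<Sum>g\<in>S. wcomp w g p) m = lookup p m" .
qed

lemma whomog_add: "whomog w g p \<Longrightarrow> whomog w g q \<Longrightarrow> whomog w g (p + q)"
  using keys_add[of p q] by (auto simp: whomog_def)

lemma whomog_0 [simp]: "whomog w g 0"
  by (simp add: whomog_def)

lemma whomog_sum: "(\<And>i. i \<in> S \<Longrightarrow> whomog w g (f i)) \<Longrightarrow> whomog w g (sum f S)"
  by (induction S rule: infinite_finite_induct) (simp_all add: whomog_add)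

lemma whomog_mult: "whomog w g p \<Longrightarrow> whomog w h q \<Longrightarrow> whomog w (g + h) (p * q)"
  using keys_mult[of p q] by (fastforce simp: whomog_def)

lemma whomog_Const: "whomog w 0 (Const c)"
  by (simp add: whomog_def)

lemma whomog_var: "whomog w (w x) (var x)"
  by (simp add: whomog_def var_def monomial_def)

lemma whomog_Const_mult: "whomog w g p \<Longrightarrow> whomog w g (Const c * p)"
  using whomog_mult[OF whomog_Const] by fastforce

lemma whomog_prod: "(\<And>i. i \<in> S \<Longrightarrow> whomog w (g i) (f i)) \<Longrightarrow> whomog w (sum g S) (prod f S)"
proof (induction S rule: infinite_finite_induct)
  case (insert x F)
  then show ?case by (simp add: whomog_mult)
qed (use whomog_Const[of w 1] in simp_all)

text \<open>
  Differentiating by \<open>x\<close> removes one factor \<open>x\<close> from a monomial and so lowers its weight by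
  \<open>w x\<close>.
\<close>

lemma pdiff_wcomp:
  fixes w :: "'x \<Rightarrow> 'w::comm_ring_1"
  shows "pdiff x (wcomp w g p) = wcomp w (g - w x) (pdiff x p)"
proof (induction p rule: poly_mapping_additive_induct)
  case (1 m c)
  have single: "wcomp w g (Poly_Mapping.single m c) =
      (if wdeg w m = g then Poly_Mapping.single m c else 0)" for g m c
    unfolding wcomp_def by (rule sum_keys_single) simp
  show ?case
  proof (cases "lookup m x = 0")
    case False
    have "wdeg w m = wdeg w ((m - Poly_Mapping.single x 1) + Poly_Mapping.single x 1)"
      using monomial_minus_variable[OF False] by simp
    then have "wdeg w m = wdeg w (m - Poly_Mapping.single x 1) + w x" by simp
    then show ?thesis by (auto simp: single)
  qed (simp add: single)
qed (simp add: pdiff_add wcomp_add)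

lemma whomog_pdiff: "whomog (\<lambda>_. 1) (k::nat) p \<Longrightarrow> whomog (\<lambda>_. 1) (k - 1) (pdiff x p)"
proof -
  assume p: "whomog (\<lambda>_. 1) k p"
  have "mdeg (m - Poly_Mapping.single x 1) = k - 1" if "m \<in> keys p" "lookup m x \<noteq> 0" for m
  proof -
    have "mdeg m = mdeg ((m - Poly_Mapping.single x 1) + Poly_Mapping.single x 1)"
      using monomial_minus_variable[OF that(2)] by simp
    then show ?thesis using p that by (simp add: whomog_def)
  qed
  then show ?thesis using subsetD[OF keys_pdiff[of x p]] unfolding whomog_def by fastforce
qed

section \<open>The Jacobian criterion for algebraic independence\<close>

definition pindep :: "'i set \<Rightarrow> ('i \<Rightarrow> ('x, 'f::field) mpoly) \<Rightarrow> bool" where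
  "pindep I f \<longleftrightarrow> (\<forall>Q\<in>polys I. psubst f Q = 0 \<longrightarrow> Q = 0)"

text \<open>
  A nonzero partial derivative of a relation has smaller total degree. Hence descending from any
  relation to a derivative that is still a nonzero relation comes to an end.
\<close>

lemma minimal_relation:
  fixes f :: "'i \<Rightarrow> ('x, 'f::field_char_0) mpoly"
  assumes "\<not> pindep I f"
  shows "\<exists>Q\<in>polys I. Q \<noteq> 0 \<and> psubst f Q = 0 \<and>
    (\<forall>i. psubst f (pdiff i Q) = 0 \<longrightarrow> pdiff i Q = 0)"
proof -
  define good where "good Q \<longleftrightarrow> Q \<in> polys I \<and> Q \<noteq> 0 \<and> psubst f Q = 0" for Q
  have "\<exists>Q. good Q \<and> (\<forall>i. psubst f (pdiff i Q) = 0 \<longrightarrow> pdiff i Q = 0)"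
    if "good Q" "\<forall>m\<in>keys Q. mdeg m \<le> d" for Q d
    using that
  proof (induction d arbitrary: Q rule: less_induct)
    case (less d)
    show ?case
    proof (cases "\<forall>i. psubst f (pdiff i Q) = 0 \<longrightarrow> pdiff i Q = 0")
      case False
      then obtain i where i: "psubst f (pdiff i Q) = 0" "pdiff i Q \<noteq> 0" by blast
      have deg: "mdeg n < d" if n: "n \<in> keys (pdiff i Q)" for n
      proof -
        obtain m where m: "m \<in> keys Q" "lookup m i \<noteq> 0" "n = m - Poly_Mapping.single i 1"
          using subsetD[OF keys_pdiff n] by blast
        have "mdeg m = mdeg (n + Poly_Mapping.single i 1)"
          using monomial_minus_variable[OF m(2)] m(3) by simp
        then show ?thesis using less.prems(2) m(1) by fastforce
      qed
      moreover have "keys (pdiff i Q) \<noteq> {}" using i(2) by simp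
      ultimately have d: "d - 1 < d" by fastforce
      have "good (pdiff i Q)"
        using less.prems(1) i polys_pdiff[of Q I i] unfolding good_def by blast
      moreover have "\<forall>m\<in>keys (pdiff i Q). mdeg m \<le> d - 1" using deg by fastforce
      ultimately show ?thesis using less.IH[OF d] by blast
    qed (use less.prems in blast)
  qed
  moreover obtain Q where "good Q" using assms unfolding pindep_def good_def by blast
  moreover have "\<forall>m\<in>keys Q. mdeg m \<le> Max (insert 0 (mdeg ` keys Q))" by simp
  ultimately show ?thesis unfolding good_def by blast
qed

text \<open>
  Apply a derivation \<open>D\<close> to a minimal relation \<open>Q\<close>. By the chain rule the values
  \<open>(\<partial>Q/\<partial>i)(g)\<close> are the coefficients of a vanishing combination of the rows
  \<open>(D (g i))\<^sub>D\<close> of the Jacobian matrix. If the rows are independent, these values vanish, so by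
  minimality all partial derivatives of \<open>Q\<close> vanish and \<open>Q\<close> is a constant.
\<close>

lemma pindep_if_rows_independent:
  fixes g :: "'i \<Rightarrow> ('x, 'f::field_char_0) mpoly"
  assumes I: "finite I" and der: "\<And>D. D \<in> \<D> \<Longrightarrow> derivation D"
    and rows: "\<And>c. (\<And>D. D \<in> \<D> \<Longrightarrow> (\<Sum>i\<in>I. c i * D (g i)) = 0) \<Longrightarrow> \<forall>i\<in>I. c i = 0"
  shows "pindep I g"
proof (rule ccontr)
  assume "\<not> pindep I g"
  from minimal_relation[OF this] obtain Q where Q: "Q \<in> polys I" "Q \<noteq> 0" "psubst g Q = 0"
    "\<And>i. psubst g (pdiff i Q) = 0 \<Longrightarrow> pdiff i Q = 0"
    by (elim bexE conjE) (erule (2) that, blast)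
  have "(\<Sum>i\<in>I. psubst g (pdiff i Q) * D (g i)) = 0" if "D \<in> \<D>" for D
    using chain_rule[OF der[OF that] I Q(1), of g] Q(3) derivationD(4)[OF der[OF that]] by simp
  then have "\<forall>i\<in>I. psubst g (pdiff i Q) = 0" by (rule rows)
  then have zero: "lookup m i = 0" if "m \<in> keys Q" "i \<in> I" for m i
    using pdiff_eq_0_imp[OF Q(4) that(1)] that(2) by simp
  have "m = 0" if m: "m \<in> keys Q" for m
  proof (rule poly_mapping_eqI)
    fix i
    have "keys m \<subseteq> I" using Q(1) m by blast
    then show "lookup m i = lookup 0 i"
      using zero[OF m, of i] by (cases "i \<in> I") (auto simp: in_keys_iff)
  qed
  then have "Q = Const (lookup Q 0)"
    by (intro poly_mapping_eqI) (auto simp: lookup_single when_def in_keys_iff)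
  then have "psubst g Q = Const (lookup Q 0)" by (metis psubst_single mval_0 mult.right_neutral)
  with Q(3) have "lookup Q 0 = 0" by (metis lookup_single_eq lookup_zero)
  with \<open>Q = Const (lookup Q 0)\<close> Q(2) show False by simp
qed

subsection \<open>Counting monomials\<close>

definition box :: "'x set \<Rightarrow> nat \<Rightarrow> ('x \<Rightarrow>\<^sub>0 nat) set" where
  "box X e = {m. keys m \<subseteq> X \<and> (\<forall>x. lookup m x < e)}"

lemma finite_card_box:
  assumes X: "finite X" and e: "0 < e"
  shows "finite (box X e)" "card (box X e) = e ^ card X"
proof -
  have "bij_betw (\<lambda>m. restrict (lookup m) X) (box X e) (X \<rightarrow>\<^sub>E {..<e})"
  proof (rule bij_betwI[where g = "\<lambda>u. Abs_poly_mapping (\<lambda>x. if x \<in> X then u x else 0)"])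
    show "(\<lambda>m. restrict (lookup m) X) \<in> box X e \<rightarrow> X \<rightarrow>\<^sub>E {..<e}"
      by (auto simp: box_def)
    have lk: "lookup (Abs_poly_mapping (\<lambda>x. if x \<in> X then u x else 0)) =
        (\<lambda>x. if x \<in> X then u x else (0::nat))" for u
      using X by (intro lookup_Abs_poly_mapping) simp
    show "(\<lambda>u. Abs_poly_mapping (\<lambda>x. if x \<in> X then u x else 0)) \<in> (X \<rightarrow>\<^sub>E {..<e}) \<rightarrow> box X e"
      using e by (auto simp: box_def in_keys_iff lk PiE_def split: if_splits)
    show "Abs_poly_mapping (\<lambda>x. if x \<in> X then restrict (lookup m) X x else 0) = m"
      if "m \<in> box X e" for m
      using that by (intro poly_mapping_eqI) (auto simp: lk box_def in_keys_iff)
    show "restrict (lookup (Abs_poly_mapping (\<lambda>x. if x \<in> X then u x else 0))) X = u"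
      if "u \<in> X \<rightarrow>\<^sub>E {..<e}" for u
      using that unfolding lk by (auto simp: restrict_def PiE_def extensional_def)
  qed
  moreover have "finite (X \<rightarrow>\<^sub>E {..<e})" using X by (simp add: finite_PiE)
  moreover have "card (X \<rightarrow>\<^sub>E {..<e}) = e ^ card X" using X by (simp add: card_PiE)
  ultimately show "finite (box X e)" "card (box X e) = e ^ card X"
    using bij_betw_finite bij_betw_same_card by (blast, metis)
qed

definition bounded_exps :: "nat \<Rightarrow> ('x, 'f::field) mpoly \<Rightarrow> bool" where
  "bounded_exps k p \<longleftrightarrow> (\<forall>m\<in>keys p. \<forall>x. lookup m x \<le> k)"

lemma bounded_exps_mult:
  assumes "bounded_exps k p" "bounded_exps l q"
  shows "bounded_exps (k + l) (p * q)"
  unfolding bounded_exps_def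
proof (intro ballI allI)
  fix m x assume "m \<in> keys (p * q)"
  from subsetD[OF keys_mult this] obtain a b where "m = a + b" "a \<in> keys p" "b \<in> keys q" by blast
  then show "lookup m x \<le> k + l"
    using assms unfolding bounded_exps_def by (auto simp: lookup_add intro!: add_mono)
qed

lemma bounded_exps_power: "bounded_exps k p \<Longrightarrow> bounded_exps (n * k) (p ^ n)"
  by (induction n) (auto simp: bounded_exps_mult, simp add: bounded_exps_def)

lemma bounded_exps_prod: "(\<And>i. i \<in> S \<Longrightarrow> bounded_exps (k i) (f i)) \<Longrightarrow> bounded_exps (sum k S) (prod f S)"
  by (induction S rule: infinite_finite_induct) (auto simp: bounded_exps_mult, simp_all add: bounded_exps_def)

text \<open>
  The monomials with exponents less than \<open>e\<close> in \<open>N\<close> independent elements are \<open>e^N\<close> linearly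
  independent polynomials, with exponents bounded by a fixed multiple of \<open>e\<close>. In \<open>n\<close> variables
  such polynomials form a space of dimension \<open>O(e^n)\<close>, so \<open>N > n\<close> is impossible for large \<open>e\<close>.
\<close>

lemma pindep_card_le:
  fixes f :: "'i \<Rightarrow> ('x, 'f::field) mpoly"
  assumes I: "finite I" and X: "finite X" and f: "\<And>i. i \<in> I \<Longrightarrow> f i \<in> polys X"
    and indep: "pindep I f"
  shows "card I \<le> card X"
proof (rule ccontr)
  assume "\<not> card I \<le> card X"
  define scale where "scale c p = Const c * p" for c and p :: "('x, 'f) mpoly"
  interpret V: vector_space scale
    by unfold_locales (simp_all add: scale_def algebra_simps single_add mult_single flip: mult.assoc)
  \<comment> \<open>All exponents in the given elements are at most \<open>d\<close>. Products of them with exponents less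
    than \<open>e\<close> have exponents less than \<open>e * b\<close>, and \<open>e > b ^ card X\<close> makes
    \<open>(e * b) ^ card X\<close> smaller than \<open>e ^ Suc (card X)\<close>.\<close>
  define d where "d = Max (insert 0 (\<Union>i\<in>I. \<Union>m\<in>keys (f i). lookup m ` keys m))"
  have d: "bounded_exps d (f i)" if "i \<in> I" for i
    unfolding bounded_exps_def
  proof (intro ballI allI)
    fix m x assume m: "m \<in> keys (f i)"
    show "lookup m x \<le> d"
    proof (cases "x \<in> keys m")
      case True
      then show ?thesis unfolding d_def using I that m by (intro Max_ge) auto
    qed (simp add: in_keys_iff)
  qed
  define b where "b = d * card I + 1"
  define e where "e = b ^ card X + 1"
  have e: "0 < e" by (simp add: e_def)
  let ?S = "mval f ` box I e" and ?T = "(\<lambda>m. Poly_Mapping.single m (1::'f)) ` box X (e * b)"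
  have eb: "0 < e * b" using e by (simp add: b_def)
  have fin: "finite (box I e)" "finite (box X (e * b))"
    using finite_card_box(1)[OF I e] finite_card_box(1)[OF X eb] .
  have zero: "u m = 0" if "(\<Sum>m\<in>box I e. Const (u m) * mval f m) = 0" "m \<in> box I e"
    for u :: "_ \<Rightarrow> 'f" and m
  proof -
    let ?Q = "\<Sum>m\<in>box I e. Poly_Mapping.single m (u m)"
    have "psubst f ?Q = 0" using that(1) by (simp add: psubst_sum)
    moreover have "?Q \<in> polys I"
      by (intro polys_sum) (auto simp: box_def)
    ultimately have "?Q = 0" using indep unfolding pindep_def by blast
    then have "lookup ?Q m = 0" by simp
    then show ?thesis
      using that(2) fin by (simp add: lookup_sum lookup_single when_def)
  qed
  have inj: "inj_on (mval f) (box I e)"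
  proof (rule inj_onI, rule ccontr)
    fix m n assume mn: "m \<in> box I e" "n \<in> box I e" "mval f m = mval f n" "m \<noteq> n"
    let ?Q = "Poly_Mapping.single m 1 - Poly_Mapping.single n (1::'f)"
    have "psubst f ?Q = 0" using mn(3) by (simp add: psubst_diff)
    moreover have "?Q \<in> polys I"
      using mn by (intro polys_diff) (auto simp: box_def)
    ultimately have "?Q = 0" using indep unfolding pindep_def by blast
    then have "lookup ?Q m = 0" by simp
    then show False using mn(4) by (simp add: lookup_minus lookup_single when_def)
  qed
  have "V.independent ?S"
  proof -
    have "finite ?S" using fin by simp
    moreover have "u v = 0" if "(\<Sum>v\<in>?S. scale (u v) v) = 0" "v \<in> ?S" for u v
    proof -
      have "(\<Sum>m\<in>box I e. Const (u (mval f m)) * mval f m) = 0"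
        using that(1) inj by (simp add: sum.reindex scale_def)
      then show ?thesis using zero[of "\<lambda>m. u (mval f m)"] that(2) by blast
    qed
    ultimately show ?thesis unfolding V.dependent_finite[OF \<open>finite ?S\<close>] by blast
  qed
  moreover have "?S \<subseteq> V.span ?T"
  proof safe
    fix m assume m: "m \<in> box I e"
    have "bounded_exps (\<Sum>i\<in>keys m. lookup m i * d) (mval f m)"
      unfolding mval_def using m d by (intro bounded_exps_prod bounded_exps_power) (auto simp: box_def)
    moreover have "(\<Sum>i\<in>keys m. lookup m i * d) \<le> (\<Sum>i\<in>keys m. e * d)"
      using m by (intro sum_mono mult_right_mono) (auto simp: box_def less_imp_le)
    moreover have "\<dots> \<le> card I * (e * d)"
      using m I card_mono[of I "keys m"] by (simp add: box_def)
    moreover have "card I * (e * d) < e * b"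
      using e unfolding b_def by (simp add: algebra_simps)
    ultimately have "\<forall>n\<in>keys (mval f m). \<forall>x. lookup n x < e * b"
      unfolding bounded_exps_def by (meson le_less_trans order.trans)
    moreover have "mval f m \<in> polys X"
    proof -
      have "psubst f (Poly_Mapping.single m 1) \<in> polys X"
        using m f by (intro polys_psubst[where X = I]) (auto simp: box_def)
      then show ?thesis by simp
    qed
    ultimately have sub: "keys (mval f m) \<subseteq> box X (e * b)" unfolding box_def by blast
    have "(\<Sum>n\<in>keys (mval f m). scale (lookup (mval f m) n) (Poly_Mapping.single n 1)) \<in> V.span ?T"
      using sub by (intro V.span_sum V.span_scale V.span_base) blast
    also have "(\<Sum>n\<in>keys (mval f m). scale (lookup (mval f m) n) (Poly_Mapping.single n 1)) = mval f m"
      by (rule poly_mapping_eqI)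
        (simp add: scale_def lookup_sum lookup_single when_def in_keys_iff)
    finally show "mval f m \<in> V.span ?T" .
  qed
  ultimately have "card ?S \<le> card ?T"
    using V.independent_span_bound[of ?T ?S] fin by simp
  also have "\<dots> \<le> card (box X (e * b))" using fin by (intro card_image_le)
  also have "\<dots> = (e * b) ^ card X" using finite_card_box(2)[OF X eb] .
  finally have "e ^ card I \<le> (e * b) ^ card X"
    using card_image[OF inj] finite_card_box(2)[OF I e] by simp
  moreover have "e ^ Suc (card X) \<le> e ^ card I"
    using \<open>\<not> card I \<le> card X\<close> e by (intro power_increasing) auto
  ultimately have "e ^ Suc (card X) \<le> (e * b) ^ card X" by (rule le_trans[rotated])
  then have "e ^ card X * e \<le> e ^ card X * b ^ card X"
    unfolding power_mult_distrib power_Suc2 .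
  then have "e \<le> b ^ card X" using e by (subst (asm) mult_le_cancel1) simp
  then show False by (simp add: e_def)
qed

subsection \<open>Independent polynomials have a Jacobian of full rank\<close>

lemma pindep_rename:
  fixes f :: "'i \<Rightarrow> ('x, 'f::field) mpoly" and emb :: "'i \<Rightarrow> 'j"
  assumes "pindep I f" "\<And>i. i \<in> I \<Longrightarrow> h (emb i) = f i" "inj emb"
  shows "pindep (emb ` I) h"
  unfolding pindep_def
proof (intro ballI impI)
  fix Q :: "('j, 'f) mpoly" assume Q: "Q \<in> polys (emb ` I)" "psubst h Q = 0"
  have inv: "the_inv emb (emb i) = i" for i using assms(3) by (simp add: the_inv_f_f)
  let ?Q = "psubst (\<lambda>j. var (the_inv emb j)) Q"
  have "psubst f ?Q = psubst h Q"
    unfolding psubst_psubst psubst_var using Q(1) assms(2) inv by (intro psubst_cong) auto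
  moreover have "?Q \<in> polys I"
    using Q(1) inv by (intro polys_psubst[where X = "emb ` I"] polys_var) auto
  ultimately have "?Q = 0" using assms(1) Q(2) unfolding pindep_def by simp
  moreover have "psubst (\<lambda>i. var (emb i)) ?Q = psubst var Q"
    unfolding psubst_psubst psubst_var using Q(1) inv by (intro psubst_cong) auto
  ultimately show "Q = 0" by (simp add: psubst_var_id)
qed

text \<open>
  The converse of the Jacobian criterion, with a right inverse of the Jacobian matrix up to the
  factor \<open>d\<close>; in this form it survives any injective change of coefficients. Enlarge the family
  by variables to a maximal independent one. Then every variable \<open>x\<close> is algebraic over the family,
  and differentiating a minimal relation expresses a nonzero multiple of \<open>D x\<close> by the values of
  \<open>D\<close> on the family, for every derivation \<open>D\<close>. Taking partial derivatives for \<open>D\<close>, this says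
  that \<open>B * A\<close> is diagonal with nonzero entries, where \<open>A\<close> is the Jacobian matrix of the family.
  The family has at most as many members as there are variables, so \<open>A\<close> can be taken square, its
  determinant \<open>d\<close> is nonzero, and the adjugate of \<open>A\<close> provides the right inverse.
\<close>

lemma jacobian_if_pindep:
  fixes f :: "'i \<Rightarrow> ('x::linorder, 'f::field_char_0) mpoly"
  assumes I: "finite I" and X: "finite X" and f: "\<And>i. i \<in> I \<Longrightarrow> f i \<in> polys X"
    and indep: "pindep I f"
  shows "\<exists>d N. d \<noteq> 0 \<and>
    (\<forall>i\<in>I. \<forall>k\<in>I. (\<Sum>x\<in>X. pdiff x (f i) * N x k) = (if i = k then d else 0))"
proof -
  define h where "h = case_sum f (var :: 'x \<Rightarrow> ('x, 'f) mpoly)"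
  have h [simp]: "h (Inl i) = f i" "h (Inr x) = var x" for i x by (simp_all add: h_def)
  define C where "C = {J. J \<subseteq> Inl ` I \<union> Inr ` X \<and> pindep J h}"
  have "pindep (Inl ` I) h" by (rule pindep_rename[OF indep]) simp_all
  then have "Inl ` I \<in> C" unfolding C_def by blast
  moreover have "finite C"
    by (rule finite_subset[of C "Pow (Inl ` I \<union> Inr ` X)"]) (use I X in \<open>auto simp: C_def\<close>)
  ultimately have "\<exists>J\<in>C. Inl ` I \<subseteq> J \<and> (\<forall>J'\<in>C. J \<subseteq> J' \<longrightarrow> J = J')"
    by (rule finite_has_maximal2[rotated])
  then obtain J where J: "J \<in> C" "Inl ` I \<subseteq> J" "\<forall>J'\<in>C. J \<subseteq> J' \<longrightarrow> J = J'"
    by (elim bexE conjE)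
  have J': "J \<subseteq> Inl ` I \<union> Inr ` X" "pindep J h" "finite J"
    using J(1) I X finite_subset[of J "Inl ` I \<union> Inr ` X"] unfolding C_def by auto
  \<comment> \<open>Up to a nonzero factor for each variable, a derivation is determined by its values on \<open>J\<close>.\<close>
  have "\<exists>e M. e \<noteq> 0 \<and> (\<forall>D. derivation D \<longrightarrow> e * D (var x) = (\<Sum>i\<in>J. M i * D (h i)))"
    if x: "x \<in> X" for x
  proof (cases "Inr x \<in> J")
    case True
    have "1 * D (var x) = (\<Sum>i\<in>J. (if i = Inr x then 1 else 0) * D (h i))"
      for D :: "('x, 'f) mpoly \<Rightarrow> ('x, 'f) mpoly"
    proof -
      have "(\<Sum>i\<in>J. (if i = Inr x then 1 else 0) * D (h i)) =
          (\<Sum>i\<in>J. if i = Inr x then D (h i) else 0)"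
        by (intro sum.cong) auto
      then show ?thesis using True J'(3) by simp
    qed
    then have "(1 :: ('x, 'f) mpoly) \<noteq> 0 \<and> (\<forall>D. derivation D \<longrightarrow>
        1 * D (var x) = (\<Sum>i\<in>J. (if i = Inr x then 1 else 0) * D (h i)))"
      by (intro conjI allI impI) simp_all
    then show ?thesis by (intro exI)
  next
    case False
    have notC: "insert (Inr x) J \<notin> C"
      using bspec[OF J(3), of "insert (Inr x) J"] False by blast
    have sub: "insert (Inr x) J \<subseteq> Inl ` I \<union> Inr ` X" using J'(1) x by simp
    have "\<not> pindep (insert (Inr x) J) h"
    proof
      assume "pindep (insert (Inr x) J) h"
      with sub have "insert (Inr x) J \<in> C" unfolding C_def by (intro CollectI conjI)
      with notC show False by contradiction
    qed
    from minimal_relation[OF this] obtain Q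
      where Q: "Q \<in> polys (insert (Inr x) J)" "Q \<noteq> 0" "psubst h Q = 0"
        "\<And>i. psubst h (pdiff i Q) = 0 \<Longrightarrow> pdiff i Q = 0"
      by (elim bexE conjE) (erule (2) that, blast)
    let ?e = "psubst h (pdiff (Inr x) Q)"
    have "?e \<noteq> 0"
    proof
      assume "?e = 0"
      then have "pdiff (Inr x) Q = 0" by (rule Q(4))
      then have "Inr x \<notin> keys m" if "m \<in> keys Q" for m
        using pdiff_eq_0_imp[OF _ that] by (simp add: in_keys_iff)
      then have "Q \<in> polys J" using Q(1) by blast
      then show False using J'(2) Q(2,3) unfolding pindep_def by blast
    qed
    moreover have "?e * D (var x) = (\<Sum>i\<in>J. - psubst h (pdiff i Q) * D (h i))"
      if D: "derivation D" for D
    proof -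
      have "0 = (\<Sum>i\<in>insert (Inr x) J. psubst h (pdiff i Q) * D (h i))"
        using chain_rule[OF D _ Q(1), of h] J'(3) Q(3) derivationD(4)[OF D] by simp
      then show ?thesis
        using J'(3) False by (simp add: sum_negf eq_neg_iff_add_eq_0)
    qed
    ultimately have "?e \<noteq> 0 \<and> (\<forall>D. derivation D \<longrightarrow>
        ?e * D (var x) = (\<Sum>i\<in>J. - psubst h (pdiff i Q) * D (h i)))"
      by simp
    then show ?thesis by (intro exI)
  qed
  then have "\<forall>x\<in>X. \<exists>e M. e \<noteq> 0 \<and>
      (\<forall>D. derivation D \<longrightarrow> e * D (var x) = (\<Sum>i\<in>J. M i * D (h i)))"
    by (intro ballI)
  from bchoice[OF this] obtain e where "\<forall>x\<in>X. \<exists>M. e x \<noteq> 0 \<and>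
      (\<forall>D. derivation D \<longrightarrow> e x * D (var x) = (\<Sum>i\<in>J. M i * D (h i)))"
    by (elim exE)
  from bchoice[OF this] obtain M where eM': "\<forall>x\<in>X. e x \<noteq> 0 \<and>
      (\<forall>D. derivation D \<longrightarrow> e x * D (var x) = (\<Sum>i\<in>J. M x i * D (h i)))"
    by (elim exE)
  then have eM: "e x \<noteq> 0" "derivation D \<Longrightarrow> e x * D (var x) = (\<Sum>i\<in>J. M x i * D (h i))"
    if "x \<in> X" for x D
    using that by simp_all
  have "card J \<le> card X"
  proof (rule pindep_card_le)
    show "h i \<in> polys X" if "i \<in> J" for i
      using subsetD[OF J'(1) that] by (elim UnE imageE) (simp_all only: h f polys_var)
  qed (use J' X in auto)
  define n where "n = card X"
  obtain xs where xs: "bij_betw xs {..<n} X"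
    using ex_bij_betw_nat_finite[OF X] unfolding n_def atLeast0LessThan by blast
  obtain js where js: "bij_betw js {..<card J} J"
    using ex_bij_betw_nat_finite[OF J'(3)] unfolding atLeast0LessThan by blast
  \<comment> \<open>Rows of \<open>A\<close> and columns of \<open>B\<close> beyond the size of the family are filled with zeros.\<close>
  define A where "A = mat n n (\<lambda>(a, k). if a < card J then pdiff (xs k) (h (js a)) else 0)"
  define B where "B = mat n n (\<lambda>(j, a). if a < card J then M (xs j) (js a) else 0)"
  have A: "A \<in> carrier_mat n n" and B: "B \<in> carrier_mat n n" by (simp_all add: A_def B_def)
  have BA: "(B * A) $$ (j, k) = (if j = k then e (xs j) else 0)" if "j < n" "k < n" for j k
  proof -
    have xX: "xs j \<in> X" "xs k \<in> X" using xs that by (auto simp: bij_betw_def)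
    have "(B * A) $$ (j, k) = (\<Sum>a\<in>{..<n}. B $$ (j, a) * A $$ (a, k))"
      using that A B by (simp add: scalar_prod_def atLeast0LessThan)
    also have "\<dots> = (\<Sum>a\<in>{..<card J}. M (xs j) (js a) * pdiff (xs k) (h (js a)))"
      using that \<open>card J \<le> card X\<close>
      by (intro sum.mono_neutral_cong_right) (auto simp: A_def B_def n_def)
    also have "\<dots> = (\<Sum>i\<in>J. M (xs j) i * pdiff (xs k) (h i))"
      by (rule sum.reindex_bij_betw[OF js])
    also have "\<dots> = e (xs j) * pdiff (xs k) (var (xs j))"
      using eM(2)[OF xX(1) derivation_pdiff] by simp
    finally show ?thesis
      using that xs by (auto simp: pdiff_var bij_betw_def inj_on_def)
  qed
  have "det (B * A) = prod_list (diag_mat (B * A))"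
    using A B BA by (intro det_upper_triangular[where n = n]) auto
  moreover have "0 \<notin> set (diag_mat (B * A))"
    using A B BA eM(1) xs by (auto simp: diag_mat_def bij_betw_def)
  ultimately have "det (B * A) \<noteq> 0" by (simp add: prod_list_zero_iff)
  then have d: "det A \<noteq> 0" using det_mult[OF B A] by auto
  define x_of where "x_of = the_inv_into {..<n} xs"
  define j_of where "j_of = the_inv_into {..<card J} js"
  define N where "N x i = adj_mat A $$ (x_of x, j_of (Inl i))" for x i
  have "(\<Sum>x\<in>X. pdiff x (f i) * N x k) = (if i = k then det A else 0)" if ik: "i \<in> I" "k \<in> I" for i k
  proof -
    have J_ik: "Inl i \<in> J" "Inl k \<in> J" using ik J(2) by auto
    obtain a b where ab: "a < card J" "js a = Inl i" "b < card J" "js b = Inl k"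
      using J_ik js unfolding bij_betw_def by (metis imageE lessThan_iff)
    have abn: "a < n" "b < n" using ab \<open>card J \<le> card X\<close> unfolding n_def by auto
    have jb: "j_of (Inl k) = b"
      unfolding j_of_def using ab js by (metis bij_betw_def lessThan_iff the_inv_into_f_f)
    have "(\<Sum>x\<in>X. pdiff x (f i) * N x k) = (\<Sum>l\<in>{..<n}. pdiff (xs l) (f i) * N (xs l) k)"
      by (rule sum.reindex_bij_betw[OF xs, symmetric])
    also have "\<dots> = (\<Sum>l\<in>{..<n}. A $$ (a, l) * adj_mat A $$ (l, b))"
    proof (intro sum.cong refl)
      fix l assume l: "l \<in> {..<n}"
      then have "x_of (xs l) = l"
        unfolding x_of_def using xs by (metis bij_betw_def the_inv_into_f_f)
      then show "pdiff (xs l) (f i) * N (xs l) k = A $$ (a, l) * adj_mat A $$ (l, b)"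
        using l abn ab by (simp add: N_def jb A_def)
    qed
    also have "\<dots> = (A * adj_mat A) $$ (a, b)"
      using A adj_mat(1)[OF A] abn by (simp add: scalar_prod_def atLeast0LessThan)
    also have "\<dots> = (if a = b then det A else 0)"
      using adj_mat(2)[OF A] abn by simp
    also have "(a = b) = (i = k)" using ab js by (auto simp: bij_betw_def inj_on_def)
    finally show ?thesis .
  qed
  then show ?thesis
    using d by (intro exI[of _ "det A"] exI[of _ N] conjI ballI) simp_all
qed

section \<open>Weight components of a polynomial at the generic truncated point\<close>

text \<open>
  Exponents are regarded as integer vectors, since the degrees \<open>k \<mu> - \<omega>\<close> involve differences.
\<close>

definition int_exp :: "(nat \<Rightarrow>\<^sub>0 nat) \<Rightarrow> nat \<Rightarrow> int" where
  "int_exp \<omega> = (\<lambda>j. int (lookup \<omega> j))"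

abbreviation vw :: "'x \<times> (nat \<Rightarrow>\<^sub>0 nat) \<Rightarrow> nat \<Rightarrow> int" where
  "vw v \<equiv> int_exp (snd v)"

text \<open>
  With the variable \<open>(x, \<omega>)\<close> standing for \<open>x \<otimes> \<tau>\<^sup>\<omega>\<close>, this is the homomorphism \<open>\<tau>\<^sub>a\<close> in
  coordinates. Equivalently, the component of weight \<open>\<gamma>\<close> of \<open>hat W p\<close> is the coefficient of
  \<open>t\<^sup>\<gamma>\<close> in the value of \<open>p\<close> at the generic point with coordinates
  \<open>\<Sum>\<omega>\<in>W. var (x, \<omega>) t\<^sup>\<omega>\<close>.
\<close>

definition hat :: "(nat \<Rightarrow>\<^sub>0 nat) set \<Rightarrow> ('x, 'f::field) mpoly \<Rightarrow> ('x \<times> (nat \<Rightarrow>\<^sub>0 nat), 'f) mpoly" where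
  "hat W = psubst (\<lambda>x. \<Sum>\<omega>\<in>W. var (x, \<omega>))"

lemma int_exp_inject: "int_exp \<omega> = int_exp \<omega>' \<longleftrightarrow> \<omega> = \<omega>'"
  unfolding int_exp_def by (metis (mono_tags) of_nat_eq_iff poly_mapping_eqI)

lemma int_exp_diff: "exp_le \<omega> \<mu> \<Longrightarrow> int_exp (\<mu> - \<omega>) = int_exp \<mu> - int_exp \<omega>"
  unfolding int_exp_def exp_le_def by (rule ext) (simp add: lookup_minus of_nat_diff)

lemma pdiff_hat:
  assumes W: "finite W" "\<eta> \<in> W"
  shows "pdiff (x, \<eta>) (hat W p) = hat W (pdiff x p)"
proof -
  have "p \<in> polys UNIV" by simp
  then show ?thesis
  proof (induction rule: mpoly_induct)
    case (Const c)
    then show ?case by (simp add: hat_def)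
  next
    case (var y)
    have "pdiff (x, \<eta>) (hat W (var y)) = (\<Sum>\<omega>\<in>W. if \<omega> = \<eta> then (if x = y then 1 else 0) else 0)"
      unfolding hat_def psubst_var derivationD(5)[OF derivation_pdiff]
      by (intro sum.cong) (auto simp: pdiff_var)
    then show ?case using W by (cases "x = y") (simp_all add: pdiff_var hat_def)
  next
    case (add a b)
    then show ?case by (simp add: hat_def psubst_add pdiff_add)
  next
    case (mult a b)
    then show ?case by (simp add: hat_def psubst_add psubst_mult pdiff_add pdiff_mult)
  qed
qed

text \<open>
  Weights are compared componentwise: a weight below \<open>g\<close> is at most \<open>g\<close> in every component and
  different from \<open>g\<close>.
\<close>

definition below :: "('x \<Rightarrow> nat \<Rightarrow> int) \<Rightarrow> (nat \<Rightarrow> int) \<Rightarrow> ('x, 'f::field) mpoly \<Rightarrow> bool" where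
  "below w g p \<longleftrightarrow> (\<forall>m\<in>keys p. wdeg w m < g)"

lemma below_add: "below w g p \<Longrightarrow> below w g q \<Longrightarrow> below w g (p + q)"
  unfolding below_def using subsetD[OF keys_add[of p q]] by (metis UnE)

lemma below_0 [simp]: "below w g 0"
  by (simp add: below_def)

lemma below_sum: "(\<And>i. i \<in> S \<Longrightarrow> below w g (f i)) \<Longrightarrow> below w g (sum f S)"
  by (induction S rule: infinite_finite_induct) (simp_all add: below_add)

lemma below_mult_whomog:
  assumes "below w g p" "whomog w h q"
  shows "below w (g + h) (p * q)"
  unfolding below_def
proof
  fix m assume "m \<in> keys (p * q)"
  from subsetD[OF keys_mult this] obtain a b where "m = a + b" "a \<in> keys p" "b \<in> keys q" by blast
  then show "wdeg w m < g + h"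
    using assms unfolding below_def whomog_def by simp
qed

lemma below_mult_below:
  assumes "below w g p" "below w h q"
  shows "below w (g + h) (p * q)"
  unfolding below_def
proof
  fix m assume "m \<in> keys (p * q)"
  from subsetD[OF keys_mult this] obtain a b where "m = a + b" "a \<in> keys p" "b \<in> keys q" by blast
  then show "wdeg w m < g + h"
    using assms unfolding below_def by (simp add: add_strict_mono)
qed

lemma wcomp_below: "below w g p \<Longrightarrow> \<not> h < g \<Longrightarrow> wcomp w h p = 0"
  by (rule poly_mapping_eqI) (auto simp: lookup_wcomp below_def in_keys_iff)

text \<open>
  In a monomial of degree \<open>k\<close>, each factor \<open>x\<close> becomes \<open>var (x, \<mu>)\<close> plus variables of weight
  below \<open>\<mu>\<close>. After expanding, only the product of the \<open>k\<close> leading variables attains the weight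
  \<open>k \<mu>\<close>, and all other terms lie below it.
\<close>

lemma hat_top:
  fixes p :: "('x, 'f::field) mpoly"
  assumes W: "finite W" "\<mu> \<in> W" "\<And>\<omega>. \<omega> \<in> W \<Longrightarrow> exp_le \<omega> \<mu>"
    and p: "whomog (\<lambda>_. 1) (k::nat) p"
  defines "g \<equiv> of_nat k * int_exp \<mu>"
  shows "whomog vw g (psubst (\<lambda>x. var (x, \<mu>)) p)"
    and "below vw g (hat W p - psubst (\<lambda>x. var (x, \<mu>)) p)"
proof -
  let ?top = "psubst (\<lambda>x. var (x, \<mu>)) :: ('x, 'f) mpoly \<Rightarrow> ('x \<times> (nat \<Rightarrow>\<^sub>0 nat), 'f) mpoly"
  have lt: "int_exp \<omega> < int_exp \<mu>" if "\<omega> \<in> W - {\<mu>}" for \<omega>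
  proof -
    have "int_exp \<omega> \<le> int_exp \<mu>" using W(3) that by (simp add: int_exp_def exp_le_def le_fun_def)
    moreover have "int_exp \<omega> \<noteq> int_exp \<mu>" using that by (simp add: int_exp_inject)
    ultimately show ?thesis by simp
  qed
  have mono: "whomog vw (of_nat (mdeg m) * int_exp \<mu>) (?top (Poly_Mapping.single m 1)) \<and>
      below vw (of_nat (mdeg m) * int_exp \<mu>)
        (hat W (Poly_Mapping.single m (1::'f)) - ?top (Poly_Mapping.single m 1))"
    for m :: "'x \<Rightarrow>\<^sub>0 nat"
    using subset_UNIV
  proof (induction rule: monomial_induct)
    case one
    show ?case
      unfolding wdeg_0 of_nat_0 mult_zero_left single_one hat_def psubst_1 diff_self
      by (intro conjI below_0 whomog_Const[of vw 1, unfolded single_one])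
  next
    case (var_mult x n)
    let ?n = "Poly_Mapping.single n (1::'f)"
    let ?low = "\<Sum>\<omega>\<in>W - {\<mu>}. var (x, \<omega>) :: ('x \<times> (nat \<Rightarrow>\<^sub>0 nat), 'f) mpoly"
    let ?g = "of_nat (mdeg n) * int_exp \<mu>"
    have split: "Poly_Mapping.single (Poly_Mapping.single x 1 + n) (1::'f) = var x * ?n"
      by (simp add: var_def monomial_def mult_single)
    have g: "of_nat (mdeg (Poly_Mapping.single x 1 + n)) * int_exp \<mu> = int_exp \<mu> + ?g"
      by (simp add: distrib_right)
    have hat_x: "hat W (var x) = var (x, \<mu>) + ?low"
      unfolding hat_def psubst_var using W(1,2) by (rule sum.remove)
    have low: "below vw (int_exp \<mu>) ?low"
      using lt by (intro below_sum) (simp add: below_def var_def monomial_def)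
    have top_x: "whomog vw (int_exp \<mu>) (var (x, \<mu>))"
      using whomog_var[of vw "(x, \<mu>)"] by simp
    have 1: "whomog vw (int_exp \<mu> + ?g) (?top (var x * ?n))"
      unfolding psubst_mult psubst_var
      by (rule whomog_mult[OF top_x conjunct1[OF var_mult(3)]])
    have "hat W (var x * ?n) - ?top (var x * ?n) =
        (?low * (hat W ?n - ?top ?n) + ?low * ?top ?n) +
          (hat W ?n - ?top ?n) * var (x, \<mu>)"
      unfolding hat_def psubst_mult
      unfolding hat_def[symmetric] hat_x psubst_var by (simp only: algebra_simps)
    moreover have "below vw (int_exp \<mu> + ?g) (?low * (hat W ?n - ?top ?n))"
      by (rule below_mult_below[OF low conjunct2[OF var_mult(3)]])
    moreover have "below vw (int_exp \<mu> + ?g) (?low * ?top ?n)"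
      by (rule below_mult_whomog[OF low conjunct1[OF var_mult(3)]])
    moreover have "below vw (int_exp \<mu> + ?g) ((hat W ?n - ?top ?n) * var (x, \<mu>))"
      by (subst add.commute) (rule below_mult_whomog[OF conjunct2[OF var_mult(3)] top_x])
    ultimately have 2: "below vw (int_exp \<mu> + ?g) (hat W (var x * ?n) - ?top (var x * ?n))"
      by (simp add: below_add)
    show ?case unfolding split g by (rule conjI[OF 1 2])
  qed
  have p_eq: "p = (\<Sum>m\<in>keys p. Const (lookup p m) * Poly_Mapping.single m 1)"
    by (rule poly_mapping_eqI) (simp add: lookup_sum lookup_single when_def in_keys_iff)
  have k: "mdeg m = k" if "m \<in> keys p" for m
    using p that by (simp add: whomog_def)
  have top: "?top p = (\<Sum>m\<in>keys p. Const (lookup p m) * ?top (Poly_Mapping.single m 1))"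
    by (subst p_eq, simp only: psubst_sum psubst_mult) simp
  show "whomog vw g (?top p)"
    unfolding top
  proof (intro whomog_sum whomog_Const_mult)
    fix m assume "m \<in> keys p"
    show "whomog vw g (?top (Poly_Mapping.single m 1))"
      using conjunct1[OF mono[of m]] k[OF \<open>m \<in> keys p\<close>] by (simp add: g_def)
  qed
  have hat: "hat W p = (\<Sum>m\<in>keys p. Const (lookup p m) * hat W (Poly_Mapping.single m 1))"
    unfolding hat_def by (subst p_eq, simp only: psubst_sum psubst_mult) simp
  have "hat W p - ?top p = (\<Sum>m\<in>keys p. (hat W (Poly_Mapping.single m 1) -
      ?top (Poly_Mapping.single m 1)) * Const (lookup p m))"
    unfolding hat top by (simp add: sum_subtractf algebra_simps)
  also have "below vw g \<dots>"
  proof (rule below_sum)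
    fix m assume m: "m \<in> keys p"
    show "below vw g ((hat W (Poly_Mapping.single m 1) - ?top (Poly_Mapping.single m 1)) *
        Const (lookup p m))"
      using below_mult_whomog[OF conjunct2[OF mono[of m]] whomog_Const] k[OF m]
      unfolding g_def by simp
  qed
  finally show "below vw g (hat W p - ?top p)" .
qed

lemma wcomp_hat:
  assumes W: "finite W" "\<mu> \<in> W" "\<And>\<omega>. \<omega> \<in> W \<Longrightarrow> exp_le \<omega> \<mu>"
    and p: "whomog (\<lambda>_. 1) (k::nat) p"
  shows "wcomp vw (of_nat k * int_exp \<mu>) (hat W p) = psubst (\<lambda>x. var (x, \<mu>)) p"
    and "\<not> g \<le> of_nat k * int_exp \<mu> \<Longrightarrow> wcomp vw g (hat W p) = 0"
proof -
  let ?top = "psubst (\<lambda>x. var (x, \<mu>)) p"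
  have split: "wcomp vw g (hat W p) = wcomp vw g ?top + wcomp vw g (hat W p - ?top)" for g
    by (simp add: wcomp_diff)
  note top = hat_top[OF W p]
  show "wcomp vw (of_nat k * int_exp \<mu>) (hat W p) = ?top"
    unfolding split wcomp_below[OF top(2), of "of_nat k * int_exp \<mu>", simplified]
    using wcomp_whomog[OF top(1)] by simp
  assume g: "\<not> g \<le> of_nat k * int_exp \<mu>"
  then have "\<not> g < of_nat k * int_exp \<mu>" "g \<noteq> of_nat k * int_exp \<mu>" by auto
  then show "wcomp vw g (hat W p) = 0"
    unfolding split
    using wcomp_whomog[OF top(1), of g] wcomp_below[OF top(2) \<open>\<not> g < of_nat k * int_exp \<mu>\<close>] by simp
qed

lemma pindep_reindex:
  fixes g :: "'j \<Rightarrow> ('x, 'f::field) mpoly" and emb :: "'i \<Rightarrow> 'j"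
  assumes G: "pindep G g" and emb: "\<And>i. i \<in> I \<Longrightarrow> emb i \<in> G" and inv: "\<And>i. i \<in> I \<Longrightarrow> pr (emb i) = i"
  shows "pindep I (\<lambda>i. g (emb i))"
  unfolding pindep_def
proof (intro ballI impI)
  fix Q :: "('i, 'f) mpoly" assume Q: "Q \<in> polys I" "psubst (\<lambda>i. g (emb i)) Q = 0"
  let ?Q = "psubst (\<lambda>i. var (emb i)) Q"
  have "?Q \<in> polys G"
    using Q(1) emb by (intro polys_psubst[where X = I] polys_var)
  moreover have "psubst g ?Q = 0" using Q(2) by (simp add: psubst_psubst)
  ultimately have "?Q = 0" using G unfolding pindep_def by simp
  moreover have "psubst (\<lambda>j. var (pr j)) ?Q = psubst var Q"
    unfolding psubst_psubst psubst_var using inv by (intro psubst_cong[OF Q(1)]) simp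
  ultimately show "Q = 0" by (simp add: psubst_var_id)
qed

lemma pindep_cong:
  assumes "\<And>i. i \<in> I \<Longrightarrow> f i = g i"
  shows "pindep I f \<longleftrightarrow> pindep I g"
proof -
  have "psubst f Q = psubst g Q" if "Q \<in> polys I" for Q
    using that assms by (rule psubst_cong)
  then show ?thesis unfolding pindep_def by simp
qed

text \<open>
  A homomorphism turns a relation between elements into a relation between their images.
\<close>

lemma pindep_of_image:
  assumes "pindep I (\<lambda>i. psubst \<sigma> (f i))"
  shows "pindep I f"
  unfolding pindep_def
proof (intro ballI impI)
  fix Q assume Q: "Q \<in> polys I" "psubst f Q = 0"
  have "psubst (\<lambda>i. psubst \<sigma> (f i)) Q = psubst \<sigma> (psubst f Q)" by (simp only: psubst_psubst)
  then show "Q = 0" using assms Q unfolding pindep_def by simp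
qed

text \<open>
  The component of top weight \<open>k i \<mu>\<close> is \<open>f i\<close> itself in the variables \<open>(x, \<mu>)\<close>, which gives
  the implication from right to left.
  
  For the other implication, consider the Jacobian matrix of the components of weight
  \<open>g i \<omega> = k i \<mu> - \<omega>\<close> with respect to the variables \<open>(x, \<mu> - \<omega>')\<close>. The entry in row \<open>(i, \<omega>)\<close>
  is the component of \<open>hat (\<partial>f i/\<partial>x)\<close> of weight \<open>(k i - 1) \<mu> - (\<omega> - \<omega>')\<close>. Since
  \<open>\<partial>f i/\<partial>x\<close> has degree \<open>k i - 1\<close>, this vanishes unless \<open>\<omega>' \<le> \<omega>\<close>, and for \<open>\<omega>' = \<omega>\<close> it is
  \<open>\<partial>f i/\<partial>x\<close> in the variables \<open>(x, \<mu>)\<close>. So the matrix is block triangular, and each diagonal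
  block is the Jacobian matrix of \<open>f\<close>, whose rows are independent.
\<close>

theorem pindep_components_iff:
  fixes f :: "'i \<Rightarrow> ('x::linorder, 'f::field_char_0) mpoly" and \<mu> :: "nat \<Rightarrow>\<^sub>0 nat"
  assumes I: "finite I" and X: "finite X"
    and f: "\<And>i. i \<in> I \<Longrightarrow> f i \<in> polys X" "\<And>i. i \<in> I \<Longrightarrow> whomog (\<lambda>_. 1) (k i) (f i)"
    and k: "\<And>i. i \<in> I \<Longrightarrow> 1 \<le> (k i :: nat)"
    and W: "finite W" "\<mu> \<in> W" "\<And>\<omega>. \<omega> \<in> W \<Longrightarrow> exp_le \<omega> \<mu>"
    and W_down: "\<And>\<omega>. \<omega> \<in> W \<Longrightarrow> \<mu> - \<omega> \<in> W"
  defines "g \<equiv> \<lambda>i \<omega>. of_nat (k i) * int_exp \<mu> - int_exp \<omega>"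
  shows "pindep I f \<longleftrightarrow>
    pindep {(i, \<gamma>). i \<in> I \<and> \<gamma> \<in> g i ` W} (\<lambda>(i, \<gamma>). wcomp vw \<gamma> (hat W (f i)))"
    (is "_ \<longleftrightarrow> pindep ?G ?F")
proof
  let ?top = "psubst (\<lambda>x. var (x, \<mu>)) :: ('x, 'f) mpoly \<Rightarrow> ('x \<times> (nat \<Rightarrow>\<^sub>0 nat), 'f) mpoly"
  have zero_in: "0 \<in> W" using W_down[OF W(2)] by simp
  have g0: "g i 0 = of_nat (k i) * int_exp \<mu>" for i
    by (simp add: g_def int_exp_def zero_fun_def fun_eq_iff)
  {
    assume G: "pindep ?G ?F"
    have "pindep I (\<lambda>i. ?F (i, g i 0))"
      by (rule pindep_reindex[OF G, where pr = fst]) (use zero_in in auto)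
    moreover have "?F (i, g i 0) = ?top (f i)" if "i \<in> I" for i
      using wcomp_hat(1)[OF W f(2)[OF that]] by (simp add: g0)
    ultimately have "pindep I (\<lambda>i. ?top (f i))"
      using pindep_cong[of I "\<lambda>i. ?F (i, g i 0)" "\<lambda>i. ?top (f i)"] by simp
    then show "pindep I f" by (rule pindep_of_image)
  }
  assume indep: "pindep I f"
  have "\<exists>d N. d \<noteq> 0 \<and>
      (\<forall>i\<in>I. \<forall>k\<in>I. (\<Sum>x\<in>X. pdiff x (f i) * N x k) = (if i = k then d else 0))"
    by (rule jacobian_if_pindep[OF I X f(1) indep])
  then obtain d N where d: "d \<noteq> 0" and
    N: "\<forall>i\<in>I. \<forall>k\<in>I. (\<Sum>x\<in>X. pdiff x (f i) * N x k) = (if i = k then d else 0)"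
    by (elim exE conjE)
  have top_d: "?top d \<noteq> 0"
  proof
    assume "?top d = 0"
    then have "psubst (\<lambda>v. var (fst v)) (?top d) = 0" by simp
    then show False using d unfolding psubst_psubst by (simp add: psubst_var_id)
  qed
  have G: "finite ?G"
  proof -
    have "?G = Sigma I (\<lambda>i. g i ` W)" by auto
    then show ?thesis using I W(1) by simp
  qed
  have g_inj: "g i \<omega> = g i \<omega>' \<longleftrightarrow> \<omega> = \<omega>'" for i \<omega> \<omega>'
    by (simp add: g_def int_exp_inject)
  show "pindep ?G ?F"
  proof (rule pindep_if_rows_independent[OF G,
        where \<D> = "{pdiff (x, \<eta>) | x \<eta>. x \<in> X \<and> \<eta> \<in> W}"])
    show "derivation D" if "D \<in> {pdiff (x, \<eta>) | x \<eta>. x \<in> X \<and> \<eta> \<in> W}"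
      for D :: "('x \<times> (nat \<Rightarrow>\<^sub>0 nat), 'f) mpoly \<Rightarrow> _"
      using that by (auto simp: derivation_pdiff)
  next
    fix c :: "'i \<times> (nat \<Rightarrow> int) \<Rightarrow> ('x \<times> (nat \<Rightarrow>\<^sub>0 nat), 'f) mpoly"
    assume rows: "(\<Sum>v\<in>?G. c v * D (?F v)) = 0"
      if "D \<in> {pdiff (x, \<eta>) | x \<eta>. x \<in> X \<and> \<eta> \<in> W}" for D
    show "\<forall>v\<in>?G. c v = 0"
    proof (rule ccontr)
      assume "\<not> (\<forall>v\<in>?G. c v = 0)"
      then obtain i1 \<omega>1 where i1: "i1 \<in> I" "\<omega>1 \<in> W" "c (i1, g i1 \<omega>1) \<noteq> 0" by blast
      \<comment> \<open>Among the block rows that occur in the combination, take a maximal one. Every other block row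
        that occurs has a zero entry in the column block that belongs to it.\<close>
      define S where "S = {int_exp \<omega> | \<omega>. \<omega> \<in> W \<and> (\<exists>i\<in>I. c (i, g i \<omega>) \<noteq> 0)}"
      have "finite S" by (rule finite_subset[of S "int_exp ` W"]) (use W(1) in \<open>auto simp: S_def\<close>)
      moreover have "S \<noteq> {}" using i1 unfolding S_def by blast
      ultimately have "\<exists>m\<in>S. \<forall>b\<in>S. m \<le> b \<longrightarrow> m = b" by (rule finite_has_maximal)
      then obtain \<omega>0 where \<omega>0: "\<omega>0 \<in> W" "\<exists>i\<in>I. c (i, g i \<omega>0) \<noteq> 0"
        "\<forall>b\<in>S. int_exp \<omega>0 \<le> b \<longrightarrow> int_exp \<omega>0 = b"
        unfolding S_def by blast
      define \<eta> where "\<eta> = \<mu> - \<omega>0"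
      have \<eta>: "\<eta> \<in> W" "int_exp \<eta> = int_exp \<mu> - int_exp \<omega>0"
        unfolding \<eta>_def using \<omega>0(1) W_down W(3) int_exp_diff by auto
      have der: "pdiff (x, \<eta>) (?F (i, g i \<omega>)) =
          wcomp vw (of_nat (k i - 1) * int_exp \<mu> + (int_exp \<omega>0 - int_exp \<omega>)) (hat W (pdiff x (f i)))"
        if "i \<in> I" for x i \<omega>
      proof -
        have "of_nat (k i) * int_exp \<mu> = of_nat (k i - 1) * int_exp \<mu> + int_exp \<mu>"
          using k[OF that] by (cases "k i") (simp_all add: algebra_simps)
        then have "g i \<omega> - int_exp \<eta> = of_nat (k i - 1) * int_exp \<mu> + (int_exp \<omega>0 - int_exp \<omega>)"
          unfolding g_def \<eta>(2) by (simp add: algebra_simps)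
        then show ?thesis
          by (simp add: pdiff_wcomp pdiff_hat[OF W(1) \<eta>(1)])
      qed
      have hom: "whomog (\<lambda>_. 1) (k i - 1) (pdiff x (f i))" if "i \<in> I" for x i
        using whomog_pdiff[OF f(2)[OF that]] .
      have der_top: "pdiff (x, \<eta>) (?F (i, g i \<omega>0)) = ?top (pdiff x (f i))" if "i \<in> I" for x i
        using der[OF that, of x \<omega>0] wcomp_hat(1)[OF W hom[OF that]] by simp
      have vanish: "c (i, g i \<omega>) * pdiff (x, \<eta>) (?F (i, g i \<omega>)) = 0"
        if "i \<in> I" "\<omega> \<in> W" "\<omega> \<noteq> \<omega>0" for x i \<omega>
      proof (cases "int_exp \<omega>0 \<le> int_exp \<omega>")
        case True
        then have "int_exp \<omega> \<notin> S" using \<omega>0(3) that(3) by (auto simp: int_exp_inject)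
        then have "c (i, g i \<omega>) = 0" using that unfolding S_def by blast
        then show ?thesis by simp
      next
        case False
        then have "\<not> of_nat (k i - 1) * int_exp \<mu> + (int_exp \<omega>0 - int_exp \<omega>) \<le> of_nat (k i - 1) * int_exp \<mu>"
          by simp
        from wcomp_hat(2)[OF W hom[OF that(1)] this] show ?thesis
          unfolding der[OF that(1)] by simp
      qed
      have row: "(\<Sum>i\<in>I. c (i, g i \<omega>0) * ?top (pdiff x (f i))) = 0" if x: "x \<in> X" for x
      proof -
        have "0 = (\<Sum>v\<in>?G. c v * pdiff (x, \<eta>) (?F v))"
          by (rule rows[symmetric]) (use x \<eta> in blast)
        also have "\<dots> = (\<Sum>v\<in>(\<lambda>i. (i, g i \<omega>0)) ` I. c v * pdiff (x, \<eta>) (?F v))"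
        proof (rule sum.mono_neutral_right[OF G])
          show "(\<lambda>i. (i, g i \<omega>0)) ` I \<subseteq> ?G" using \<omega>0(1) by auto
          show "\<forall>v\<in>?G - (\<lambda>i. (i, g i \<omega>0)) ` I. c v * pdiff (x, \<eta>) (?F v) = 0"
          proof
            fix v assume v: "v \<in> ?G - (\<lambda>i. (i, g i \<omega>0)) ` I"
            then obtain i \<omega> where i: "v = (i, g i \<omega>)" "i \<in> I" "\<omega> \<in> W" by auto
            have "\<omega> \<noteq> \<omega>0" using v i by auto
            from vanish[OF i(2,3) this] show "c v * pdiff (x, \<eta>) (?F v) = 0" unfolding i(1) .
          qed
        qed
        also have "\<dots> = (\<Sum>i\<in>I. c (i, g i \<omega>0) * pdiff (x, \<eta>) (?F (i, g i \<omega>0)))"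
          by (subst sum.reindex) (auto intro: inj_onI)
        also have "\<dots> = (\<Sum>i\<in>I. c (i, g i \<omega>0) * ?top (pdiff x (f i)))"
          using der_top by (intro sum.cong refl) simp
        finally show ?thesis by simp
      qed
      \<comment> \<open>Multiply by the right inverse of the Jacobian matrix of \<open>f\<close>.\<close>
      have "c (l, g l \<omega>0) = 0" if l: "l \<in> I" for l
      proof -
        have "0 = (\<Sum>x\<in>X. (\<Sum>i\<in>I. c (i, g i \<omega>0) * ?top (pdiff x (f i))) * ?top (N x l))"
          using row by simp
        also have "\<dots> = (\<Sum>x\<in>X. \<Sum>i\<in>I. c (i, g i \<omega>0) * ?top (pdiff x (f i) * N x l))"
          by (simp add: sum_distrib_right psubst_mult mult.assoc)
        also have "\<dots> = (\<Sum>i\<in>I. \<Sum>x\<in>X. c (i, g i \<omega>0) * ?top (pdiff x (f i) * N x l))"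
          by (rule sum.swap)
        also have "\<dots> = (\<Sum>i\<in>I. c (i, g i \<omega>0) * ?top (\<Sum>x\<in>X. pdiff x (f i) * N x l))"
          by (simp add: sum_distrib_left psubst_sum)
        also have "\<dots> = (\<Sum>i\<in>I. if i = l then c (l, g l \<omega>0) * ?top d else 0)"
          using N l by (intro sum.cong) auto
        also have "\<dots> = c (l, g l \<omega>0) * ?top d" using I l by simp
        finally show ?thesis using top_d by simp
      qed
      then show False using \<omega>0(2) by blast
    qed
  qed
qed

section \<open>Quotients and coordinates\<close>

abbreviation (input) FF :: "'f::field ring" where
  "FF \<equiv> class_ring"

lemma cring_FF: "cring (FF :: 'f::field ring)"
  by (rule class_cring.cring_axioms)

lemma lin_span_least:
  assumes M: "Module.module FF V" and S: "S \<subseteq> P" and P: "P \<subseteq> carrier V" "\<zero>\<^bsub>V\<^esub> \<in> P"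
    and add: "\<And>x y. x \<in> P \<Longrightarrow> y \<in> P \<Longrightarrow> x \<oplus>\<^bsub>V\<^esub> y \<in> P"
    and smult: "\<And>c x. x \<in> P \<Longrightarrow> c \<odot>\<^bsub>V\<^esub> x \<in> P"
  shows "lin_span V S \<subseteq> P"
proof -
  have "LinearCombinations.submodule FF P V"
    using assms by (intro LinearCombinations.submodule.intro) auto
  then show ?thesis
    unfolding lin_span_def using LinearCombinations.module.span_is_subset[OF M S] by blast
qed

lemma lin_span_superset: "Module.module FF V \<Longrightarrow> S \<subseteq> carrier V \<Longrightarrow> S \<subseteq> lin_span V S"
  unfolding lin_span_def by (rule LinearCombinations.module.in_own_span)

lemma lin_span_closed:
  assumes M: "Module.module FF V" and S: "S \<subseteq> carrier V"
  shows "lin_span V S \<subseteq> carrier V" "\<zero>\<^bsub>V\<^esub> \<in> lin_span V S"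
    "x \<in> lin_span V S \<Longrightarrow> y \<in> lin_span V S \<Longrightarrow> x \<oplus>\<^bsub>V\<^esub> y \<in> lin_span V S"
    "x \<in> lin_span V S \<Longrightarrow> c \<odot>\<^bsub>V\<^esub> x \<in> lin_span V S"
proof -
  have "LinearCombinations.submodule FF (lin_span V S) V"
    unfolding lin_span_def by (rule LinearCombinations.module.span_is_submodule[OF M S])
  then interpret sm: LinearCombinations.submodule FF "lin_span V S" V .
  show "lin_span V S \<subseteq> carrier V" "\<zero>\<^bsub>V\<^esub> \<in> lin_span V S"
    "x \<in> lin_span V S \<Longrightarrow> y \<in> lin_span V S \<Longrightarrow> x \<oplus>\<^bsub>V\<^esub> y \<in> lin_span V S"
    "x \<in> lin_span V S \<Longrightarrow> c \<odot>\<^bsub>V\<^esub> x \<in> lin_span V S"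
    using sm.subset by auto
qed

text \<open>
  The underlying additive group is that of a type, which makes cosets translates of \<open>N\<close> and reduces
  their arithmetic to the type. Multiplication is left open, so that quotients of free modules and
  of polynomial algebras are both instances.
\<close>

locale quotient_space = Module.module "FF :: 'f::field ring" M
  for M :: "('f::field, 'u::ab_group_add) Module.module" (structure) +
  fixes N :: "'u set"
  assumes add_M: "add M = (+)" and zero_M: "\<zero>\<^bsub>M\<^esub> = 0"
    and N_sub: "N \<subseteq> carrier M" and N_0: "0 \<in> N"
    and N_add: "\<And>x y. x \<in> N \<Longrightarrow> y \<in> N \<Longrightarrow> x + y \<in> N"
    and N_smult: "\<And>c x. x \<in> N \<Longrightarrow> c \<odot>\<^bsub>M\<^esub> x \<in> N"
begin

abbreviation Q :: "('f, 'u set) Module.module" where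
  "Q \<equiv> quot_module M N"

definition cls :: "'u \<Rightarrow> 'u set" where
  "cls x = N +>\<^bsub>M\<^esub> x"

lemma M_add [simp]: "x \<in> carrier M \<Longrightarrow> y \<in> carrier M \<Longrightarrow> x + y \<in> carrier M"
  using M.a_closed by (simp add: add_M)

lemma M_0 [simp]: "0 \<in> carrier M"
  using M.zero_closed by (simp add: zero_M)

lemma smult_minus_1: "x \<in> carrier M \<Longrightarrow> (- 1) \<odot>\<^bsub>M\<^esub> x = - x"
proof -
  assume x: "x \<in> carrier M"
  have "(- 1 + 1) \<odot>\<^bsub>M\<^esub> x = (- 1) \<odot>\<^bsub>M\<^esub> x + x"
    using smult_l_distr[of "- 1" 1 x] smult_one[OF x] x by (simp add: add_M)
  moreover have "0 \<odot>\<^bsub>M\<^esub> x = 0" using smult_l_null[OF x] by (simp add: zero_M)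
  ultimately show ?thesis by (simp add: eq_neg_iff_add_eq_0)
qed

lemma M_uminus [simp]: "x \<in> carrier M \<Longrightarrow> - x \<in> carrier M"
  using smult_minus_1[of x] smult_closed[of "- 1" x] by simp

lemma M_diff [simp]: "x \<in> carrier M \<Longrightarrow> y \<in> carrier M \<Longrightarrow> x - y \<in> carrier M"
  using M_add[of x "- y"] by simp

lemma N_uminus: "x \<in> N \<Longrightarrow> - x \<in> N"
  using smult_minus_1[of x] N_smult[of x "- 1"] N_sub by auto

lemma N_diff: "x \<in> N \<Longrightarrow> y \<in> N \<Longrightarrow> x - y \<in> N"
  using N_add[of x "- y"] N_uminus[of y] by simp

lemma cls_image: "cls x = (\<lambda>h. h + x) ` N"
  unfolding cls_def a_r_coset_def' by (auto simp: add_M)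

lemma cls_eq_iff: "cls x = cls y \<longleftrightarrow> x - y \<in> N"
proof
  assume "cls x = cls y"
  then have "0 + x \<in> (\<lambda>h. h + y) ` N" unfolding cls_image using N_0 by blast
  then show "x - y \<in> N" by auto
next
  assume xy: "x - y \<in> N"
  have "h + x \<in> (\<lambda>h. h + y) ` N" if "h \<in> N" for h
    by (rule image_eqI[of _ _ "h + (x - y)"]) (use N_add that xy in auto)
  moreover have "h + y \<in> (\<lambda>h. h + x) ` N" if "h \<in> N" for h
    by (rule image_eqI[of _ _ "h - (x - y)"]) (use N_diff that xy in auto)
  ultimately show "cls x = cls y" unfolding cls_image by blast
qed

lemma carrier_Q: "carrier Q = cls ` carrier M"
  unfolding quot_module_def ring.extend_def module.fields_def FactRing_def
  by (auto simp: A_RCOSETS_def' cls_def)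

lemma cls_closed [simp]: "x \<in> carrier M \<Longrightarrow> cls x \<in> carrier Q"
  by (simp add: carrier_Q)

lemma add_Q: "cls x \<oplus>\<^bsub>Q\<^esub> cls y = cls (x + y)"
proof -
  have "cls x \<oplus>\<^bsub>Q\<^esub> cls y = (\<Union>a\<in>cls x. \<Union>b\<in>cls y. {a + b})"
    unfolding quot_module_def ring.extend_def module.fields_def FactRing_def
    by (simp add: set_add_def' add_M)
  also have "\<dots> = cls (x + y)"
  proof safe
    fix a b assume "a \<in> cls x" "b \<in> cls y"
    then obtain h k where "h \<in> N" "a = h + x" "k \<in> N" "b = k + y" unfolding cls_image by blast
    then show "a + b \<in> cls (x + y)"
      unfolding cls_image by (intro image_eqI[of _ _ "h + k"]) (auto intro: N_add simp: algebra_simps)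
  next
    fix a assume "a \<in> cls (x + y)"
    then obtain h where h: "h \<in> N" "a = h + (x + y)" unfolding cls_image by blast
    then have "a = (h + x) + (0 + y)" by (simp add: algebra_simps)
    moreover have "h + x \<in> cls x" "0 + y \<in> cls y" unfolding cls_image using h N_0 by blast+
    ultimately show "a \<in> (\<Union>a\<in>cls x. \<Union>b\<in>cls y. {a + b})" by blast
  qed
  finally show ?thesis .
qed

lemma zero_Q: "\<zero>\<^bsub>Q\<^esub> = cls 0"
  unfolding quot_module_def ring.extend_def module.fields_def FactRing_def
  by (simp add: cls_image)

lemma smult_Q:
  assumes x: "x \<in> carrier M"
  shows "c \<odot>\<^bsub>Q\<^esub> cls x = cls (c \<odot>\<^bsub>M\<^esub> x)"
proof -
  have "cls (c \<odot>\<^bsub>M\<^esub> y) = cls (c \<odot>\<^bsub>M\<^esub> x)" if y: "y \<in> cls x" for y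
  proof -
    obtain h where h: "h \<in> N" "y = h + x" using y unfolding cls_image by blast
    then have "c \<odot>\<^bsub>M\<^esub> y = c \<odot>\<^bsub>M\<^esub> h + c \<odot>\<^bsub>M\<^esub> x"
      using smult_r_distr[of c h x] N_sub x by (auto simp: add_M)
    then show ?thesis unfolding cls_eq_iff using N_smult[OF h(1)] by simp
  qed
  moreover have "cls x \<noteq> {}" unfolding cls_image using N_0 by blast
  ultimately have "(\<Union>y\<in>cls x. cls (c \<odot>\<^bsub>M\<^esub> y)) = cls (c \<odot>\<^bsub>M\<^esub> x)" by blast
  then show ?thesis
    unfolding quot_module_def ring.extend_def module.fields_def by (simp add: cls_def)
qed

lemma Q_cases:
  assumes "X \<in> carrier Q"
  obtains x where "x \<in> carrier M" "X = cls x"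
  using assms unfolding carrier_Q by blast

lemma module_Q: "Module.module FF Q"
proof (rule moduleI)
  show "cring (FF :: 'f ring)" by (rule cring_FF)
  show "abelian_group Q"
  proof (rule abelian_groupI)
    fix X assume "X \<in> carrier Q"
    then obtain x where x: "x \<in> carrier M" "X = cls x" by (rule Q_cases)
    show "\<exists>Y\<in>carrier Q. Y \<oplus>\<^bsub>Q\<^esub> X = \<zero>\<^bsub>Q\<^esub>"
      by (rule bexI[of _ "cls (- x)"]) (use x in \<open>simp_all add: add_Q zero_Q\<close>)
  qed (auto elim!: Q_cases simp: add_Q zero_Q algebra_simps)
next
  fix a b X
  assume "X \<in> carrier Q"
  then obtain x where x: "x \<in> carrier M" "X = cls x" by (rule Q_cases)
  have cl: "c \<odot>\<^bsub>M\<^esub> x \<in> carrier M" for c using smult_closed[of c x] x by simp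
  show "(a \<oplus>\<^bsub>FF\<^esub> b) \<odot>\<^bsub>Q\<^esub> X = a \<odot>\<^bsub>Q\<^esub> X \<oplus>\<^bsub>Q\<^esub> b \<odot>\<^bsub>Q\<^esub> X"
    using smult_l_distr[of a b x] x by (simp add: add_Q smult_Q add_M)
  show "(a \<otimes>\<^bsub>FF\<^esub> b) \<odot>\<^bsub>Q\<^esub> X = a \<odot>\<^bsub>Q\<^esub> (b \<odot>\<^bsub>Q\<^esub> X)"
    using smult_assoc1[of a b x] x cl by (simp add: smult_Q)
  show "\<one>\<^bsub>FF\<^esub> \<odot>\<^bsub>Q\<^esub> X = X"
    using smult_one[of x] x by (simp add: smult_Q)
  show "a \<odot>\<^bsub>Q\<^esub> X \<in> carrier Q" using x cl by (simp add: smult_Q)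
next
  fix a X Y
  assume "X \<in> carrier Q" "Y \<in> carrier Q"
  then obtain x y where xy: "x \<in> carrier M" "X = cls x" "y \<in> carrier M" "Y = cls y"
    by (elim Q_cases) blast
  then show "a \<odot>\<^bsub>Q\<^esub> (X \<oplus>\<^bsub>Q\<^esub> Y) = a \<odot>\<^bsub>Q\<^esub> X \<oplus>\<^bsub>Q\<^esub> a \<odot>\<^bsub>Q\<^esub> Y"
    using smult_r_distr[of a x y] by (simp add: add_Q smult_Q add_M)
qed

end

text \<open>
  A representative is chosen; for functions that are constant on cosets the choice is irrelevant.
\<close>

definition lift :: "('u \<Rightarrow> 'b) \<Rightarrow> 'u set \<Rightarrow> 'b" where
  "lift f X = f (SOME x. x \<in> X)"

lemma (in quotient_space) lift_cls:
  assumes add: "\<And>h y. h \<in> carrier M \<Longrightarrow> y \<in> carrier M \<Longrightarrow> f (h + y) = f h + f y"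
    and N: "\<And>h. h \<in> N \<Longrightarrow> f h = (0 :: 'b::monoid_add)" and x: "x \<in> carrier M"
  shows "lift f (cls x) = f x"
proof -
  have "0 + x \<in> cls x" unfolding cls_image using N_0 by blast
  then have "(SOME y. y \<in> cls x) \<in> cls x" by (rule someI)
  then obtain h where h: "h \<in> N" "(SOME y. y \<in> cls x) = h + x" unfolding cls_image by blast
  have "f (h + x) = f h + f x" using h N_sub x by (intro add) auto
  then show ?thesis unfolding lift_def h(2) using N[OF h(1)] by simp
qed

subsection \<open>Coordinate systems\<close>

text \<open>
  A finite basis \<open>b\<close> together with its coordinate functions \<open>c\<close>. The functions are kept as data,
  because a map out of a quotient is obtained from them.
\<close>

locale coord_system = Module.module "FF :: 'f::field ring" V
  for V :: "('f::field, 'v) Module.module" (structure) +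
  fixes J :: "'j set" and b :: "'j \<Rightarrow> 'v" and c :: "'j \<Rightarrow> 'v \<Rightarrow> 'f"
  assumes finite_J: "finite J" and b_closed: "\<And>j. j \<in> J \<Longrightarrow> b j \<in> carrier V"
    and c_add: "\<And>j x y. j \<in> J \<Longrightarrow> x \<in> carrier V \<Longrightarrow> y \<in> carrier V \<Longrightarrow> c j (x \<oplus> y) = c j x + c j y"
    and c_smult: "\<And>j a x. j \<in> J \<Longrightarrow> x \<in> carrier V \<Longrightarrow> c j (a \<odot> x) = a * c j x"
    and c_b: "\<And>i j. i \<in> J \<Longrightarrow> j \<in> J \<Longrightarrow> c i (b j) = (if i = j then 1 else 0)"
    and expand: "\<And>x. x \<in> carrier V \<Longrightarrow> x = (\<Oplus>j\<in>J. c j x \<odot> b j)"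

lemma fin_dim_coord_system:
  fixes L :: "('f::field, 'g) Module.module"
  assumes L: "vectorspace FF L" and fd: "vectorspace.fin_dim FF L"
  shows "\<exists>n b c. coord_system L {..<n::nat} b c"
proof -
  interpret vectorspace FF L by (rule L)
  obtain B where B: "finite B" "basis B" using finite_basis_exists[OF fd] by blast
  then have BL: "B \<subseteq> carrier L" by (simp add: basis_def)
  have ex1: "\<exists>!a. a \<in> B \<rightarrow>\<^sub>E carrier (FF :: 'f ring) \<and> lincomb a B = x" if "x \<in> carrier L" for x
    using basis_criterion[OF B(1) BL] B(2) that by blast
  have smult_01: "1 \<odot>\<^bsub>L\<^esub> v = v" "0 \<odot>\<^bsub>L\<^esub> v = \<zero>\<^bsub>L\<^esub>" if "v \<in> carrier L" for v
    using smult_one[OF that] smult_l_null[OF that] by simp_all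
  define co where "co x = (THE a. a \<in> B \<rightarrow>\<^sub>E carrier (FF :: 'f ring) \<and> lincomb a B = x)" for x
  have co: "co x \<in> B \<rightarrow>\<^sub>E UNIV" "lincomb (co x) B = x" if "x \<in> carrier L" for x
    using theI'[OF ex1[OF that]] unfolding co_def by auto
  have co_eq: "co x v = a v" if "a \<in> B \<rightarrow> carrier (FF :: 'f ring)" "lincomb a B = x" "v \<in> B" for a x v
  proof -
    have ra: "lincomb (restrict a B) B = x"
      using that(1,2) BL lincomb_cong[OF refl BL, of a "restrict a B"] by simp
    have x: "x \<in> carrier L" using lincomb_closed[OF BL] that(1,2) by auto
    have "co x = restrict a B"
      unfolding co_def by (rule the1_equality[OF ex1[OF x]]) (use ra in auto)
    then show ?thesis using that(3) by simp
  qed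
  obtain e where e: "bij_betw e {..<card B} B"
    using ex_bij_betw_nat_finite[OF B(1)] unfolding atLeast0LessThan by blast
  have eB: "e j \<in> B" if "j < card B" for j using e that by (auto simp: bij_betw_def)
  have "coord_system L {..<card B} e (\<lambda>j x. co x (e j))"
  proof
    fix j assume j: "j \<in> {..<card B}"
    then show "e j \<in> carrier L" using eB BL by auto
    {
      fix x y assume xy: "x \<in> carrier L" "y \<in> carrier L"
      have "lincomb (\<lambda>v. co x v \<oplus>\<^bsub>FF\<^esub> co y v) B = x \<oplus>\<^bsub>L\<^esub> y"
        using lincomb_sum[OF B(1) BL, of "co x" "co y"] co xy by simp
      then show "co (x \<oplus>\<^bsub>L\<^esub> y) (e j) = co x (e j) + co y (e j)"
        using co_eq[of "\<lambda>v. co x v \<oplus>\<^bsub>FF\<^esub> co y v" _ "e j"] eB j by simp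
    }
    {
      fix a x assume x: "x \<in> carrier L"
      have "lincomb (\<lambda>v. a \<otimes>\<^bsub>FF\<^esub> co x v) B = a \<odot>\<^bsub>L\<^esub> x"
        using lincomb_smult[OF BL, of "co x" a] co(2)[OF x] by simp
      then show "co (a \<odot>\<^bsub>L\<^esub> x) (e j) = a * co x (e j)"
        using co_eq[of "\<lambda>v. a \<otimes>\<^bsub>FF\<^esub> co x v" _ "e j"] eB j by simp
    }
    {
      fix i assume i: "i \<in> {..<card B}"
      have "lincomb (\<lambda>v. if v = e i then 1 else 0) B =
          (\<Oplus>\<^bsub>L\<^esub>v\<in>B. if e i = v then v else \<zero>\<^bsub>L\<^esub>)"
        unfolding lincomb_def using BL smult_01 by (intro M.finsum_cong') auto
      also have "\<dots> = e i"
        using M.finsum_singleton[of "e i" B "\<lambda>v. v"] eB i B(1) BL by auto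
      finally have "co (e i) (e j) = (if e j = e i then 1 else 0)"
        using co_eq[of "\<lambda>v. if v = e i then 1 else 0" _ "e j"] eB j by simp
      then show "co (e i) (e j) = (if j = i then 1 else 0)"
        using e i j by (auto simp: bij_betw_def inj_on_def)
    }
  next
    fix x assume x: "x \<in> carrier L"
    have "x = (\<Oplus>\<^bsub>L\<^esub>v\<in>B. co x v \<odot>\<^bsub>L\<^esub> v)" using co(2)[OF x] by (simp add: lincomb_def)
    also have "\<dots> = (\<Oplus>\<^bsub>L\<^esub>v\<in>e ` {..<card B}. co x v \<odot>\<^bsub>L\<^esub> v)" using e by (simp add: bij_betw_def)
    also have "\<dots> = (\<Oplus>\<^bsub>L\<^esub>j\<in>{..<card B}. co x (e j) \<odot>\<^bsub>L\<^esub> e j)"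
      using e BL by (intro M.finsum_reindex) (auto simp: bij_betw_def)
    finally show "x = (\<Oplus>\<^bsub>L\<^esub>j\<in>{..<card B}. co x (e j) \<odot>\<^bsub>L\<^esub> e j)" .
  qed simp
  then show ?thesis by blast
qed

text \<open>
  The vectors that agree with their expansion form a subspace, so a spanning set suffices in place
  of the expansion of every vector.
\<close>

lemma coord_systemI:
  fixes V :: "('f::field, 'v) Module.module" (structure)
  assumes M: "Module.module FF V" and J: "finite J" and b: "\<And>j. j \<in> J \<Longrightarrow> b j \<in> carrier V"
    and c_add: "\<And>j x y. j \<in> J \<Longrightarrow> x \<in> carrier V \<Longrightarrow> y \<in> carrier V \<Longrightarrow> c j (x \<oplus> y) = c j x + c j y"
    and c_smult: "\<And>j a x. j \<in> J \<Longrightarrow> x \<in> carrier V \<Longrightarrow> c j (a \<odot> x) = a * c j x"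
    and c_b: "\<And>i j. i \<in> J \<Longrightarrow> j \<in> J \<Longrightarrow> c i (b j) = (if i = j then 1 else 0)"
    and span: "carrier V \<subseteq> lin_span V (b ` J)"
  shows "coord_system V J b c"
proof -
  interpret V: Module.module FF V by (rule M)
  have sm: "1 \<odot> v = v" "0 \<odot> v = \<zero>" "a \<odot> v \<in> carrier V" if "v \<in> carrier V" for v and a :: 'f
    using V.smult_one[OF that] V.smult_l_null[OF that] V.smult_closed[of a, OF _ that] by simp_all
  define P where "P = {x \<in> carrier V. x = (\<Oplus>j\<in>J. c j x \<odot> b j)}"
  have closed: "(\<lambda>j. a j \<odot> b j) \<in> J \<rightarrow> carrier V" for a
    using b sm(3) by auto
  have "lin_span V (b ` J) \<subseteq> P"
  proof (rule lin_span_least[OF M])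
    show "b ` J \<subseteq> P"
    proof safe
      fix i assume i: "i \<in> J"
      have "(\<Oplus>j\<in>J. c j (b i) \<odot> b j) = (\<Oplus>j\<in>J. if i = j then b j else \<zero>)"
        using b i c_b sm by (intro V.M.finsum_cong') auto
      also have "\<dots> = b i" using V.M.finsum_singleton[of i J b] i J b by auto
      finally show "b i \<in> P" using b i by (simp add: P_def)
    qed
    have c0: "c j \<zero> = 0" if "j \<in> J" for j
      using c_smult[OF that, of \<zero> 0] sm by simp
    have "(\<Oplus>j\<in>J. c j \<zero> \<odot> b j) = (\<Oplus>j\<in>J. \<zero>)"
      using c0 sm b by (intro V.M.finsum_cong') auto
    then show "\<zero> \<in> P" unfolding P_def by simp
    show "x \<oplus> y \<in> P" if "x \<in> P" "y \<in> P" for x y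
    proof -
      have xy: "x \<in> carrier V" "y \<in> carrier V" "x = (\<Oplus>j\<in>J. c j x \<odot> b j)" "y = (\<Oplus>j\<in>J. c j y \<odot> b j)"
        using that unfolding P_def by auto
      have "(\<Oplus>j\<in>J. c j (x \<oplus> y) \<odot> b j) = (\<Oplus>j\<in>J. c j x \<odot> b j \<oplus> c j y \<odot> b j)"
      proof (rule V.M.finsum_cong'[OF refl])
        show "(\<lambda>j. c j x \<odot> b j \<oplus> c j y \<odot> b j) \<in> J \<rightarrow> carrier V"
          using b sm(3) by auto
        show "c j (x \<oplus> y) \<odot> b j = c j x \<odot> b j \<oplus> c j y \<odot> b j" if "j \<in> J" for j
          using V.smult_l_distr[of "c j x" "c j y" "b j"] c_add[OF that xy(1,2)] b[OF that] by simp
      qed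
      also have "\<dots> = x \<oplus> y"
        using V.M.finsum_addf[OF closed closed] xy(3,4) by simp
      finally show ?thesis using xy(1,2) by (simp add: P_def)
    qed
    show "a \<odot> x \<in> P" if "x \<in> P" for a x
    proof -
      have x: "x \<in> carrier V" "x = (\<Oplus>j\<in>J. c j x \<odot> b j)" using that unfolding P_def by auto
      have "(\<Oplus>j\<in>J. c j (a \<odot> x) \<odot> b j) = (\<Oplus>j\<in>J. a \<odot> (c j x \<odot> b j))"
      proof (rule V.M.finsum_cong'[OF refl])
        show "(\<lambda>j. a \<odot> (c j x \<odot> b j)) \<in> J \<rightarrow> carrier V"
          using b sm(3) by auto
        show "c j (a \<odot> x) \<odot> b j = a \<odot> (c j x \<odot> b j)" if "j \<in> J" for j
          using V.smult_assoc1[of a "c j x" "b j"] c_smult[OF that x(1)] b[OF that] by simp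
      qed
      also have "\<dots> = a \<odot> x"
        using V.finsum_smult[of a "\<lambda>j. c j x \<odot> b j" J] closed x(2) by simp
      finally show ?thesis using x(1) sm(3) by (simp add: P_def)
    qed
  qed (auto simp: P_def)
  then have "x = (\<Oplus>j\<in>J. c j x \<odot> b j)" if "x \<in> carrier V" for x
    using span that unfolding P_def by auto
  then show ?thesis
    using assms by (intro coord_system.intro coord_system_axioms.intro) auto
qed

context coord_system
begin

lemma smult_simps:
  assumes "v \<in> carrier V"
  shows "1 \<odot> v = v" "0 \<odot> v = \<zero>" "a \<odot> v \<in> carrier V"
  using smult_one[OF assms] smult_l_null[OF assms] smult_closed[of a, OF _ assms] by simp_all

lemma expand_induct [consumes 1, case_names zero smult add]:
  assumes x: "x \<in> carrier V" and zero: "P \<zero>" and b: "\<And>j a. j \<in> J \<Longrightarrow> P (a \<odot> b j)"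
    and add: "\<And>x y. x \<in> carrier V \<Longrightarrow> y \<in> carrier V \<Longrightarrow> P x \<Longrightarrow> P y \<Longrightarrow> P (x \<oplus> y)"
  shows "P x"
proof -
  have "P (\<Oplus>j\<in>S. c j x \<odot> b j) \<and> (\<Oplus>j\<in>S. c j x \<odot> b j) \<in> carrier V" if "finite S" "S \<subseteq> J" for S
    using that
  proof induction
    case empty
    show ?case using zero by simp
  next
    case (insert i S)
    have cl: "c j x \<odot> b j \<in> carrier V" if "j \<in> J" for j
      using b_closed[OF that] smult_simps(3) by simp
    have "(\<Oplus>j\<in>insert i S. c j x \<odot> b j) = c i x \<odot> b i \<oplus> (\<Oplus>j\<in>S. c j x \<odot> b j)"
      using insert cl by (intro M.finsum_insert) auto
    then show ?case using insert cl b add by simp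
  qed
  then have "P (\<Oplus>j\<in>J. c j x \<odot> b j)" using finite_J by blast
  then show ?thesis using expand[OF x] by simp
qed

lemma c_zero: "j \<in> J \<Longrightarrow> c j \<zero> = 0"
  using c_smult[of j \<zero> 0] smult_simps(2)[of \<zero>] by simp

lemma c_finsum:
  assumes j: "j \<in> J" and f: "f \<in> S \<rightarrow> carrier V"
  shows "c j (\<Oplus>i\<in>S. f i) = (\<Sum>i\<in>S. c j (f i))"
  using f
proof (induction S rule: infinite_finite_induct)
  case (insert x F)
  then have "(\<Oplus>i\<in>insert x F. f i) = f x \<oplus> (\<Oplus>i\<in>F. f i)"
    by (intro M.finsum_insert) auto
  moreover have "f x \<in> carrier V" "(\<Oplus>i\<in>F. f i) \<in> carrier V" using insert by auto
  ultimately show ?case using insert c_add[OF j] by simp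
qed (simp_all add: c_zero j)

end

section \<open>The polynomial and tensor constructions in coordinates\<close>

lemma mpoly_algebra_simps [simp]:
  "carrier (mpoly_algebra X) = polys X" "add (mpoly_algebra X) = (+)"
  "mult (mpoly_algebra X) = (*)" "one (mpoly_algebra X) = 1" "zero (mpoly_algebra X) = 0"
  "Module.smult (mpoly_algebra X) a p = Const a * p"
  by (simp_all add: mpoly_algebra_def)

lemma cring_mpoly_algebra: "cring (mpoly_algebra X :: ('f::field, ('x, 'f) mpoly) Module.module)"
proof (rule cringI)
  show "abelian_group (mpoly_algebra X :: ('f, ('x, 'f) mpoly) Module.module)"
  proof (rule abelian_groupI)
    fix p :: "('x, 'f) mpoly"
    assume "p \<in> carrier (mpoly_algebra X)"
    then show "\<exists>q\<in>carrier (mpoly_algebra X). q \<oplus>\<^bsub>mpoly_algebra X\<^esub> p = \<zero>\<^bsub>mpoly_algebra X\<^esub>"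
      unfolding mpoly_algebra_simps by (intro bexI[of _ "- p"]) (simp, rule polys_uminus)
  qed (simp_all add: polys_add polys_0 add_ac del: mem_Collect_eq)
  show "comm_monoid (mpoly_algebra X :: ('f, ('x, 'f) mpoly) Module.module)"
    by (rule comm_monoidI) (simp_all add: polys_mult polys_1 mult_ac del: mem_Collect_eq)
qed (simp add: algebra_simps)

lemma module_mpoly_algebra:
  "Module.module FF (mpoly_algebra X :: ('f::field, ('x, 'f) mpoly) Module.module)"
proof -
  interpret cring "mpoly_algebra X :: ('f, ('x, 'f) mpoly) Module.module"
    by (rule cring_mpoly_algebra)
  show ?thesis
  proof (rule moduleI)
    show "abelian_group (mpoly_algebra X :: ('f, ('x, 'f) mpoly) Module.module)"
      by (rule abelian_group_axioms)
    show "a \<odot>\<^bsub>mpoly_algebra X\<^esub> p \<in> carrier (mpoly_algebra X)"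
      if "p \<in> carrier (mpoly_algebra X)" for a and p :: "('x, 'f) mpoly"
      using polys_mult[OF polys_Const[of a X], of p] that by (simp del: mem_Collect_eq)
  qed (simp_all add: cring_FF single_add algebra_simps mult_single flip: mult.assoc)
qed

lemma lookup_map_times:
  "lookup (Poly_Mapping.map ((*) c) u) x = c * lookup u x" for u :: "'x \<Rightarrow>\<^sub>0 'f::field"
  by (simp add: Poly_Mapping.map.rep_eq when_def)

lemma free_module_simps [simp]:
  "carrier (free_module X) = {u. keys u \<subseteq> X}" "add (free_module X) = (+)"
  "zero (free_module X) = 0" "Module.smult (free_module X) c u = Poly_Mapping.map ((*) c) u"
  by (simp_all add: free_module_def)

lemma keys_map_times: "keys (Poly_Mapping.map ((*) c) u) \<subseteq> keys (u :: 'x \<Rightarrow>\<^sub>0 'f::field)"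
  by (auto simp: in_keys_iff lookup_map_times)

lemma module_free_module: "Module.module FF (free_module X :: ('f::field, 'x \<Rightarrow>\<^sub>0 'f) Module.module)"
proof (rule moduleI)
  show "abelian_group (free_module X :: ('f, 'x \<Rightarrow>\<^sub>0 'f) Module.module)"
  proof (rule abelian_groupI)
    fix u :: "'x \<Rightarrow>\<^sub>0 'f" assume u: "u \<in> carrier (free_module X)"
    show "\<exists>q\<in>carrier (free_module X). q \<oplus>\<^bsub>free_module X\<^esub> u = \<zero>\<^bsub>free_module X\<^esub>"
      using u by (intro bexI[of _ "- u"]) (auto simp: in_keys_iff)
    fix v :: "'x \<Rightarrow>\<^sub>0 'f" assume v: "v \<in> carrier (free_module X)"
    show "u \<oplus>\<^bsub>free_module X\<^esub> v \<in> carrier (free_module X)"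
      using u v keys_add[of u v] by auto
  qed (auto simp: algebra_simps)
  fix a b and u v :: "'x \<Rightarrow>\<^sub>0 'f"
  assume u: "u \<in> carrier (free_module X)"
  show "a \<odot>\<^bsub>free_module X\<^esub> u \<in> carrier (free_module X)"
    using u keys_map_times[of a u] by auto
  show "(a \<oplus>\<^bsub>FF\<^esub> b) \<odot>\<^bsub>free_module X\<^esub> u =
      a \<odot>\<^bsub>free_module X\<^esub> u \<oplus>\<^bsub>free_module X\<^esub> b \<odot>\<^bsub>free_module X\<^esub> u"
    by (simp, rule poly_mapping_eqI) (simp add: lookup_map_times lookup_add distrib_right)
  show "a \<odot>\<^bsub>free_module X\<^esub> (u \<oplus>\<^bsub>free_module X\<^esub> v) =
      a \<odot>\<^bsub>free_module X\<^esub> u \<oplus>\<^bsub>free_module X\<^esub> a \<odot>\<^bsub>free_module X\<^esub> v"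
    by (simp, rule poly_mapping_eqI) (simp add: lookup_map_times lookup_add distrib_left)
  show "(a \<otimes>\<^bsub>FF\<^esub> b) \<odot>\<^bsub>free_module X\<^esub> u = a \<odot>\<^bsub>free_module X\<^esub> (b \<odot>\<^bsub>free_module X\<^esub> u)"
    by (simp, rule poly_mapping_eqI) (simp add: lookup_map_times mult.assoc)
  show "\<one>\<^bsub>FF\<^esub> \<odot>\<^bsub>free_module X\<^esub> u = u"
    by (simp, rule poly_mapping_eqI) (simp add: lookup_map_times)
qed (rule cring_FF)

subsection \<open>The truncated polynomial algebra\<close>

definition trunc_coord :: "(nat \<Rightarrow>\<^sub>0 nat) \<Rightarrow> (nat, 'f::field) mpoly set \<Rightarrow> 'f" where
  "trunc_coord w = lift (\<lambda>p. lookup p w)"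

lemma polys_exps: "polys {..<l} = {p. keys p \<subseteq> exps l}"
  by (auto simp: exps_def)

context
  fixes l :: nat and \<Omega>0 :: "(nat \<Rightarrow>\<^sub>0 nat) set"
  assumes \<Omega>0_sub: "\<Omega>0 \<subseteq> exps l"
begin

lemma monomial_closed: "w \<in> exps l \<Longrightarrow> (monomial w :: (nat, 'f::field) mpoly) \<in> polys {..<l}"
  by (simp add: monomial_def exps_def)

lemma trunc_gens_closed: "(monomial ` \<Omega>0 :: (nat, 'f::field) mpoly set) \<subseteq> polys {..<l}"
  using monomial_closed \<Omega>0_sub by blast

text \<open>
  Linear combinations of the monomials in \<open>\<Omega>0\<close> are recognised by their support, so the
  coefficients outside \<open>\<Omega>0\<close> are well defined on cosets.
\<close>

lemma trunc_ideal_iff: "(p :: (nat, 'f::field) mpoly) \<in> trunc_ideal l \<Omega>0 \<longleftrightarrow> keys p \<subseteq> \<Omega>0"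
proof
  have "(trunc_ideal l \<Omega>0 :: (nat, 'f) mpoly set) \<subseteq> {p. keys p \<subseteq> \<Omega>0}"
    unfolding trunc_ideal_def
  proof (rule lin_span_least[OF module_mpoly_algebra])
    show "{p. keys p \<subseteq> \<Omega>0} \<subseteq> carrier (mpoly_algebra {..<l} :: ('f, (nat, 'f) mpoly) Module.module)"
      unfolding mpoly_algebra_simps polys_exps using \<Omega>0_sub by blast
    show "x \<oplus>\<^bsub>mpoly_algebra {..<l}\<^esub> y \<in> {p. keys p \<subseteq> \<Omega>0}"
      if "x \<in> {p. keys p \<subseteq> \<Omega>0}" "y \<in> {p. keys p \<subseteq> \<Omega>0}" for x y :: "(nat, 'f) mpoly"
      using that keys_add[of x y] by auto
  qed (auto simp: monomial_def in_keys_iff)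
  then show "p \<in> trunc_ideal l \<Omega>0 \<Longrightarrow> keys p \<subseteq> \<Omega>0" by blast
next
  assume p: "keys p \<subseteq> \<Omega>0"
  note closed = lin_span_closed[OF module_mpoly_algebra[of "{..<l}", where 'f = 'f],
      of "monomial ` \<Omega>0", folded trunc_ideal_def, simplified mpoly_algebra_simps, OF trunc_gens_closed]
  have "(\<Sum>m\<in>S. Const (lookup p m) * monomial m) \<in> trunc_ideal l \<Omega>0" if "finite S" "S \<subseteq> \<Omega>0" for S
    using that
  proof induction
    case empty
    show ?case using closed(2) by simp
  next
    case (insert m S)
    have "(monomial ` \<Omega>0 :: (nat, 'f) mpoly set) \<subseteq> trunc_ideal l \<Omega>0"
      unfolding trunc_ideal_def
      by (rule lin_span_superset[OF module_mpoly_algebra])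
        (simp only: mpoly_algebra_simps trunc_gens_closed)
    then have "(monomial m :: (nat, 'f) mpoly) \<in> trunc_ideal l \<Omega>0"
      using insert(4) by blast
    then show ?case using insert closed(3) closed(4) by simp
  qed
  then have "(\<Sum>m\<in>keys p. Const (lookup p m) * monomial m) \<in> trunc_ideal l \<Omega>0" using p by simp
  also have "(\<Sum>m\<in>keys p. Const (lookup p m) * monomial m) = p"
    by (rule poly_mapping_eqI)
      (simp add: monomial_def lookup_sum lookup_single when_def in_keys_iff)
  finally show "p \<in> trunc_ideal l \<Omega>0" .
qed

lemma quotient_space_trunc:
  "quotient_space (mpoly_algebra {..<l} :: ('f::field, _) Module.module) (trunc_ideal l \<Omega>0)"
proof (intro quotient_space.intro quotient_space_axioms.intro module_mpoly_algebra)
  show "trunc_ideal l \<Omega>0 \<subseteq> carrier (mpoly_algebra {..<l} :: ('f, _) Module.module)"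
    unfolding mpoly_algebra_simps polys_exps using \<Omega>0_sub trunc_ideal_iff by blast
  show "x + y \<in> trunc_ideal l \<Omega>0" if "x \<in> trunc_ideal l \<Omega>0" "y \<in> trunc_ideal l \<Omega>0"
    for x y :: "(nat, 'f) mpoly"
    using that keys_add[of x y] unfolding trunc_ideal_iff by blast
  show "c \<odot>\<^bsub>mpoly_algebra {..<l}\<^esub> x \<in> trunc_ideal l \<Omega>0" if "x \<in> trunc_ideal l \<Omega>0"
    for c and x :: "(nat, 'f) mpoly"
    using that unfolding trunc_ideal_iff by (auto simp: in_keys_iff)
  show "0 \<in> trunc_ideal l \<Omega>0" unfolding trunc_ideal_iff by simp
qed simp_all

lemma trunc_coord_system:
  assumes fin: "finite (exps l - \<Omega>0)"
  shows "coord_system (trunc_algebra l \<Omega>0 :: ('f::field, _) Module.module) (exps l - \<Omega>0)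
    (trunc_mono l \<Omega>0) trunc_coord"
proof -
  interpret T: quotient_space "mpoly_algebra {..<l} :: ('f, _) Module.module" "trunc_ideal l \<Omega>0"
    by (rule quotient_space_trunc)
  have A: "trunc_algebra l \<Omega>0 = T.Q" by (simp add: trunc_algebra_def)
  have tm: "trunc_mono l \<Omega>0 w = T.cls (monomial w)" for w
    by (simp add: trunc_mono_def T.cls_def)
  have co: "trunc_coord w (T.cls p) = lookup p w" if "w \<in> exps l - \<Omega>0" "p \<in> polys {..<l}" for w p
    unfolding trunc_coord_def
  proof (rule T.lift_cls)
    show "lookup h w = 0" if "h \<in> trunc_ideal l \<Omega>0" for h :: "(nat, 'f) mpoly"
      using that \<open>w \<in> exps l - \<Omega>0\<close> unfolding trunc_ideal_iff by (auto simp: in_keys_iff)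
  qed (use that in \<open>simp_all add: lookup_add\<close>)
  have tm_closed: "trunc_mono l \<Omega>0 w \<in> carrier T.Q" if "w \<in> exps l" for w
    unfolding tm using monomial_closed[OF that] by (intro T.cls_closed) simp
  show ?thesis
    unfolding A
  proof (rule coord_systemI[OF T.module_Q fin])
    show "trunc_mono l \<Omega>0 w \<in> carrier T.Q" if "w \<in> exps l - \<Omega>0" for w
      using that tm_closed by blast
    show "trunc_coord w (X \<oplus>\<^bsub>T.Q\<^esub> Y) = trunc_coord w X + trunc_coord w Y"
      if w: "w \<in> exps l - \<Omega>0" and XY: "X \<in> carrier T.Q" "Y \<in> carrier T.Q" for w X Y
    proof -
      obtain x y where xy: "x \<in> polys {..<l}" "X = T.cls x" "y \<in> polys {..<l}" "Y = T.cls y"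
        using XY unfolding T.carrier_Q mpoly_algebra_simps by blast
      then show ?thesis
        using co[OF w] polys_add[of x _ y] by (simp only: T.add_Q lookup_add)
    qed
    show "trunc_coord w (a \<odot>\<^bsub>T.Q\<^esub> X) = a * trunc_coord w X"
      if w: "w \<in> exps l - \<Omega>0" and X: "X \<in> carrier T.Q" for w a X
    proof -
      obtain x where x: "x \<in> polys {..<l}" "X = T.cls x"
        using X unfolding T.carrier_Q mpoly_algebra_simps by blast
      then have "a \<odot>\<^bsub>T.Q\<^esub> X = T.cls (Const a * x)" using T.smult_Q[of x a] by simp
      then show ?thesis
        using co[OF w] polys_mult[OF polys_Const[of a] x(1)] x by (simp only: lookup_Const_mult)
    qed
    show "trunc_coord v (trunc_mono l \<Omega>0 w) = (if v = w then 1 else 0 :: 'f)"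
      if "v \<in> exps l - \<Omega>0" "w \<in> exps l - \<Omega>0" for v w
      using that co[OF that(1) monomial_closed, of w] unfolding tm
      by (auto simp: monomial_def lookup_single when_def)
    show "carrier T.Q \<subseteq> lin_span T.Q (trunc_mono l \<Omega>0 ` (exps l - \<Omega>0))"
      (is "_ \<subseteq> ?span")
    proof
      have gens: "trunc_mono l \<Omega>0 ` (exps l - \<Omega>0) \<subseteq> carrier T.Q" using tm_closed by blast
      note cl = lin_span_closed[OF T.module_Q gens]
      fix X assume "X \<in> carrier T.Q"
      then obtain p where p: "p \<in> polys {..<l}" "X = T.cls p"
        unfolding T.carrier_Q mpoly_algebra_simps by blast
      have "T.cls (\<Sum>w\<in>S. Const (lookup p w) * monomial w) \<in> ?span"
        if "finite S" "S \<subseteq> exps l - \<Omega>0" for S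
        using that
      proof induction
        case empty
        show ?case using cl(2) by (simp add: T.zero_Q)
      next
        case (insert w S)
        have m: "(monomial w :: (nat, 'f) mpoly) \<in> polys {..<l}"
          using insert(4) by (intro monomial_closed) simp
        have "lookup p w \<odot>\<^bsub>T.Q\<^esub> trunc_mono l \<Omega>0 w \<in> ?span"
          using insert(4) subsetD[OF lin_span_superset[OF T.module_Q gens]] by (intro cl(4)) simp
        moreover have "lookup p w \<odot>\<^bsub>T.Q\<^esub> trunc_mono l \<Omega>0 w = T.cls (Const (lookup p w) * monomial w)"
          unfolding tm using T.smult_Q[of "monomial w" "lookup p w"] m by simp
        ultimately show ?case
          using insert cl(3) by (simp flip: T.add_Q)
      qed
      then have "T.cls (\<Sum>w\<in>exps l - \<Omega>0. Const (lookup p w) * monomial w) \<in> ?span"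
        using fin by blast
      moreover have "T.cls p = T.cls (\<Sum>w\<in>exps l - \<Omega>0. Const (lookup p w) * monomial w)"
      proof -
        have eq: "lookup p m = (\<Sum>w\<in>exps l - \<Omega>0. lookup p w * lookup (monomial w) m)"
          if "m \<notin> \<Omega>0" for m
        proof (cases "m \<in> exps l")
          case True
          then show ?thesis using fin that
            by (simp add: monomial_def lookup_single when_def sum.remove[of _ m])
        next
          case False
          then have "lookup p m = 0" using p(1) unfolding polys_exps by (auto simp: in_keys_iff)
          moreover have "(\<Sum>w\<in>exps l - \<Omega>0. lookup p w * lookup (monomial w) m) = 0"
            using False by (intro sum.neutral) (auto simp: monomial_def lookup_single when_def)
          ultimately show ?thesis by simp
        qed
        have "lookup (p - (\<Sum>w\<in>exps l - \<Omega>0. Const (lookup p w) * monomial w)) m = 0"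
          if "m \<notin> \<Omega>0" for m
          by (simp only: lookup_minus lookup_sum lookup_Const_mult eq[OF that, symmetric] diff_self)
        then show ?thesis
          unfolding T.cls_eq_iff trunc_ideal_iff by (meson in_keys_iff subsetI)
      qed
      ultimately show "X \<in> ?span" using p(2) by simp
    qed
  qed
qed

end

subsection \<open>Tensor products\<close>

text \<open>
  The functional on the tensor product induced by the bilinear form
  \<open>(v, w) \<mapsto> c j v * d k w\<close>.
\<close>

definition tensor_coord ::
  "('j \<Rightarrow> 'v \<Rightarrow> 'f::field) \<Rightarrow> ('k \<Rightarrow> 'w \<Rightarrow> 'f) \<Rightarrow> 'j \<times> 'k \<Rightarrow> (('v \<times> 'w) \<Rightarrow>\<^sub>0 'f) set \<Rightarrow> 'f" where
  "tensor_coord c d jk =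
    lift (\<lambda>u. \<Sum>vw\<in>keys u. lookup u vw * (c (fst jk) (fst vw) * d (snd jk) (snd vw)))"

locale tensor_coords = V: coord_system V J b c + W: coord_system W K e d
  for V :: "('f::field, 'v) Module.module" and J :: "'j set" and b c
    and W :: "('f, 'w) Module.module" and K :: "'k set" and e d
begin

abbreviation "M \<equiv> free_module (carrier V \<times> carrier W) :: ('f, ('v \<times> 'w) \<Rightarrow>\<^sub>0 'f) Module.module"
abbreviation "N \<equiv> tensor_subspace V W"

lemma relations_closed: "tensor_relations V W \<subseteq> carrier M"
proof -
  have diff: "u - v \<in> carrier M" if "u \<in> carrier M" "v \<in> carrier M" for u v
  proof -
    have "keys (u - v) \<subseteq> keys u \<union> keys v" by (auto simp: in_keys_iff lookup_minus)
    then show ?thesis using that by auto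
  qed
  have single: "Poly_Mapping.single (v, w) a \<in> carrier M"
    if "v \<in> carrier V" "w \<in> carrier W" for v w a
    using that by simp
  note [simp del] = free_module_simps(1)
  show ?thesis
    unfolding tensor_relations_def Let_def
    by (intro subsetI, elim UnE CollectE exE conjE;
        simp only:; intro diff single V.smult_simps(3) W.smult_simps(3) V.M.a_closed W.M.a_closed)
qed

sublocale Q: quotient_space M N
proof (intro quotient_space.intro quotient_space_axioms.intro module_free_module)
  note closed = lin_span_closed[OF module_free_module relations_closed, folded tensor_subspace_def]
  show "N \<subseteq> carrier M" "0 \<in> N" using closed(1,2) by auto
  show "x + y \<in> N" if "x \<in> N" "y \<in> N" for x y using closed(3)[OF that] by simp
  show "a \<odot>\<^bsub>M\<^esub> x \<in> N" if "x \<in> N" for a x using closed(4)[OF that] .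
qed simp_all

lemma tensor_module_eq: "tensor_module V W = Q.Q"
  by (simp add: tensor_module_def)

lemma pure_eq: "pure_tensor V W v w = Q.cls (Poly_Mapping.single (v, w) 1)"
  by (simp add: pure_tensor_def Q.cls_def)

lemma relation_cls:
  assumes "u - u' \<in> tensor_relations V W"
  shows "Q.cls u = Q.cls u'"
proof -
  have "tensor_relations V W \<subseteq> N"
    unfolding tensor_subspace_def by (rule lin_span_superset[OF module_free_module relations_closed])
  then show ?thesis unfolding Q.cls_eq_iff using assms by blast
qed

lemma relation_intros:
  assumes "v \<in> carrier V" "v' \<in> carrier V" "w \<in> carrier W" "w' \<in> carrier W"
  shows "Poly_Mapping.single (v \<oplus>\<^bsub>V\<^esub> v', w) 1 - Poly_Mapping.single (v, w) 1 -
      Poly_Mapping.single (v', w) 1 \<in> tensor_relations V W"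
    and "Poly_Mapping.single (v, w \<oplus>\<^bsub>W\<^esub> w') 1 - Poly_Mapping.single (v, w) 1 -
      Poly_Mapping.single (v, w') 1 \<in> tensor_relations V W"
    and "Poly_Mapping.single (a \<odot>\<^bsub>V\<^esub> v, w) 1 - Poly_Mapping.single (v, w) a \<in> tensor_relations V W"
    and "Poly_Mapping.single (v, a \<odot>\<^bsub>W\<^esub> w) 1 - Poly_Mapping.single (v, w) a \<in> tensor_relations V W"
  using assms unfolding tensor_relations_def Let_def by blast+

lemma single_cls:
  assumes "v \<in> carrier V" "w \<in> carrier W"
  shows "Q.cls (Poly_Mapping.single (v, w) a) = a \<odot>\<^bsub>Q.Q\<^esub> pure_tensor V W v w"
  unfolding pure_eq using Q.smult_Q[of "Poly_Mapping.single (v, w) 1" a] assms by simp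

lemma pure_closed:
  assumes "v \<in> carrier V" "w \<in> carrier W"
  shows "pure_tensor V W v w \<in> carrier Q.Q"
  unfolding pure_eq using assms by (intro Q.cls_closed) simp

lemma pure_add_left:
  assumes "v \<in> carrier V" "v' \<in> carrier V" "w \<in> carrier W"
  shows "pure_tensor V W (v \<oplus>\<^bsub>V\<^esub> v') w = pure_tensor V W v w \<oplus>\<^bsub>Q.Q\<^esub> pure_tensor V W v' w"
  unfolding pure_eq Q.add_Q
  by (rule relation_cls, unfold diff_diff_eq[symmetric])
    (rule relation_intros(1)[OF assms W.M.zero_closed])

lemma pure_add_right:
  assumes "v \<in> carrier V" "w \<in> carrier W" "w' \<in> carrier W"
  shows "pure_tensor V W v (w \<oplus>\<^bsub>W\<^esub> w') = pure_tensor V W v w \<oplus>\<^bsub>Q.Q\<^esub> pure_tensor V W v w'"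
  unfolding pure_eq Q.add_Q
  by (rule relation_cls, unfold diff_diff_eq[symmetric])
    (rule relation_intros(2)[OF assms(1) V.M.zero_closed assms(2,3)])

lemma pure_smult_left:
  assumes "v \<in> carrier V" "w \<in> carrier W"
  shows "pure_tensor V W (a \<odot>\<^bsub>V\<^esub> v) w = a \<odot>\<^bsub>Q.Q\<^esub> pure_tensor V W v w"
  unfolding single_cls[OF assms, symmetric] unfolding pure_eq
  by (rule relation_cls)
    (rule relation_intros(3)[OF assms(1) V.M.zero_closed assms(2) W.M.zero_closed])

lemma pure_smult_right:
  assumes "v \<in> carrier V" "w \<in> carrier W"
  shows "pure_tensor V W v (a \<odot>\<^bsub>W\<^esub> w) = a \<odot>\<^bsub>Q.Q\<^esub> pure_tensor V W v w"
  unfolding single_cls[OF assms, symmetric] unfolding pure_eq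
  by (rule relation_cls)
    (rule relation_intros(4)[OF assms(1) V.M.zero_closed assms(2) W.M.zero_closed])

definition tensor_form :: "'j \<times> 'k \<Rightarrow> (('v \<times> 'w) \<Rightarrow>\<^sub>0 'f) \<Rightarrow> 'f" where
  "tensor_form jk u = (\<Sum>vw\<in>keys u. lookup u vw * (c (fst jk) (fst vw) * d (snd jk) (snd vw)))"

lemma tensor_form_add: "tensor_form jk (u + u') = tensor_form jk u + tensor_form jk u'"
  unfolding tensor_form_def by (rule sum_keys_add) (simp_all add: distrib_right)

lemma tensor_form_0: "tensor_form jk 0 = 0"
  by (simp add: tensor_form_def)

lemma tensor_form_diff: "tensor_form jk (u - u') = tensor_form jk u - tensor_form jk u'"
  using tensor_form_add[of jk "u - u'" u'] by simp

lemma tensor_form_single: "tensor_form (j, k) (Poly_Mapping.single (v, w) a) = a * (c j v * d k w)"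
  unfolding tensor_form_def by (subst sum_keys_single) simp_all

lemma tensor_form_map: "tensor_form jk (Poly_Mapping.map ((*) a) u) = a * tensor_form jk u"
proof -
  have "tensor_form jk (Poly_Mapping.map ((*) a) u) = (\<Sum>vw\<in>keys u.
      lookup (Poly_Mapping.map ((*) a) u) vw * (c (fst jk) (fst vw) * d (snd jk) (snd vw)))"
    unfolding tensor_form_def by (intro sum_keys_superset) (simp_all add: keys_map_times)
  then show ?thesis by (simp add: lookup_map_times tensor_form_def sum_distrib_left mult.assoc)
qed

text \<open>
  Bilinearity of the products of coordinate functions is exactly what the relations ask for.
\<close>

lemma tensor_form_N:
  assumes "j \<in> J" "k \<in> K" "u \<in> N"
  shows "tensor_form (j, k) u = 0"
proof -
  have "N \<subseteq> {u \<in> carrier M. tensor_form (j, k) u = 0}"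
    unfolding tensor_subspace_def
  proof (rule lin_span_least[OF module_free_module])
    show "tensor_relations V W \<subseteq> {u \<in> carrier M. tensor_form (j, k) u = 0}"
    proof -
      have "\<forall>u\<in>tensor_relations V W. tensor_form (j, k) u = 0"
        unfolding tensor_relations_def Let_def ball_Un
        by (intro conjI ballI; elim CollectE exE conjE; hypsubst;
          simp add: tensor_form_add tensor_form_diff tensor_form_single V.c_add[OF assms(1)] W.c_add[OF assms(2)]
            V.c_smult[OF assms(1)] W.c_smult[OF assms(2)] algebra_simps)
      then show ?thesis using relations_closed by blast
    qed
    show "x \<oplus>\<^bsub>M\<^esub> y \<in> {u \<in> carrier M. tensor_form (j, k) u = 0}"
      if "x \<in> {u \<in> carrier M. tensor_form (j, k) u = 0}" "y \<in> {u \<in> carrier M. tensor_form (j, k) u = 0}" for x y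
      using that keys_add[of x y] by (auto simp: tensor_form_add)
    show "a \<odot>\<^bsub>M\<^esub> x \<in> {u \<in> carrier M. tensor_form (j, k) u = 0}"
      if "x \<in> {u \<in> carrier M. tensor_form (j, k) u = 0}" for a x
      using that keys_map_times[of a x] by (auto simp: tensor_form_map)
  qed (auto simp: tensor_form_0)
  then show ?thesis using assms(3) by blast
qed

lemma tensor_coord_cls:
  assumes "j \<in> J" "k \<in> K" "u \<in> carrier M"
  shows "tensor_coord c d (j, k) (Q.cls u) = tensor_form (j, k) u"
proof -
  have "lift (tensor_form (j, k)) (Q.cls u) = tensor_form (j, k) u"
    using tensor_form_N[OF assms(1,2)] assms(3) by (intro Q.lift_cls) (simp_all add: tensor_form_add)
  then show ?thesis by (simp add: tensor_coord_def tensor_form_def[abs_def])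
qed

lemma tensor_coord_pure:
  assumes "j \<in> J" "k \<in> K" "v \<in> carrier V" "w \<in> carrier W"
  shows "tensor_coord c d (j, k) (pure_tensor V W v w) = c j v * d k w"
  unfolding pure_eq using assms by (subst tensor_coord_cls) (simp_all add: tensor_form_single)

text \<open>
  The coordinate functions separate the products of basis vectors. These products span: a pure
  tensor is expanded first in its left and then in its right factor.
\<close>

lemma tensor_coord_system:
  "coord_system (tensor_module V W) (J \<times> K) (\<lambda>(j, k). pure_tensor V W (b j) (e k)) (tensor_coord c d)"
  unfolding tensor_module_eq
proof (rule coord_systemI[OF Q.module_Q])
  show "finite (J \<times> K)" using V.finite_J W.finite_J by simp
  show "(case jk of (j, k) \<Rightarrow> pure_tensor V W (b j) (e k)) \<in> carrier Q.Q" if "jk \<in> J \<times> K" for jk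
    using that V.b_closed W.b_closed by (auto intro: pure_closed)
  show "tensor_coord c d jk (X \<oplus>\<^bsub>Q.Q\<^esub> Y) = tensor_coord c d jk X + tensor_coord c d jk Y"
    if jk: "jk \<in> J \<times> K" and XY: "X \<in> carrier Q.Q" "Y \<in> carrier Q.Q" for jk X Y
  proof -
    from XY(1) obtain x where x: "x \<in> carrier M" "X = Q.cls x" by (rule Q.Q_cases)
    from XY(2) obtain y where y: "y \<in> carrier M" "Y = Q.cls y" by (rule Q.Q_cases)
    obtain j k where jk': "jk = (j, k)" "j \<in> J" "k \<in> K" using jk by (elim SigmaE)
    show ?thesis
      using tensor_coord_cls[OF jk'(2,3)] x(1) y(1) Q.M_add[OF x(1) y(1)]
      by (simp only: jk'(1) x(2) y(2) Q.add_Q tensor_form_add)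
  qed
  show "tensor_coord c d jk (a \<odot>\<^bsub>Q.Q\<^esub> X) = a * tensor_coord c d jk X"
    if jk: "jk \<in> J \<times> K" and X: "X \<in> carrier Q.Q" for jk a X
  proof -
    from X obtain x where x: "x \<in> carrier M" "X = Q.cls x" by (rule Q.Q_cases)
    obtain j k where jk': "jk = (j, k)" "j \<in> J" "k \<in> K" using jk by (elim SigmaE)
    have "Poly_Mapping.map ((*) a) x \<in> carrier M"
      using order.trans[OF keys_map_times, of x "carrier V \<times> carrier W" a] x(1) by simp
    from tensor_coord_cls[OF jk'(2,3) this] show ?thesis
      using tensor_coord_cls[OF jk'(2,3) x(1)] Q.smult_Q[OF x(1), of a]
      by (simp only: jk'(1) x(2) tensor_form_map free_module_simps(4))
  qed
  show "tensor_coord c d jk (case jk' of (j, k) \<Rightarrow> pure_tensor V W (b j) (e k)) =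
      (if jk = jk' then 1 else 0)" if "jk \<in> J \<times> K" "jk' \<in> J \<times> K" for jk jk'
    using that
    by (auto simp: tensor_coord_pure V.b_closed W.b_closed V.c_b W.c_b split: if_splits)
  let ?B = "(\<lambda>(j, k). pure_tensor V W (b j) (e k)) ` (J \<times> K)"
  have gens: "?B \<subseteq> carrier Q.Q"
    using V.b_closed W.b_closed by (auto intro: pure_closed)
  note cl = lin_span_closed[OF Q.module_Q gens]
  have bb: "pure_tensor V W (b j) (e k) \<in> lin_span Q.Q ?B" if "j \<in> J" "k \<in> K" for j k
    using that by (intro subsetD[OF lin_span_superset[OF Q.module_Q gens]]) blast
  have null: "0 \<odot>\<^bsub>Q.Q\<^esub> X = \<zero>\<^bsub>Q.Q\<^esub>" if "X \<in> carrier Q.Q" for X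
    using Module.module.smult_l_null[OF Q.module_Q that] by simp
  have vb: "pure_tensor V W v (e k) \<in> lin_span Q.Q ?B" if v: "v \<in> carrier V" and k: "k \<in> K" for v k
    using v
  proof (induction rule: V.expand_induct)
    case zero
    have "pure_tensor V W (0 \<odot>\<^bsub>V\<^esub> \<zero>\<^bsub>V\<^esub>) (e k) = \<zero>\<^bsub>Q.Q\<^esub>"
      unfolding pure_smult_left[OF V.M.zero_closed W.b_closed[OF k]]
      by (rule null[OF pure_closed[OF V.M.zero_closed W.b_closed[OF k]]])
    then show ?case using cl(2) V.smult_simps(2)[of "\<zero>\<^bsub>V\<^esub>"] by simp
  next
    case (smult j a)
    show ?case
      unfolding pure_smult_left[OF V.b_closed[OF smult] W.b_closed[OF k]] by (rule cl(4)[OF bb[OF smult k]])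
  next
    case (add x y)
    show ?case
      unfolding pure_add_left[OF add(1,2) W.b_closed[OF k]] by (rule cl(3)[OF add(3,4)])
  qed
  have vw: "pure_tensor V W v w \<in> lin_span Q.Q ?B" if v: "v \<in> carrier V" and w: "w \<in> carrier W" for v w
    using w
  proof (induction rule: W.expand_induct)
    case zero
    have "pure_tensor V W v (0 \<odot>\<^bsub>W\<^esub> \<zero>\<^bsub>W\<^esub>) = \<zero>\<^bsub>Q.Q\<^esub>"
      unfolding pure_smult_right[OF v W.M.zero_closed]
      by (rule null[OF pure_closed[OF v W.M.zero_closed]])
    then show ?case using cl(2) W.smult_simps(2)[of "\<zero>\<^bsub>W\<^esub>"] by simp
  next
    case (smult k a)
    show ?case
      unfolding pure_smult_right[OF v W.b_closed[OF smult]] by (rule cl(4)[OF vb[OF v smult]])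
  next
    case (add x y)
    show ?case
      unfolding pure_add_right[OF v add(1,2)] by (rule cl(3)[OF add(3,4)])
  qed
  show "carrier Q.Q \<subseteq> lin_span Q.Q ?B"
  proof
    fix X assume "X \<in> carrier Q.Q"
    then obtain u where u: "u \<in> carrier M" "X = Q.cls u" by (rule Q.Q_cases)
    have "Q.cls (\<Sum>x\<in>S. Poly_Mapping.single x (lookup u x)) \<in> lin_span Q.Q ?B"
      if "finite S" "S \<subseteq> keys u" for S
      using that
    proof induction
      case empty
      show ?case using cl(2) by (simp add: Q.zero_Q)
    next
      case (insert x S)
      obtain v w where x: "x = (v, w)" "v \<in> carrier V" "w \<in> carrier W"
        using insert(4) u(1) by auto
      have "Q.cls (Poly_Mapping.single x (lookup u x)) \<in> lin_span Q.Q ?B"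
        unfolding x(1) single_cls[OF x(2,3)] by (rule cl(4)[OF vw[OF x(2,3)]])
      then show ?case using insert cl(3) by (simp flip: Q.add_Q)
    qed
    then have "Q.cls (\<Sum>x\<in>keys u. Poly_Mapping.single x (lookup u x)) \<in> lin_span Q.Q ?B" by simp
    also have "(\<Sum>x\<in>keys u. Poly_Mapping.single x (lookup u x)) = u"
      by (rule poly_mapping_eqI) (simp add: lookup_sum lookup_single when_def in_keys_iff)
    finally show "X \<in> lin_span Q.Q ?B" using u(2) by simp
  qed
qed

end

section \<open>The symmetric algebra in coordinates\<close>

text \<open>
  A coordinate system of \<open>V\<close> identifies \<open>S(V)\<close> with the polynomials in the variables \<open>J\<close>. The
  isomorphism \<open>phi\<close> is induced by \<open>lin\<close>, which sends a vector to the linear form of its coordinates;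
  its inverse \<open>psi\<close> substitutes the basis vectors for the variables.
\<close>

locale sym_coords = coord_system V J b c
  for V :: "('f::field, 'v) Module.module" and J :: "'x set" and b c
begin

abbreviation "M \<equiv> mpoly_algebra (carrier V) :: ('f, ('v, 'f) mpoly) Module.module"
abbreviation "N \<equiv> sym_ideal V"
abbreviation "S \<equiv> sym_algebra V"

definition lin :: "'v \<Rightarrow> ('x, 'f) mpoly" where
  "lin v = (\<Sum>j\<in>J. Const (c j v) * var j)"

lemma relations_closed: "sym_relations V \<subseteq> polys (carrier V)"
proof -
  have "var (x \<oplus>\<^bsub>V\<^esub> y) - var x - var y \<in> polys (carrier V)"
    if "x \<in> carrier V" "y \<in> carrier V" for x y
    by (intro polys_diff polys_var) (use that in auto)
  moreover have "var (a \<odot>\<^bsub>V\<^esub> x) - Const a * var x \<in> polys (carrier V)" if "x \<in> carrier V" for a x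
    by (intro polys_diff polys_mult polys_Const polys_var smult_simps(3)) (use that in auto)
  ultimately show ?thesis
    unfolding sym_relations_def by (intro subsetI, elim UnE CollectE exE conjE) (simp_all only:)
qed

lemma ideal_N: "ideal N M"
proof -
  interpret PA: cring M by (rule cring_mpoly_algebra)
  show ?thesis
    unfolding sym_ideal_def
    by (rule PA.genideal_ideal) (simp only: mpoly_algebra_simps relations_closed)
qed

sublocale Q: quotient_space M N
  rewrites "quot_module M N = S"
proof -
  interpret I: ideal N M by (rule ideal_N)
  have sub: "N \<subseteq> carrier M" using I.a_subset .
  show "quotient_space M N"
  proof (intro quotient_space.intro quotient_space_axioms.intro module_mpoly_algebra sub)
    have sg: "additive_subgroup N M" by (rule I.is_additive_subgroup)
    show "0 \<in> N" using additive_subgroup.zero_closed[OF sg] by simp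
    show "x + y \<in> N" if "x \<in> N" "y \<in> N" for x y
      using additive_subgroup.a_closed[OF sg that] by simp
    show "a \<odot>\<^bsub>M\<^esub> x \<in> N" if "x \<in> N" for a x
      using I.I_l_closed[OF that, of "Const a"] by simp
  qed simp_all
  show "quot_module M N = S" by (simp add: sym_algebra_def)
qed

lemma N_mult: "p \<in> N \<Longrightarrow> q \<in> polys (carrier V) \<Longrightarrow> p * q \<in> N"
  using ideal.I_r_closed[OF ideal_N, of p q] by (simp del: mem_Collect_eq)

lemma relations_N: "sym_relations V \<subseteq> N"
proof -
  interpret PA: cring M by (rule cring_mpoly_algebra)
  show ?thesis
    unfolding sym_ideal_def
    by (rule PA.genideal_self) (simp only: mpoly_algebra_simps relations_closed)
qed

lemma mult_S:
  assumes "p \<in> polys (carrier V)" "q \<in> polys (carrier V)"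
  shows "Q.cls p \<otimes>\<^bsub>S\<^esub> Q.cls q = Q.cls (p * q)"
  using ideal.rcoset_mult_add[OF ideal_N, of p q] assms
  unfolding sym_algebra_def quot_module_def ring.extend_def module.fields_def FactRing_def Q.cls_def
  by (simp del: mem_Collect_eq)

lemma one_S: "\<one>\<^bsub>S\<^esub> = Q.cls 1"
  unfolding sym_algebra_def quot_module_def ring.extend_def module.fields_def FactRing_def Q.cls_def
  by simp

lemma carrier_S: "carrier S = Q.cls ` polys (carrier V)"
  using Q.carrier_Q by (simp only: mpoly_algebra_simps)

lemma cls_closed: "p \<in> polys (carrier V) \<Longrightarrow> Q.cls p \<in> carrier S"
  unfolding carrier_S by blast

lemma S_cases:
  assumes "X \<in> carrier S"
  obtains p where "p \<in> polys (carrier V)" "X = Q.cls p"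
  using assms unfolding carrier_S by blast

lemma smult_S: "p \<in> polys (carrier V) \<Longrightarrow> a \<odot>\<^bsub>S\<^esub> Q.cls p = Q.cls (Const a * p)"
  using Q.smult_Q[of p a] by (simp del: mem_Collect_eq)

lemma module_S: "Module.module FF S"
  by (rule Q.module_Q)

lemma cring_S: "cring S"
proof -
  interpret S: Module.module FF S by (rule module_S)
  show ?thesis
  proof (rule cringI)
    show "abelian_group S" by (rule S.M.abelian_group_axioms)
    show "comm_monoid S"
    proof (rule comm_monoidI)
      show "\<one>\<^bsub>S\<^esub> \<in> carrier S" unfolding one_S by (rule cls_closed[OF polys_1])
    qed ((elim S_cases; simp add: mult_S one_S polys_mult polys_1 cls_closed mult_ac
        del: mem_Collect_eq)+)
    show "(X \<oplus>\<^bsub>S\<^esub> Y) \<otimes>\<^bsub>S\<^esub> Z = X \<otimes>\<^bsub>S\<^esub> Z \<oplus>\<^bsub>S\<^esub> Y \<otimes>\<^bsub>S\<^esub> Z"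
      if "X \<in> carrier S" "Y \<in> carrier S" "Z \<in> carrier S" for X Y Z
      using that by (elim S_cases)
        (simp add: Q.add_Q mult_S polys_add polys_mult distrib_right del: mem_Collect_eq)
  qed
qed

lemma lin_add: "x \<in> carrier V \<Longrightarrow> y \<in> carrier V \<Longrightarrow> lin (x \<oplus>\<^bsub>V\<^esub> y) = lin x + lin y"
  unfolding lin_def sum.distrib[symmetric]
  by (intro sum.cong) (simp_all add: c_add single_add distrib_right)

lemma lin_smult: "x \<in> carrier V \<Longrightarrow> lin (a \<odot>\<^bsub>V\<^esub> x) = Const a * lin x"
  unfolding lin_def sum_distrib_left
  by (intro sum.cong) (simp_all add: c_smult flip: mult.assoc)

lemma lin_b: "j \<in> J \<Longrightarrow> lin (b j) = var j"
proof -
  assume j: "j \<in> J"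
  have "lin (b j) = (\<Sum>i\<in>J. if i = j then var j else 0)"
    unfolding lin_def using j by (intro sum.cong) (simp_all add: c_b)
  then show ?thesis using j finite_J by simp
qed

lemma polys_lin: "lin v \<in> polys J"
  unfolding lin_def by (intro polys_sum polys_mult polys_Const polys_var)

text \<open>
  Linearity of \<open>lin\<close> makes the relations vanish, and the kernel of a substitution is an ideal.
\<close>

lemma psubst_lin_N:
  assumes "p \<in> N"
  shows "psubst lin p = 0"
proof -
  interpret PA: cring M by (rule cring_mpoly_algebra)
  let ?K = "{p \<in> polys (carrier V). psubst lin p = 0}"
  have "ideal ?K M"
  proof (rule idealI)
    show "Ring.ring M" by (rule PA.ring_axioms)
    show "subgroup ?K (add_monoid M)"
    proof (rule group.subgroupI[OF abelian_group.a_group[OF ring.is_abelian_group[OF cring.axioms(1)[OF cring_mpoly_algebra]]]])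
      show "?K \<subseteq> carrier (add_monoid M)" by auto
      have "0 \<in> ?K" by simp
      then show "?K \<noteq> {}" by blast
      fix p q assume p: "p \<in> ?K" and q: "q \<in> ?K"
      have p': "p \<in> polys (carrier V)" "- p \<in> polys (carrier V)"
        using p polys_uminus by blast+
      have "inv\<^bsub>add_monoid M\<^esub> p = - p"
        using p' by (intro group.inv_equality[OF abelian_group.a_group[OF ring.is_abelian_group[OF cring.axioms(1)[OF cring_mpoly_algebra]]]]) simp_all
      then show "inv\<^bsub>add_monoid M\<^esub> p \<in> ?K" using p p'(2) by (simp add: psubst_uminus)
      have "p + q \<in> polys (carrier V)" by (rule polys_add) (use p q in simp_all)
      then show "p \<otimes>\<^bsub>add_monoid M\<^esub> q \<in> ?K" using p q by (simp add: psubst_add)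
    qed
    fix p q assume p: "p \<in> ?K" and q: "q \<in> carrier M"
    have "q * p \<in> polys (carrier V)" "p * q \<in> polys (carrier V)"
      by (rule polys_mult; use p q in simp)+
    then show "q \<otimes>\<^bsub>M\<^esub> p \<in> ?K" "p \<otimes>\<^bsub>M\<^esub> q \<in> ?K"
      using p by (simp_all add: psubst_mult)
  qed
  moreover have "sym_relations V \<subseteq> ?K"
  proof -
    have "\<forall>p\<in>sym_relations V. psubst lin p = 0"
      unfolding sym_relations_def ball_Un
      by (intro conjI ballI; elim CollectE exE conjE; hypsubst;
        simp add: psubst_diff psubst_mult lin_add lin_smult)
    then show ?thesis using relations_closed by blast
  qed
  ultimately have "N \<subseteq> ?K" unfolding sym_ideal_def by (rule PA.genideal_minimal)
  then show ?thesis using assms by blast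
qed

abbreviation subst_b :: "('x, 'f) mpoly \<Rightarrow> ('v, 'f) mpoly" where
  "subst_b \<equiv> psubst (\<lambda>j. var (b j))"

lemma subst_b_polys: "p \<in> polys J \<Longrightarrow> subst_b p \<in> polys (carrier V)"
  by (rule polys_psubst) (auto intro!: polys_var b_closed simp del: mem_Collect_eq)

lemma var_minus_lin: "v \<in> carrier V \<Longrightarrow> var v - subst_b (lin v) \<in> N"
proof (induction rule: expand_induct)
  case zero
  have "var (0 \<odot>\<^bsub>V\<^esub> \<zero>\<^bsub>V\<^esub>) - Const 0 * var \<zero>\<^bsub>V\<^esub> \<in> sym_relations V"
    unfolding sym_relations_def by blast
  then have "var \<zero>\<^bsub>V\<^esub> \<in> N" using relations_N smult_simps(2)[of "\<zero>\<^bsub>V\<^esub>"] by auto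
  moreover have "lin \<zero>\<^bsub>V\<^esub> = 0" using lin_smult[of "\<zero>\<^bsub>V\<^esub>" 0] smult_simps(2)[of "\<zero>\<^bsub>V\<^esub>"] by simp
  ultimately show ?case by simp
next
  case (smult j a)
  have "var (a \<odot>\<^bsub>V\<^esub> b j) - Const a * var (b j) \<in> sym_relations V"
    unfolding sym_relations_def using b_closed[OF smult] by blast
  then show ?case
    using relations_N by (auto simp: lin_smult b_closed[OF smult] lin_b[OF smult] psubst_mult)
next
  case (add x y)
  have "var (x \<oplus>\<^bsub>V\<^esub> y) - var x - var y \<in> N"
    using relations_N add(1,2) unfolding sym_relations_def by blast
  from Q.N_add[OF Q.N_add[OF this add(3)] add(4)] show ?case
    by (simp add: lin_add[OF add(1,2)] psubst_add algebra_simps)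
qed

text \<open>
  Modulo the relations a vector equals the expansion in the basis, hence so does every polynomial
  in vectors. Together with \<open>psubst_lin_N\<close>, this shows that the relations generate the kernel of
  \<open>psubst lin\<close>.
\<close>

lemma minus_subst_lin: "p \<in> polys (carrier V) \<Longrightarrow> p - subst_b (psubst lin p) \<in> N"
proof (induction rule: mpoly_induct)
  case (Const a)
  then show ?case using Q.N_0 by simp
next
  case (var v)
  then show ?case using var_minus_lin by simp
next
  case (add p q)
  then show ?case using Q.N_add[OF add(3,4)] by (simp add: psubst_add algebra_simps)
next
  case (mult p q)
  let ?p = "subst_b (psubst lin p)" and ?q = "subst_b (psubst lin q)"
  have "?p \<in> polys (carrier V)"
    by (intro subst_b_polys polys_psubst[OF mult(1)] polys_lin)
  from Q.N_add[OF N_mult[OF mult(3,2)] N_mult[OF mult(4) this]] show ?case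
    by (simp add: psubst_mult algebra_simps)
qed

definition phi :: "('f, 'v) sym \<Rightarrow> ('x, 'f) mpoly" where
  "phi = lift (psubst lin)"

definition psi :: "('x, 'f) mpoly \<Rightarrow> ('f, 'v) sym" where
  "psi p = Q.cls (subst_b p)"

lemma phi_cls: "p \<in> polys (carrier V) \<Longrightarrow> phi (Q.cls p) = psubst lin p"
  unfolding phi_def by (rule Q.lift_cls) (simp_all add: psubst_add psubst_lin_N del: mem_Collect_eq)

lemma phi_psi: "p \<in> polys J \<Longrightarrow> phi (psi p) = p"
proof -
  assume p: "p \<in> polys J"
  have "phi (psi p) = psubst (\<lambda>j. lin (b j)) p"
    unfolding psi_def phi_cls[OF subst_b_polys[OF p]] psubst_psubst psubst_var ..
  also have "\<dots> = psubst var p" using lin_b by (intro psubst_cong[OF p])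
  finally show ?thesis by (simp add: psubst_var_id)
qed

lemma psi_closed: "p \<in> polys J \<Longrightarrow> psi p \<in> carrier S"
  unfolding psi_def by (intro cls_closed subst_b_polys)

lemma polys_phi: "X \<in> carrier S \<Longrightarrow> phi X \<in> polys J"
  by (elim S_cases) (simp only: phi_cls polys_psubst polys_lin)

lemma phi_add: "X \<in> carrier S \<Longrightarrow> Y \<in> carrier S \<Longrightarrow> phi (X \<oplus>\<^bsub>S\<^esub> Y) = phi X + phi Y"
  by (elim S_cases) (simp add: Q.add_Q phi_cls polys_add psubst_add del: mem_Collect_eq)

lemma phi_mult: "X \<in> carrier S \<Longrightarrow> Y \<in> carrier S \<Longrightarrow> phi (X \<otimes>\<^bsub>S\<^esub> Y) = phi X * phi Y"
  by (elim S_cases) (simp add: mult_S phi_cls polys_mult psubst_mult del: mem_Collect_eq)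

lemma phi_smult: "X \<in> carrier S \<Longrightarrow> phi (a \<odot>\<^bsub>S\<^esub> X) = Const a * phi X"
  by (elim S_cases)
    (simp add: smult_S phi_cls polys_mult[OF polys_Const] psubst_mult del: mem_Collect_eq)

lemma phi_zero: "phi \<zero>\<^bsub>S\<^esub> = 0" and phi_one: "phi \<one>\<^bsub>S\<^esub> = 1"
  unfolding Q.zero_Q one_S using phi_cls[OF polys_0] phi_cls[OF polys_1] by simp_all

lemma sym_incl_eq: "sym_incl V v = Q.cls (var v)"
  by (simp add: sym_incl_def Q.cls_def)

lemma sym_incl_closed: "v \<in> carrier V \<Longrightarrow> sym_incl V v \<in> carrier S"
  unfolding sym_incl_eq by (intro cls_closed polys_var)

lemma phi_incl: "v \<in> carrier V \<Longrightarrow> phi (sym_incl V v) = lin v"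
  unfolding sym_incl_eq by (simp only: phi_cls polys_var psubst_var)

lemma psi_phi: "X \<in> carrier S \<Longrightarrow> psi (phi X) = X"
proof (elim S_cases)
  fix p assume p: "p \<in> polys (carrier V)" "X = Q.cls p"
  have "Q.cls p = Q.cls (subst_b (psubst lin p))"
    unfolding Q.cls_eq_iff by (rule minus_subst_lin[OF p(1)])
  then show ?thesis unfolding p(2) psi_def phi_cls[OF p(1)] by (rule sym)
qed

lemma phi_inject: "X \<in> carrier S \<Longrightarrow> Y \<in> carrier S \<Longrightarrow> phi X = phi Y \<longleftrightarrow> X = Y"
  using psi_phi by metis

lemma phi_finsum: "f \<in> I \<rightarrow> carrier S \<Longrightarrow> phi (\<Oplus>\<^bsub>S\<^esub>i\<in>I. f i) = (\<Sum>i\<in>I. phi (f i))"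
proof (induction I rule: infinite_finite_induct)
  case (insert x F)
  interpret S: cring S by (rule cring_S)
  have "(\<Oplus>\<^bsub>S\<^esub>i\<in>insert x F. f i) = f x \<oplus>\<^bsub>S\<^esub> (\<Oplus>\<^bsub>S\<^esub>i\<in>F. f i)"
    using insert by (intro S.finsum_insert) auto
  then show ?case using insert by (simp add: phi_add Pi_iff)
next
  case (infinite I)
  interpret S: cring S by (rule cring_S)
  show ?case using infinite by (simp add: phi_zero)
next
  case empty
  interpret S: cring S by (rule cring_S)
  show ?case by (simp add: phi_zero)
qed

lemma phi_finprod: "f \<in> I \<rightarrow> carrier S \<Longrightarrow> phi (\<Otimes>\<^bsub>S\<^esub>i\<in>I. f i) = (\<Prod>i\<in>I. phi (f i))"
proof (induction I rule: infinite_finite_induct)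
  case (insert x F)
  interpret S: cring S by (rule cring_S)
  have "(\<Otimes>\<^bsub>S\<^esub>i\<in>insert x F. f i) = f x \<otimes>\<^bsub>S\<^esub> (\<Otimes>\<^bsub>S\<^esub>i\<in>F. f i)"
    using insert by (intro S.finprod_insert) auto
  then show ?case using insert by (simp add: phi_mult Pi_iff)
next
  case (infinite I)
  interpret S: cring S by (rule cring_S)
  show ?case using infinite by (simp add: phi_one)
next
  case empty
  interpret S: cring S by (rule cring_S)
  show ?case by (simp add: phi_one)
qed

lemma phi_power: "X \<in> carrier S \<Longrightarrow> phi (X [^]\<^bsub>S\<^esub> (n::nat)) = phi X ^ n"
proof (induction n)
  case 0
  interpret S: cring S by (rule cring_S)
  show ?case by (simp add: phi_one)
next
  case (Suc n)
  interpret S: cring S by (rule cring_S)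
  show ?case using Suc by (simp add: phi_mult)
qed

lemma phi_alg_eval:
  assumes f: "f \<in> I \<rightarrow> carrier S" and P: "P \<in> polys I"
  shows "alg_eval S f P \<in> carrier S" "phi (alg_eval S f P) = psubst (\<lambda>i. phi (f i)) P"
proof -
  interpret S: cring S by (rule cring_S)
  interpret SM: Module.module FF S by (rule module_S)
  have pow: "f i [^]\<^bsub>S\<^esub> lookup m i \<in> carrier S" if "m \<in> keys P" "i \<in> keys m" for m i
    using f P that by (intro S.nat_pow_closed) auto
  have prd: "(\<Otimes>\<^bsub>S\<^esub>i\<in>keys m. f i [^]\<^bsub>S\<^esub> lookup m i) \<in> carrier S" if "m \<in> keys P" for m
    using pow[OF that] by (intro S.finprod_closed) auto
  have trm: "a \<odot>\<^bsub>S\<^esub> (\<Otimes>\<^bsub>S\<^esub>i\<in>keys m. f i [^]\<^bsub>S\<^esub> lookup m i) \<in> carrier S" if "m \<in> keys P" for a m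
    using SM.smult_closed[of a, OF _ prd[OF that]] by simp
  show "alg_eval S f P \<in> carrier S"
    unfolding alg_eval_def using trm by (intro S.finsum_closed) auto
  have "phi (alg_eval S f P) =
      (\<Sum>m\<in>keys P. phi (lookup P m \<odot>\<^bsub>S\<^esub> (\<Otimes>\<^bsub>S\<^esub>i\<in>keys m. f i [^]\<^bsub>S\<^esub> lookup m i)))"
    unfolding alg_eval_def using trm by (intro phi_finsum) auto
  also have "\<dots> = (\<Sum>m\<in>keys P. Const (lookup P m) * mval (\<lambda>i. phi (f i)) m)"
  proof (intro sum.cong refl)
    fix m assume m: "m \<in> keys P"
    have fi: "f i \<in> carrier S" if "i \<in> keys m" for i using f P m that by auto
    have "phi (\<Otimes>\<^bsub>S\<^esub>i\<in>keys m. f i [^]\<^bsub>S\<^esub> lookup m i) = (\<Prod>i\<in>keys m. phi (f i [^]\<^bsub>S\<^esub> lookup m i))"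
      by (rule phi_finprod) (rule Pi_I, rule pow[OF m])
    also have "\<dots> = mval (\<lambda>i. phi (f i)) m"
      unfolding mval_def using phi_power[OF fi] by (rule prod.cong[OF refl])
    finally show "phi (lookup P m \<odot>\<^bsub>S\<^esub> (\<Otimes>\<^bsub>S\<^esub>i\<in>keys m. f i [^]\<^bsub>S\<^esub> lookup m i)) =
        Const (lookup P m) * mval (\<lambda>i. phi (f i)) m"
      by (simp only: phi_smult[OF prd[OF m]])
  qed
  finally show "phi (alg_eval S f P) = psubst (\<lambda>i. phi (f i)) P" by (simp add: psubst_def)
qed

lemma alg_indep_iff_pindep:
  assumes f: "f \<in> I \<rightarrow> carrier S"
  shows "alg_indep S I f \<longleftrightarrow> pindep I (\<lambda>i. phi (f i))"
proof -
  interpret S: cring S by (rule cring_S)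
  have "alg_eval S f P = \<zero>\<^bsub>S\<^esub> \<longleftrightarrow> psubst (\<lambda>i. phi (f i)) P = 0" if P: "P \<in> polys I" for P
    using phi_inject[OF phi_alg_eval(1)[OF f P] S.zero_closed] phi_alg_eval(2)[OF f P] phi_zero by simp
  then show ?thesis
    unfolding alg_indep_def pindep_def mpoly_algebra_simps by blast
qed

lemma phi_lin_span:
  assumes G: "G \<subseteq> carrier S" and X: "X \<in> lin_span S G"
    and gen: "\<And>g. g \<in> G \<Longrightarrow> P (phi g)" and zero: "P 0"
    and add: "\<And>p q. P p \<Longrightarrow> P q \<Longrightarrow> P (p + q)" and smult: "\<And>a p. P p \<Longrightarrow> P (Const a * p)"
  shows "P (phi X)"
proof -
  interpret S: Module.module FF S by (rule module_S)
  have "lin_span S G \<subseteq> {X \<in> carrier S. P (phi X)}"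
  proof (rule lin_span_least[OF module_S])
    show "G \<subseteq> {X \<in> carrier S. P (phi X)}" using G gen by blast
    show "{X \<in> carrier S. P (phi X)} \<subseteq> carrier S" by blast
    show "\<zero>\<^bsub>S\<^esub> \<in> {X \<in> carrier S. P (phi X)}" using zero by (simp add: phi_zero)
    show "X \<oplus>\<^bsub>S\<^esub> Y \<in> {X \<in> carrier S. P (phi X)}"
      if "X \<in> {X \<in> carrier S. P (phi X)}" "Y \<in> {X \<in> carrier S. P (phi X)}" for X Y
      using that add by (simp add: phi_add)
    show "a \<odot>\<^bsub>S\<^esub> X \<in> {X \<in> carrier S. P (phi X)}" if "X \<in> {X \<in> carrier S. P (phi X)}" for a X
      using that smult S.smult_closed[of a X] by (simp add: phi_smult)
  qed
  then show ?thesis using X by blast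
qed

end

lemma (in sym_coords) psi_add: "psi (p + q) = psi p \<oplus>\<^bsub>S\<^esub> psi q"
  by (simp add: psi_def psubst_add Q.add_Q)

lemma (in sym_coords) psi_Const_mult:
  "p \<in> polys J \<Longrightarrow> psi (Const a * p) = a \<odot>\<^bsub>S\<^esub> psi p"
  using smult_S[OF subst_b_polys] by (simp add: psi_def psubst_mult)

lemma (in sym_coords) psi_0: "psi 0 = \<zero>\<^bsub>S\<^esub>"
  by (simp add: psi_def Q.zero_Q)

lemma (in sym_coords) S_closed:
  "X \<in> carrier S \<Longrightarrow> Y \<in> carrier S \<Longrightarrow> X \<oplus>\<^bsub>S\<^esub> Y \<in> carrier S"
  "X \<in> carrier S \<Longrightarrow> Y \<in> carrier S \<Longrightarrow> X \<otimes>\<^bsub>S\<^esub> Y \<in> carrier S"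
  "X \<in> carrier S \<Longrightarrow> a \<odot>\<^bsub>S\<^esub> X \<in> carrier S"
  "\<zero>\<^bsub>S\<^esub> \<in> carrier S" "\<one>\<^bsub>S\<^esub> \<in> carrier S"
proof -
  interpret S: Module.module FF S by (rule module_S)
  interpret SR: cring S by (rule cring_S)
  show "X \<in> carrier S \<Longrightarrow> Y \<in> carrier S \<Longrightarrow> X \<oplus>\<^bsub>S\<^esub> Y \<in> carrier S"
    "X \<in> carrier S \<Longrightarrow> Y \<in> carrier S \<Longrightarrow> X \<otimes>\<^bsub>S\<^esub> Y \<in> carrier S"
    "X \<in> carrier S \<Longrightarrow> a \<odot>\<^bsub>S\<^esub> X \<in> carrier S"
    "\<zero>\<^bsub>S\<^esub> \<in> carrier S" "\<one>\<^bsub>S\<^esub> \<in> carrier S"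
    using S.smult_closed[of a X] by auto
qed

section \<open>The elements \<open>p\<^sub>\<gamma>\<close> in coordinates\<close>

text \<open>
  The definite description picks a unique homomorphism. In coordinates it can only be the
  substitution of the images of the basis vectors, because a homomorphism is determined by the
  vectors and \<open>f\<close> is linear; conversely this substitution, carried back to the symmetric algebras,
  extends \<open>f\<close>.
\<close>

lemma sym_extend_phi:
  fixes V :: "('f::field, 'v) Module.module" and V' :: "('f, 'w) Module.module"
  assumes sc: "sym_coords V J b c" and sc': "sym_coords V' J' b' c'"
    and f: "\<And>x. x \<in> carrier V \<Longrightarrow> f x \<in> carrier (sym_algebra V')"
    and f_add: "\<And>x y. x \<in> carrier V \<Longrightarrow> y \<in> carrier V \<Longrightarrow>
      f (x \<oplus>\<^bsub>V\<^esub> y) = f x \<oplus>\<^bsub>sym_algebra V'\<^esub> f y"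
    and f_smult: "\<And>a x. x \<in> carrier V \<Longrightarrow> f (a \<odot>\<^bsub>V\<^esub> x) = a \<odot>\<^bsub>sym_algebra V'\<^esub> f x"
    and X: "X \<in> carrier (sym_algebra V)"
  shows "sym_extend V (sym_algebra V') f X \<in> carrier (sym_algebra V')"
    and "sym_coords.phi J' c' (sym_extend V (sym_algebra V') f X) =
      psubst (\<lambda>j. sym_coords.phi J' c' (f (b j))) (sym_coords.phi J c X)"
proof -
  interpret A: sym_coords V J b c by (rule sc)
  interpret B: sym_coords V' J' b' c' by (rule sc')
  define \<sigma> where "\<sigma> j = B.phi (f (b j))" for j
  have \<sigma>: "\<sigma> j \<in> polys J'" if "j \<in> J" for j
    unfolding \<sigma>_def by (intro B.polys_phi f A.b_closed that)
  define h where "h = restrict (\<lambda>X. B.psi (psubst \<sigma> (A.phi X))) (carrier A.S)"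
  have poly: "psubst \<sigma> (A.phi X) \<in> polys J'" if "X \<in> carrier A.S" for X
    using A.polys_phi[OF that] \<sigma> by (rule polys_psubst)
  have h_closed: "h X \<in> carrier B.S" if "X \<in> carrier A.S" for X
    unfolding h_def using that B.psi_closed[OF poly[OF that]] by simp
  have phi_h: "B.phi (h X) = psubst \<sigma> (A.phi X)" if "X \<in> carrier A.S" for X
    unfolding h_def using that B.phi_psi[OF poly[OF that]] by simp
  have f_lin: "B.phi (f v) = psubst \<sigma> (A.lin v)" if "v \<in> carrier V" for v
    using that
  proof (induction rule: A.expand_induct)
    case zero
    have "B.phi (f (0 \<odot>\<^bsub>V\<^esub> \<zero>\<^bsub>V\<^esub>)) = 0"
      unfolding f_smult[OF A.M.zero_closed] B.phi_smult[OF f[OF A.M.zero_closed]] by simp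
    moreover have "A.lin (0 \<odot>\<^bsub>V\<^esub> \<zero>\<^bsub>V\<^esub>) = 0"
      unfolding A.lin_smult[OF A.M.zero_closed] by simp
    ultimately show ?case using A.smult_simps(2)[OF A.M.zero_closed] by simp
  next
    case (smult j a)
    note j = A.b_closed[OF smult]
    show ?case
      unfolding f_smult[OF j] B.phi_smult[OF f[OF j]] A.lin_smult[OF j] A.lin_b[OF smult]
      by (simp add: psubst_mult \<sigma>_def)
  next
    case (add x y)
    then show ?case
      by (simp add: f_add B.phi_add f A.lin_add psubst_add)
  qed
  have h_hom: "h \<in> alg_hom A.S B.S"
    unfolding alg_hom_def
  proof
    show "h \<in> Ring.ring_hom A.S B.S"
    proof (rule ring_hom_memI)
      fix X Y assume XY: "X \<in> carrier A.S" "Y \<in> carrier A.S"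
      show "h (X \<otimes>\<^bsub>A.S\<^esub> Y) = h X \<otimes>\<^bsub>B.S\<^esub> h Y"
        by (subst B.phi_inject[symmetric])
          (simp_all add: XY A.S_closed B.S_closed h_closed phi_h A.phi_mult B.phi_mult psubst_mult)
      show "h (X \<oplus>\<^bsub>A.S\<^esub> Y) = h X \<oplus>\<^bsub>B.S\<^esub> h Y"
        by (subst B.phi_inject[symmetric])
          (simp_all add: XY A.S_closed B.S_closed h_closed phi_h A.phi_add B.phi_add psubst_add)
    next
      show "h \<one>\<^bsub>A.S\<^esub> = \<one>\<^bsub>B.S\<^esub>"
        by (subst B.phi_inject[symmetric])
          (simp_all add: A.S_closed B.S_closed h_closed phi_h A.phi_one B.phi_one)
    qed (rule h_closed)
    have "h (X \<oplus>\<^bsub>A.S\<^esub> Y) = h X \<oplus>\<^bsub>B.S\<^esub> h Y" if "X \<in> carrier A.S" "Y \<in> carrier A.S" for X Y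
      by (subst B.phi_inject[symmetric])
        (simp_all add: that A.S_closed B.S_closed h_closed phi_h A.phi_add B.phi_add psubst_add)
    moreover have "h (a \<odot>\<^bsub>A.S\<^esub> X) = a \<odot>\<^bsub>B.S\<^esub> h X" if "X \<in> carrier A.S" for a X
      by (subst B.phi_inject[symmetric])
        (simp_all add: that A.S_closed B.S_closed h_closed phi_h A.phi_smult B.phi_smult psubst_mult)
    ultimately show "h \<in> LinearCombinations.module_hom FF A.S B.S"
      unfolding LinearCombinations.module_hom_def using h_closed by simp
  qed
  have h_incl: "h (sym_incl V x) = f x" if "x \<in> carrier V" for x
    by (subst B.phi_inject[symmetric])
      (simp_all add: that h_closed f phi_h A.sym_incl_closed A.phi_incl f_lin)
  have uniq: "h' = h" if h': "h' \<in> alg_hom A.S B.S" "h' \<in> extensional (carrier A.S)"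
    "\<forall>x\<in>carrier V. h' (sym_incl V x) = f x" for h'
  proof (rule extensionalityI[OF h'(2)])
    show "h \<in> extensional (carrier A.S)" unfolding h_def by simp
    have rh: "h' \<in> Ring.ring_hom A.S B.S" and mh: "h' \<in> LinearCombinations.module_hom FF A.S B.S"
      using h'(1) unfolding alg_hom_def by blast+
    note h'_closed = ring_hom_closed[OF rh] and h'_mult = ring_hom_mult[OF rh]
      and h'_add = ring_hom_add[OF rh] and h'_one = ring_hom_one[OF rh]
    have h'_smult: "h' (a \<odot>\<^bsub>A.S\<^esub> X) = a \<odot>\<^bsub>B.S\<^esub> h' X" if "X \<in> carrier A.S" for a X
      using LinearCombinations.module_hom_smult[OF mh _ that, of a] by simp
    fix X assume "X \<in> carrier A.S"
    then obtain p where p: "p \<in> polys (carrier V)" "X = A.Q.cls p" by (rule A.S_cases)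
    have "B.phi (h' (A.Q.cls p)) = psubst (\<lambda>v. B.phi (f v)) p"
    proof (rule hom_eq_psubst[where H = "\<lambda>p. B.phi (h' (A.Q.cls p))", OF p(1)])
      fix a
      have "A.Q.cls (Const a) = a \<odot>\<^bsub>A.S\<^esub> \<one>\<^bsub>A.S\<^esub>"
        unfolding A.one_S A.smult_S[OF polys_1] by simp
      then show "B.phi (h' (A.Q.cls (Const a))) = Const a"
        by (simp add: h'_smult A.S_closed h'_one B.phi_smult B.S_closed B.phi_one)
    next
      fix v assume "v \<in> carrier V"
      then show "B.phi (h' (A.Q.cls (var v))) = B.phi (f v)"
        using h'(3) by (simp flip: A.sym_incl_eq)
    next
      fix p q :: "('v, 'f) mpoly"
      assume pq: "p \<in> polys (carrier V)" "q \<in> polys (carrier V)"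
      note cl = A.cls_closed[OF pq(1)] A.cls_closed[OF pq(2)]
      show "B.phi (h' (A.Q.cls (p + q))) = B.phi (h' (A.Q.cls p)) + B.phi (h' (A.Q.cls q))"
        unfolding A.Q.add_Q[symmetric] h'_add[OF cl] by (rule B.phi_add[OF cl[THEN h'_closed]])
      show "B.phi (h' (A.Q.cls (p * q))) = B.phi (h' (A.Q.cls p)) * B.phi (h' (A.Q.cls q))"
        unfolding A.mult_S[OF pq, symmetric] h'_mult[OF cl] by (rule B.phi_mult[OF cl[THEN h'_closed]])
    qed
    also have "\<dots> = psubst (\<lambda>v. psubst \<sigma> (A.lin v)) p"
      by (rule psubst_cong[OF p(1) f_lin])
    also have "\<dots> = psubst \<sigma> (psubst A.lin p)" by (simp add: psubst_psubst)
    also have "\<dots> = B.phi (h X)"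
      unfolding phi_h[OF \<open>X \<in> carrier A.S\<close>] unfolding p(2) A.phi_cls[OF p(1)] ..
    finally show "h' X = h X"
      unfolding p(2)
      by (subst (asm) B.phi_inject) (simp_all add: h'_closed h_closed A.cls_closed[OF p(1)])
  qed
  have "sym_extend V (sym_algebra V') f = h"
    unfolding sym_extend_def
  proof (rule the_equality)
    show "h \<in> alg_hom A.S B.S \<and> h \<in> extensional (carrier A.S) \<and>
        (\<forall>x\<in>carrier V. h (sym_incl V x) = f x)"
      using h_hom h_incl by (simp add: h_def)
  qed (elim conjE, rule uniq)
  then show "sym_extend V (sym_algebra V') f X \<in> carrier (sym_algebra V')"
    "B.phi (sym_extend V (sym_algebra V') f X) = psubst (\<lambda>j. B.phi (f (b j))) (A.phi X)"
    using h_closed[OF X] phi_h[OF X] by (simp_all add: \<sigma>_def[abs_def])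
qed

text \<open>
  Matches the shape of the products that span the homogeneous parts of a symmetric algebra.
\<close>

lemma monomial_as_prod:
  "keys m \<subseteq> X \<Longrightarrow> \<exists>n u. u \<in> {..<n::nat} \<rightarrow> X \<and>
    (Poly_Mapping.single m 1 :: ('x, 'f::field) mpoly) = (\<Prod>i<n. var (u i))"
proof (induction rule: monomial_induct)
  case one
  show ?case by (intro exI[of _ 0]) simp
next
  case (var_mult x m)
  then obtain n u where u: "u \<in> {..<n::nat} \<rightarrow> X"
    "(Poly_Mapping.single m 1 :: ('x, 'f) mpoly) = (\<Prod>i<n. var (u i))" by blast
  have "(Poly_Mapping.single (Poly_Mapping.single x 1 + m) 1 :: ('x, 'f) mpoly) =
      Poly_Mapping.single m 1 * var x"
    by (simp add: var_def monomial_def mult_single add.commute)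
  also have "\<dots> = (\<Prod>i<Suc n. var ((u(n := x)) i))" unfolding u(2) by simp
  finally show ?case
    using u(1) var_mult(1) by (intro exI[of _ "Suc n"] exI[of _ "u(n := x)"]) (auto simp: less_Suc_eq)
qed

text \<open>
  From coordinates \<open>c\<close> of \<open>L\<close> and the basis of the powers \<open>\<tau>\<^sup>\<omega>\<close> of \<open>A\<close>, the tensor product gets
  coordinates indexed by pairs \<open>(j, \<omega>)\<close>.
\<close>

locale current_coords = LC: coord_system L "{..<n}" b c
  for L :: "('f::field, 'g) Module.module" and n :: nat and b c +
  fixes l :: nat and \<Omega>0 :: "(nat \<Rightarrow>\<^sub>0 nat) set"
  assumes \<Omega>0_sub: "\<Omega>0 \<subseteq> exps l" and fin_\<Omega>1: "finite (exps l - \<Omega>0)"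
begin

abbreviation "A \<equiv> trunc_algebra l \<Omega>0 :: ('f, (nat, 'f) mpoly set) Module.module"
abbreviation "W \<equiv> exps l - \<Omega>0"

sublocale AC: coord_system A W "trunc_mono l \<Omega>0" trunc_coord
  by (rule trunc_coord_system[OF \<Omega>0_sub fin_\<Omega>1])

sublocale T: tensor_coords L "{..<n}" b c A W "trunc_mono l \<Omega>0" trunc_coord ..

sublocale SL: sym_coords L "{..<n}" b c ..

abbreviation "bV \<equiv> \<lambda>(j, w). pure_tensor L A (b j) (trunc_mono l \<Omega>0 w)"
abbreviation "cV \<equiv> tensor_coord c trunc_coord"

lemma current_space_eq: "current_space L l \<Omega>0 = tensor_module L A"
  by (simp add: current_space_def)

sublocale SV: sym_coords "current_space L l \<Omega>0" "{..<n} \<times> W" bV cV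
  unfolding current_space_eq
  by (intro sym_coords.intro T.tensor_coord_system)

lemma pure_closed: "x \<in> carrier L \<Longrightarrow> y \<in> carrier A \<Longrightarrow>
    pure_tensor L A x y \<in> carrier (current_space L l \<Omega>0)"
  unfolding current_space_eq T.tensor_module_eq by (rule T.pure_closed)

lemma lin_pure:
  assumes "x \<in> carrier L" "y \<in> carrier A"
  shows "SV.lin (pure_tensor L A x y) =
    (\<Sum>j<n. \<Sum>w\<in>W. Const (c j x * trunc_coord w y) * var (j, w))"
proof -
  have "SV.lin (pure_tensor L A x y) =
      (\<Sum>(j, w)\<in>{..<n} \<times> W. Const (c j x * trunc_coord w y) * var (j, w))"
    unfolding SV.lin_def
    by (intro sum.cong) (auto simp: T.tensor_coord_pure assms)
  then show ?thesis by (simp add: sum.cartesian_product)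
qed

abbreviation "all_ones \<equiv> \<Oplus>\<^bsub>A\<^esub>w\<in>W. trunc_mono l \<Omega>0 w"

lemma all_ones_closed: "all_ones \<in> carrier A"
  using AC.b_closed by (intro AC.M.finsum_closed) auto

lemma trunc_coord_all_ones: "w \<in> W \<Longrightarrow> trunc_coord w all_ones = (1 :: 'f)"
proof -
  assume w: "w \<in> W"
  have "trunc_coord w all_ones = (\<Sum>v\<in>W. trunc_coord w (trunc_mono l \<Omega>0 v) :: 'f)"
    using AC.b_closed by (intro AC.c_finsum[OF w]) auto
  also have "\<dots> = (\<Sum>v\<in>W. if w = v then 1 else 0)"
    using AC.c_b w by (intro sum.cong) auto
  finally show ?thesis using w fin_\<Omega>1 by simp
qed

text \<open>
  The element \<open>a\<close> has all coordinates equal to \<open>1\<close>, so \<open>x\<^sub>j \<otimes> a\<close> is the sum of the variables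
  \<open>(j, \<omega>)\<close>.
\<close>

lemma phi_tau:
  assumes X: "X \<in> carrier (sym_algebra L)"
  shows "tau_hom L l \<Omega>0 X \<in> carrier (sym_algebra (current_space L l \<Omega>0))"
    and "SV.phi (tau_hom L l \<Omega>0 X) = hat W (SL.phi X)"
proof -
  let ?V = "current_space L l \<Omega>0" and ?f = "\<lambda>x. sym_incl (current_space L l \<Omega>0) (pure_tensor L A x all_ones)"
  have tau: "tau_hom L l \<Omega>0 = sym_extend L (sym_algebra ?V) ?f"
    by (simp add: tau_hom_def Let_def)
  have closed: "?f x \<in> carrier (sym_algebra ?V)" if "x \<in> carrier L" for x
    using that all_ones_closed by (intro SV.sym_incl_closed pure_closed)
  have phi_f: "SV.phi (?f x) = (\<Sum>j<n. \<Sum>w\<in>W. Const (c j x) * var (j, w))"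
    if "x \<in> carrier L" for x
    using that all_ones_closed
    by (simp add: SV.phi_incl pure_closed lin_pure trunc_coord_all_ones)
  have ext: "?f (x \<oplus>\<^bsub>L\<^esub> y) = ?f x \<oplus>\<^bsub>sym_algebra ?V\<^esub> ?f y"
    if "x \<in> carrier L" "y \<in> carrier L" for x y
    by (subst SV.phi_inject[symmetric])
      (simp_all add: that closed SV.S_closed SV.phi_add phi_f LC.c_add single_add distrib_right
        sum.distrib)
  have sml: "?f (a \<odot>\<^bsub>L\<^esub> x) = a \<odot>\<^bsub>sym_algebra ?V\<^esub> ?f x" if "x \<in> carrier L" for a x
    by (subst SV.phi_inject[symmetric])
      (simp_all add: that closed SV.S_closed SV.phi_smult phi_f LC.c_smult LC.smult_simps(3)
        sum_distrib_left flip: mult.assoc)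
  note ex = sym_extend_phi[OF SL.sym_coords_axioms SV.sym_coords_axioms closed ext sml X]
  show "tau_hom L l \<Omega>0 X \<in> carrier (sym_algebra ?V)"
    unfolding tau by (rule ex(1))
  have "SV.phi (tau_hom L l \<Omega>0 X) = psubst (\<lambda>j. SV.phi (?f (b j))) (SL.phi X)"
    unfolding tau by (rule ex(2))
  also have "\<dots> = psubst (\<lambda>j. \<Sum>w\<in>W. var (j, w)) (SL.phi X)"
  proof (rule psubst_cong[OF SL.polys_phi[OF X]])
    fix j assume j: "j \<in> {..<n}"
    have "SV.phi (?f (b j)) = (\<Sum>i<n. if i = j then (\<Sum>w\<in>W. var (j, w)) else 0)"
      unfolding phi_f[OF LC.b_closed[OF j]] using j by (intro sum.cong) (auto simp: LC.c_b)
    then show "SV.phi (?f (b j)) = (\<Sum>w\<in>W. var (j, w))" using j by simp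
  qed
  finally show "SV.phi (tau_hom L l \<Omega>0 X) = hat W (SL.phi X)" by (simp add: hat_def)
qed

abbreviation "SA \<equiv> sym_algebra (current_space L l \<Omega>0)"

definition degree_gens :: "(nat \<Rightarrow> int) \<Rightarrow> ('f, ('f, 'g) tensor_trunc) sym set" where
  "degree_gens \<gamma> =
    {\<Otimes>\<^bsub>SA\<^esub>i\<in>{..<n::nat}. sym_incl (current_space L l \<Omega>0) (pure_tensor L A (x i) (trunc_mono l \<Omega>0 (w i)))
      | n x w. x \<in> {..<n} \<rightarrow> carrier L \<and> w \<in> {..<n} \<rightarrow> W \<and>
          (\<forall>j. (\<Sum>i<n. int (lookup (w i) j)) = \<gamma> j)}"

lemma sym_degree_part_eq: "sym_degree_part L l \<Omega>0 \<gamma> = lin_span SA (degree_gens \<gamma>)"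
  by (simp add: sym_degree_part_def degree_gens_def Let_def)

lemma incl_pure_closed:
  "x \<in> carrier L \<Longrightarrow> w \<in> W \<Longrightarrow>
    sym_incl (current_space L l \<Omega>0) (pure_tensor L A x (trunc_mono l \<Omega>0 w)) \<in> carrier SA"
  using AC.b_closed by (intro SV.sym_incl_closed pure_closed)

lemma phi_incl_pure:
  assumes "x \<in> carrier L" "w \<in> W"
  shows "SV.phi (sym_incl (current_space L l \<Omega>0) (pure_tensor L A x (trunc_mono l \<Omega>0 w))) =
    (\<Sum>j<n. Const (c j x) * var (j, w))"
proof -
  have "SV.phi (sym_incl (current_space L l \<Omega>0) (pure_tensor L A x (trunc_mono l \<Omega>0 w))) =
      (\<Sum>j<n. \<Sum>v\<in>W. Const (c j x * trunc_coord v (trunc_mono l \<Omega>0 w)) * var (j, v))"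
    using assms AC.b_closed by (simp add: SV.phi_incl pure_closed lin_pure)
  also have "\<dots> = (\<Sum>j<n. \<Sum>v\<in>W. if v = w then Const (c j x) * var (j, w) else 0)"
    using assms AC.c_b by (intro sum.cong) auto
  finally show ?thesis using assms fin_\<Omega>1 by simp
qed

lemma degree_gens_phi:
  assumes "X \<in> degree_gens \<gamma>"
  shows "X \<in> carrier SA" "whomog vw \<gamma> (SV.phi X)"
proof -
  interpret SA: cring SA by (rule SV.cring_S)
  obtain k x w where X: "X = (\<Otimes>\<^bsub>SA\<^esub>i\<in>{..<k::nat}. sym_incl (current_space L l \<Omega>0)
      (pure_tensor L A (x i) (trunc_mono l \<Omega>0 (w i))))"
    and x: "x \<in> {..<k} \<rightarrow> carrier L" and w: "w \<in> {..<k} \<rightarrow> W"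
    and deg: "\<forall>j. (\<Sum>i<k. int (lookup (w i) j)) = \<gamma> j"
    using assms unfolding degree_gens_def by (elim CollectE exE conjE)
  let ?F = "\<lambda>i. sym_incl (current_space L l \<Omega>0) (pure_tensor L A (x i) (trunc_mono l \<Omega>0 (w i)))"
  have F: "?F \<in> {..<k} \<rightarrow> carrier SA"
    using x w by (intro Pi_I incl_pure_closed) auto
  then show "X \<in> carrier SA" unfolding X by (rule SA.finprod_closed)
  have "SV.phi X = (\<Prod>i<k. SV.phi (?F i))" unfolding X by (rule SV.phi_finprod[OF F])
  also have "whomog vw (\<Sum>i<k. int_exp (w i)) \<dots>"
  proof (rule whomog_prod)
    fix i assume i: "i \<in> {..<k}"
    have "whomog vw (int_exp (w i)) (\<Sum>j<n. Const (c j (x i)) * var (j, w i))"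
      using whomog_var[of vw] by (intro whomog_sum whomog_Const_mult) force
    then show "whomog vw (int_exp (w i)) (SV.phi (?F i))"
      using x w i by (simp add: phi_incl_pure Pi_iff)
  qed
  also have "(\<Sum>i<k. int_exp (w i)) = \<gamma>"
  proof
    fix j
    have "(\<Sum>i<k. int_exp (w i)) j = (\<Sum>i<k. int_exp (w i) j)" by (induction k) (simp_all add: int_exp_def)
    then show "(\<Sum>i<k. int_exp (w i)) j = \<gamma> j" using deg by (simp add: int_exp_def)
  qed
  finally show "whomog vw \<gamma> (SV.phi X)" .
qed

text \<open>
  The factor \<open>x \<otimes> \<tau>\<^sup>\<omega>\<close> with arbitrary \<open>x\<close> becomes a linear form in variables \<open>(j, \<omega>)\<close> with the
  same \<open>\<omega>\<close>, so products of degree \<open>\<gamma>\<close> become homogeneous of weight \<open>\<gamma>\<close>.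
\<close>

lemma degree_part_phi:
  assumes "X \<in> sym_degree_part L l \<Omega>0 \<gamma>"
  shows "X \<in> carrier SA" "whomog vw \<gamma> (SV.phi X)"
proof -
  have gens: "degree_gens \<gamma> \<subseteq> carrier SA" using degree_gens_phi(1) by blast
  show "X \<in> carrier SA"
    using assms lin_span_closed(1)[OF SV.module_S gens] unfolding sym_degree_part_eq by blast
  show "whomog vw \<gamma> (SV.phi X)"
    by (rule SV.phi_lin_span[OF gens assms[unfolded sym_degree_part_eq]])
      (simp_all add: degree_gens_phi(2) whomog_add whomog_Const_mult)
qed

text \<open>
  A monomial of weight \<open>\<gamma>\<close> is the image of a product of elements \<open>b j \<otimes> \<tau>\<^sup>\<omega>\<close> of degree \<open>\<gamma>\<close>.
\<close>

lemma psi_degree_part: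
  assumes p: "p \<in> polys ({..<n} \<times> W)" and hom: "whomog vw \<gamma> p"
  shows "SV.psi p \<in> sym_degree_part L l \<Omega>0 \<gamma>"
proof -
  have gens: "degree_gens \<gamma> \<subseteq> carrier SA" using degree_gens_phi(1) by blast
  note cl = lin_span_closed[OF SV.module_S gens, folded sym_degree_part_eq]
  have mono: "SV.psi (Poly_Mapping.single m 1) \<in> degree_gens \<gamma>" if m: "m \<in> keys p" for m
  proof -
    have keys_m: "keys m \<subseteq> {..<n} \<times> W" using p m by blast
    have wdeg_m: "wdeg vw m = \<gamma>" using hom m by (simp add: whomog_def)
    obtain k u where u: "u \<in> {..<k::nat} \<rightarrow> {..<n} \<times> W"
      "(Poly_Mapping.single m 1 :: (_, 'f) mpoly) = (\<Prod>i<k. var (u i))"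
      using monomial_as_prod[OF keys_m] by blast
    define x where "x i = b (fst (u i))" for i
    define w where "w i = snd (u i)" for i
    have x: "x \<in> {..<k} \<rightarrow> carrier L" and w: "w \<in> {..<k} \<rightarrow> W"
      using u(1) LC.b_closed unfolding x_def w_def by (auto simp: Pi_iff mem_Times_iff)
    let ?F = "\<lambda>i. sym_incl (current_space L l \<Omega>0) (pure_tensor L A (x i) (trunc_mono l \<Omega>0 (w i)))"
    have F: "?F \<in> {..<k} \<rightarrow> carrier SA"
      using x w by (intro Pi_I incl_pure_closed) auto
    interpret SA: cring SA by (rule SV.cring_S)
    have phiF: "SV.phi (?F i) = var (u i)" if i: "i \<in> {..<k}" for i
    proof -
      have ui: "fst (u i) \<in> {..<n}" using u(1) i by (auto simp: Pi_iff mem_Times_iff)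
      have "SV.phi (?F i) = (\<Sum>j<n. Const (c j (x i)) * var (j, w i))"
        using x w i by (intro phi_incl_pure) auto
      also have "\<dots> = (\<Sum>j<n. if j = fst (u i) then var (u i) else 0)"
        unfolding x_def w_def using ui by (intro sum.cong) (auto simp: LC.c_b)
      finally show ?thesis using ui by simp
    qed
    have "SV.phi (\<Otimes>\<^bsub>SA\<^esub>i\<in>{..<k}. ?F i) = (\<Prod>i<k. SV.phi (?F i))"
      by (rule SV.phi_finprod[OF F])
    also have "\<dots> = Poly_Mapping.single m 1" unfolding u(2) by (rule prod.cong[OF refl phiF])
    finally have "SV.psi (Poly_Mapping.single m 1) = (\<Otimes>\<^bsub>SA\<^esub>i\<in>{..<k}. ?F i)"
      using SV.psi_phi[OF SA.finprod_closed[OF F]] by simp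
    moreover have "(\<Sum>i<k. int (lookup (w i) j)) = \<gamma> j" for j
    proof -
      have "whomog vw (\<Sum>i<k. vw (u i)) (\<Prod>i<k. var (u i) :: (_, 'f) mpoly)"
        by (rule whomog_prod) (rule whomog_var[of vw])
      then have "wdeg vw m = (\<Sum>i<k. vw (u i))"
        unfolding u(2)[symmetric] by (simp add: whomog_def)
      then have "\<gamma> j = (\<Sum>i<k. vw (u i)) j" unfolding wdeg_m by simp
      also have "\<dots> = (\<Sum>i<k. vw (u i) j)" by (induction k) (simp_all add: int_exp_def)
      finally show ?thesis by (simp add: int_exp_def w_def)
    qed
    ultimately show ?thesis unfolding degree_gens_def using x w by blast
  qed
  have "SV.psi (\<Sum>m\<in>S. Const (lookup p m) * Poly_Mapping.single m 1) \<in> sym_degree_part L l \<Omega>0 \<gamma>"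
    if "finite S" "S \<subseteq> keys p" for S
    using that
  proof induction
    case empty
    show ?case using cl(2) by (simp add: SV.psi_0)
  next
    case (insert m S)
    have "SV.psi (Poly_Mapping.single m 1) \<in> sym_degree_part L l \<Omega>0 \<gamma>"
      using mono insert(4) lin_span_superset[OF SV.module_S gens]
      unfolding sym_degree_part_eq by blast
    then have "lookup p m \<odot>\<^bsub>SA\<^esub> SV.psi (Poly_Mapping.single m 1) \<in> sym_degree_part L l \<Omega>0 \<gamma>"
      by (rule cl(4))
    moreover have m: "Poly_Mapping.single m 1 \<in> polys ({..<n} \<times> W)" using p insert(4) by auto
    ultimately have "SV.psi (Const (lookup p m) * Poly_Mapping.single m 1) \<in> sym_degree_part L l \<Omega>0 \<gamma>"
      unfolding SV.psi_Const_mult[OF m] by blast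
    then show ?case
      unfolding sum.insert[OF insert(1,2)] SV.psi_add using insert by (intro cl(3)) auto
  qed
  from this[OF finite_keys order.refl]
  have "SV.psi (\<Sum>m\<in>keys p. Const (lookup p m) * Poly_Mapping.single m 1)
    \<in> sym_degree_part L l \<Omega>0 \<gamma>" .
  also have "(\<Sum>m\<in>keys p. Const (lookup p m) * Poly_Mapping.single m 1) = p"
    by (rule poly_mapping_eqI) (simp add: lookup_sum lookup_single when_def in_keys_iff)
  finally show ?thesis .
qed

text \<open>
  By the two preceding lemmas the degree parts correspond to the weight components of polynomials.
  Splitting a polynomial by weight gives a decomposition, and taking the component of weight \<open>\<gamma>\<close>
  shows that no other decomposition has a different term at \<open>\<gamma>\<close>.
\<close>

lemma phi_component:
  assumes s: "s \<in> carrier SA" and \<gamma>: "\<gamma> \<in> degs l"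
  shows "sym_component L l \<Omega>0 \<gamma> s \<in> carrier SA"
    and "SV.phi (sym_component L l \<Omega>0 \<gamma> s) = wcomp vw \<gamma> (SV.phi s)"
proof -
  let ?P = "SV.phi s"
  let ?spec = "\<lambda>q. (\<forall>\<delta>\<in>degs l. q \<delta> \<in> sym_degree_part L l \<Omega>0 \<delta>) \<and>
      finite {\<delta>\<in>degs l. q \<delta> \<noteq> \<zero>\<^bsub>SA\<^esub>} \<and>
      s = (\<Oplus>\<^bsub>SA\<^esub>\<delta>\<in>{\<delta>\<in>degs l. q \<delta> \<noteq> \<zero>\<^bsub>SA\<^esub>}. q \<delta>)"
  interpret SA: cring SA by (rule SV.cring_S)
  have P: "?P \<in> polys ({..<n} \<times> W)" by (rule SV.polys_phi[OF s])
  define q0 where "q0 \<delta> = SV.psi (wcomp vw \<delta> ?P)" for \<delta>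
  have wc: "wcomp vw \<delta> ?P \<in> polys ({..<n} \<times> W)" for \<delta> by (rule polys_wcomp[OF P])
  have phi_q0: "SV.phi (q0 \<delta>) = wcomp vw \<delta> ?P" for \<delta>
    unfolding q0_def by (rule SV.phi_psi[OF wc])
  have q0_closed: "q0 \<delta> \<in> carrier SA" for \<delta> unfolding q0_def by (rule SV.psi_closed[OF wc])
  have q0_zero: "q0 \<delta> = \<zero>\<^bsub>SA\<^esub> \<longleftrightarrow> wcomp vw \<delta> ?P = 0" for \<delta>
    using SV.phi_inject[OF q0_closed SA.zero_closed, of \<delta>] by (simp add: phi_q0 SV.phi_zero)
  let ?D = "{\<delta>\<in>degs l. q0 \<delta> \<noteq> \<zero>\<^bsub>SA\<^esub>}" and ?K = "wdeg vw ` keys ?P"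
  have deg: "wdeg vw m \<in> degs l" if m: "m \<in> keys ?P" for m
  proof -
    have "keys m \<subseteq> {..<n} \<times> W" using P m by blast
    then show ?thesis
    proof (induction rule: monomial_induct)
      case one
      show ?case unfolding wdeg_0 by (simp add: degs_def)
    next
      case (var_mult v m')
      then have "vw v \<in> degs l" by (auto simp: degs_def int_exp_def exps_def in_keys_iff)
      then show ?case using var_mult(3) by (simp add: degs_def)
    qed
  qed
  have DK: "?D \<subseteq> ?K"
  proof
    fix \<delta> assume "\<delta> \<in> ?D"
    then have "wcomp vw \<delta> ?P \<noteq> 0" using q0_zero by blast
    then obtain m where "lookup (wcomp vw \<delta> ?P) m \<noteq> 0"
      by (metis poly_mapping_eqI lookup_zero)
    then show "\<delta> \<in> ?K" by (auto simp: lookup_wcomp in_keys_iff split: if_splits)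
  qed
  have spec0: "?spec q0"
  proof (intro conjI ballI)
    show "q0 \<delta> \<in> sym_degree_part L l \<Omega>0 \<delta>" for \<delta>
      unfolding q0_def by (rule psi_degree_part[OF wc whomog_wcomp])
    show "finite ?D" using DK by (rule finite_subset) simp
    have "SV.phi (\<Oplus>\<^bsub>SA\<^esub>\<delta>\<in>?D. q0 \<delta>) = (\<Sum>\<delta>\<in>?D. wcomp vw \<delta> ?P)"
      using q0_closed by (subst SV.phi_finsum) (auto simp: phi_q0)
    also have "\<dots> = (\<Sum>\<delta>\<in>?K. wcomp vw \<delta> ?P)"
      using DK deg q0_zero by (intro sum.mono_neutral_left) auto
    also have "\<dots> = ?P" by (rule sum_wcomp) simp_all
    finally show "s = (\<Oplus>\<^bsub>SA\<^esub>\<delta>\<in>?D. q0 \<delta>)"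
      using SV.phi_inject[OF s SA.finsum_closed, of q0 ?D] q0_closed by simp
  qed
  have uniq: "u = q0 \<gamma>" if q: "?spec q" and u: "u = q \<gamma>" for q u
  proof -
    let ?E = "{\<delta>\<in>degs l. q \<delta> \<noteq> \<zero>\<^bsub>SA\<^esub>}"
    have part: "q \<delta> \<in> carrier SA" "whomog vw \<delta> (SV.phi (q \<delta>))" if "\<delta> \<in> degs l" for \<delta>
      using degree_part_phi q that by blast+
    have fin: "finite ?E" using q by blast
    have s_eq: "s = (\<Oplus>\<^bsub>SA\<^esub>\<delta>\<in>?E. q \<delta>)" using q by blast
    have "?P = (\<Sum>\<delta>\<in>?E. SV.phi (q \<delta>))"
      by (subst s_eq, rule SV.phi_finsum) (use part in auto)
    then have "wcomp vw \<gamma> ?P = (\<Sum>\<delta>\<in>?E. wcomp vw \<gamma> (SV.phi (q \<delta>)))" by (simp add: wcomp_sum)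
    also have "\<dots> = (\<Sum>\<delta>\<in>?E. if \<delta> = \<gamma> then SV.phi (q \<gamma>) else 0)"
      using wcomp_whomog[OF part(2)] by (intro sum.cong) auto
    also have "\<dots> = SV.phi (q \<gamma>)"
      using fin \<gamma> by (auto simp: SV.phi_zero)
    finally have "SV.phi (q \<gamma>) = SV.phi (q0 \<gamma>)" by (simp add: phi_q0)
    then show ?thesis
      using SV.phi_inject[OF part(1)[OF \<gamma>] q0_closed] u by simp
  qed
  have "sym_component L l \<Omega>0 \<gamma> s = q0 \<gamma>"
    unfolding sym_component_def Let_def
  proof (rule the_equality)
    show "\<exists>q. (\<forall>\<delta>\<in>degs l. q \<delta> \<in> sym_degree_part L l \<Omega>0 \<delta>) \<and>
        finite {\<delta>\<in>degs l. q \<delta> \<noteq> \<zero>\<^bsub>SA\<^esub>} \<and>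
        s = (\<Oplus>\<^bsub>SA\<^esub>\<delta>\<in>{\<delta>\<in>degs l. q \<delta> \<noteq> \<zero>\<^bsub>SA\<^esub>}. q \<delta>) \<and> q0 \<gamma> = q \<gamma>"
      using spec0 by (intro exI[of _ q0]) (elim conjE, intro conjI refl)
  next
    fix u
    assume "\<exists>q. (\<forall>\<delta>\<in>degs l. q \<delta> \<in> sym_degree_part L l \<Omega>0 \<delta>) \<and>
        finite {\<delta>\<in>degs l. q \<delta> \<noteq> \<zero>\<^bsub>SA\<^esub>} \<and>
        s = (\<Oplus>\<^bsub>SA\<^esub>\<delta>\<in>{\<delta>\<in>degs l. q \<delta> \<noteq> \<zero>\<^bsub>SA\<^esub>}. q \<delta>) \<and> u = q \<gamma>"
    then obtain q where "?spec q" "u = q \<gamma>" by (elim exE conjE) (rule that, intro conjI)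
    then show "u = q0 \<gamma>" by (rule uniq)
  qed
  then show "sym_component L l \<Omega>0 \<gamma> s \<in> carrier SA"
    "SV.phi (sym_component L l \<Omega>0 \<gamma> s) = wcomp vw \<gamma> ?P"
    using q0_closed phi_q0 by simp_all
qed

lemma sym_power_phi:
  assumes "X \<in> sym_power L k"
  shows "X \<in> carrier (sym_algebra L)" "whomog (\<lambda>_. 1) k (SL.phi X)"
proof -
  interpret S: cring "sym_algebra L" by (rule SL.cring_S)
  let ?G = "{\<Otimes>\<^bsub>sym_algebra L\<^esub>j\<in>{..<k}. sym_incl L (x j) | x. x \<in> {..<k} \<rightarrow> carrier L}"
  have gen: "g \<in> carrier (sym_algebra L) \<and> whomog (\<lambda>_. 1) k (SL.phi g)" if gG: "g \<in> ?G" for g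
  proof -
    obtain x where g: "g = (\<Otimes>\<^bsub>sym_algebra L\<^esub>j\<in>{..<k}. sym_incl L (x j))"
      and x: "x \<in> {..<k} \<rightarrow> carrier L" using gG by (elim CollectE exE conjE)
    have F: "(\<lambda>j. sym_incl L (x j)) \<in> {..<k} \<rightarrow> carrier (sym_algebra L)"
      using x by (intro Pi_I SL.sym_incl_closed) auto
    have "SL.phi g = (\<Prod>j<k. SL.phi (sym_incl L (x j)))" unfolding g by (rule SL.phi_finprod[OF F])
    also have "whomog (\<lambda>_. 1) (\<Sum>j<k. 1::nat) \<dots>"
    proof (rule whomog_prod)
      fix j assume "j \<in> {..<k}"
      then have xj: "x j \<in> carrier L" using x by auto
      show "whomog (\<lambda>_. 1) 1 (SL.phi (sym_incl L (x j)))"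
        unfolding SL.phi_incl[OF xj] SL.lin_def
        by (intro whomog_sum whomog_Const_mult whomog_var[of "\<lambda>_. 1"])
    qed
    finally show ?thesis unfolding g using S.finprod_closed[OF F] by simp
  qed
  then have gens: "?G \<subseteq> carrier (sym_algebra L)" by blast
  show "X \<in> carrier (sym_algebra L)"
    using assms lin_span_closed(1)[OF SL.module_S gens] unfolding sym_power_def by blast
  show "whomog (\<lambda>_. 1) k (SL.phi X)"
    by (rule SL.phi_lin_span[OF gens assms[unfolded sym_power_def]])
      (simp_all only: gen whomog_0 whomog_add whomog_Const_mult)
qed

end

section \<open>Independence of the components\<close>

theorem proposition3p11:
  fixes L :: "('f::field_char_0, 'g) module"
    and bracket :: "'g \<Rightarrow> 'g \<Rightarrow> 'g"
    and l r :: nat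
    and \<Omega>0 \<Omega>1 :: "(nat \<Rightarrow>\<^sub>0 nat) set"
    and \<mu> :: "nat \<Rightarrow>\<^sub>0 nat"
    and k :: "nat \<Rightarrow> nat"
    and p :: "nat \<Rightarrow> ('f, 'g) sym"
  assumes lie: "lie_algebra class_ring L bracket"
    and fin_dim: "vectorspace.fin_dim class_ring L"
    and \<Omega>0_sub: "\<Omega>0 \<subseteq> exps l"
    and \<Omega>0_closed: "\<And>\<omega> \<gamma>. \<omega> \<in> exps l \<Longrightarrow> \<gamma> \<in> \<Omega>0 \<Longrightarrow> \<omega> + \<gamma> \<in> \<Omega>0"
    and \<Omega>1_eq: "\<Omega>1 = exps l - \<Omega>0"
    and \<Omega>1_finite: "finite \<Omega>1"
    and \<mu>_in: "\<mu> \<in> \<Omega>1"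
    and \<mu>_greatest: "\<And>\<omega>. \<omega> \<in> \<Omega>1 \<Longrightarrow> exp_le \<omega> \<mu>"
    and k_pos: "\<And>i. i \<in> {1..r} \<Longrightarrow> 1 \<le> k i"
    and p_in: "\<And>i. i \<in> {1..r} \<Longrightarrow> p i \<in> sym_power L (k i)"
  shows "alg_indep (sym_algebra L) {1..r} p \<longleftrightarrow>
    alg_indep (sym_algebra (current_space L l \<Omega>0))
      {(i, \<gamma>). i \<in> {1..r} \<and> \<gamma> \<in> mult_minus (k i) \<mu> \<Omega>1}
      (\<lambda>(i, \<gamma>). p_comp L l \<Omega>0 (p i) \<gamma>)"
proof -
  have "vectorspace class_ring L" using lie by (simp add: lie_algebra_def)
  from fin_dim_coord_system[OF this fin_dim]
  obtain n b c where co: "coord_system L {..<n::nat} b c" by (elim exE)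
  interpret CC: current_coords L n b c l \<Omega>0
    using co \<Omega>0_sub \<Omega>1_finite unfolding \<Omega>1_eq
    by (intro current_coords.intro current_coords_axioms.intro)
  let ?G = "{(i, \<gamma>). i \<in> {1..r} \<and> \<gamma> \<in> mult_minus (k i) \<mu> \<Omega>1}"
  have G: "mult_minus (k i) \<mu> \<Omega>1 = (\<lambda>\<omega>. of_nat (k i) * int_exp \<mu> - int_exp \<omega>) ` \<Omega>1" for i
    unfolding mult_minus_def by (auto simp: int_exp_def of_nat_fun fun_eq_iff image_iff)
  have degs: "\<gamma> \<in> degs l" if "\<gamma> \<in> mult_minus (k i) \<mu> \<Omega>1" for i \<gamma>
  proof -
    have "lookup w j = 0" if "w \<in> \<Omega>1" "l \<le> j" for w j
    proof -
      have "j \<notin> keys w" using that unfolding \<Omega>1_eq exps_def by auto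
      then show ?thesis by (simp add: in_keys_iff)
    qed
    then show ?thesis using that \<mu>_in unfolding mult_minus_def by (auto simp: degs_def)
  qed
  have down: "\<mu> - \<omega> \<in> \<Omega>1" if "\<omega> \<in> \<Omega>1" for \<omega>
  proof -
    have "\<omega> + (\<mu> - \<omega>) = \<mu>"
      using \<mu>_greatest[OF that] by (intro poly_mapping_eqI) (simp add: exp_le_def lookup_add lookup_minus)
    moreover have "\<mu> - \<omega> \<in> exps l"
    proof -
      have "keys (\<mu> - \<omega>) \<subseteq> keys \<mu>" by (auto simp: in_keys_iff lookup_minus)
      then show ?thesis using \<mu>_in unfolding \<Omega>1_eq exps_def by auto
    qed
    ultimately show ?thesis
      using \<Omega>0_closed[of \<omega> "\<mu> - \<omega>"] \<mu>_in that unfolding \<Omega>1_eq by auto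
  qed
  have p_closed: "p i \<in> carrier (sym_algebra L)" and p_hom: "whomog (\<lambda>_. 1) (k i) (CC.SL.phi (p i))"
    if "i \<in> {1..r}" for i
    by (rule CC.sym_power_phi[OF p_in[OF that]])+
  have comp: "p_comp L l \<Omega>0 (p i) \<gamma> \<in> carrier (sym_algebra (current_space L l \<Omega>0))"
    "CC.SV.phi (p_comp L l \<Omega>0 (p i) \<gamma>) = wcomp vw \<gamma> (hat \<Omega>1 (CC.SL.phi (p i)))"
    if "i \<in> {1..r}" "\<gamma> \<in> mult_minus (k i) \<mu> \<Omega>1" for i \<gamma>
    unfolding p_comp_def \<Omega>1_eq
    using CC.phi_component[OF CC.phi_tau(1)[OF p_closed[OF that(1)]] degs[OF that(2)]]
      CC.phi_tau(2)[OF p_closed[OF that(1)]] by simp_all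
  have "alg_indep (sym_algebra L) {1..r} p \<longleftrightarrow> pindep {1..r} (\<lambda>i. CC.SL.phi (p i))"
    using p_closed by (intro CC.SL.alg_indep_iff_pindep) auto
  also have "\<dots> \<longleftrightarrow>
      pindep {(i, \<gamma>). i \<in> {1..r} \<and> \<gamma> \<in> (\<lambda>\<omega>. of_nat (k i) * int_exp \<mu> - int_exp \<omega>) ` \<Omega>1}
        (\<lambda>(i, \<gamma>). wcomp vw \<gamma> (hat \<Omega>1 (CC.SL.phi (p i))))"
    by (rule pindep_components_iff[OF finite_atLeastAtMost finite_lessThan
          CC.SL.polys_phi[OF p_closed] p_hom k_pos \<Omega>1_finite \<mu>_in \<mu>_greatest down])
  also have "\<dots> \<longleftrightarrow> pindep ?G (\<lambda>v. CC.SV.phi ((\<lambda>(i, \<gamma>). p_comp L l \<Omega>0 (p i) \<gamma>) v))"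
    unfolding G[symmetric] by (rule pindep_cong) (auto simp: comp(2))
  also have "\<dots> \<longleftrightarrow> alg_indep (sym_algebra (current_space L l \<Omega>0)) ?G
      (\<lambda>(i, \<gamma>). p_comp L l \<Omega>0 (p i) \<gamma>)"
    using comp(1) by (intro CC.SV.alg_indep_iff_pindep[symmetric]) auto
  finally show ?thesis .
qed

end
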